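(* Let $\mu$ be a probability measure on $\partial\mathbb{D}$ with $\mu_{\mathrm s}=0$ satisfying the Szeg\H{o} condition, and let $R>1$. If $D^{-1}$ has an analytic continuation to $\{z:|z|<R\}$, then $F$ is meromorphic there with singularities precisely at the zeros of $D^{-1}$, and the order of any pole of $F$ is precisely the order of the corresponding zero of $D^{-1}$. Moreover $(\delta_0D)(z)$ is meromorphic in $\{z:|z|<R\}$ with poles precisely at the poles of $F$, of order no greater than those of $F$. Finally $(D^{(1)})^{-1}$ is analytic in $\{z:|z|<R\}$, and hence (by induction) so is each $(D^{(n)})^{-1}$, $n\ge1$.
   Context: $\mathbb{D}=\{|z|<1\}$. Write $d\mu=w(\theta)\frac{d\theta}{2\pi}+d\mu_{\mathrm s}$; the Szeg\H{o} condition is $\int\log w\,\frac{d\theta}{2\pi}>-\infty$, and then the Szeg\H{o} function is $D(z)=\exp\bigl(\int\frac{e^{i\theta}+z}{e^{i\theta}-z}\log w(\theta)\frac{d\theta}{4\pi}\bigr)$, $z\in\mathbb{D}$. Let $\alpha_0,\alpha_1,\dots$ be the Verblunsky coefficients of $\mu$ (recursion coefficients $\Phi_{k+1}(z)=z\Phi_k(z)-\bar\alpha_k\Phi_k^*(z)$, $\Phi_k^*(z)=z^k\overline{\Phi_k(1/\bar z)}$ of the monic orthogonal polynomials), $\rho_n=(1-|\alpha_n|^2)^{1/2}$. $\mu^{(n)}$ is the probability measure with Verblunsky coefficients $\{\alpha_{n+k}\}_{k\ge0}$ ($\mu^{(0)}=\mu$), $D^{(n)}$ its Szeg\H{o} function,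 $F^{(n)}(z)=\int\frac{e^{i\theta}+z}{e^{i\theta}-z}d\mu^{(n)}(\theta)$, and $f^{(n)}$ is defined by $F^{(n)}=\frac{1+zf^{(n)}}{1-zf^{(n)}}$. $F=F^{(0)}$, $D=D^{(0)}$, $f=f^{(0)}$. The relative Szeg\H{o} function is $(\delta_0D)(z)=\frac{1-\bar\alpha_0f(z)}{\rho_0}\cdot\frac{1-zf^{(1)}(z)}{1-zf(z)}$, which equals $D(z)/D^{(1)}(z)$ on $\mathbb D$. *)

theory Defs
  imports "HOL-Complex_Analysis.Complex_Analysis" "HOL-Computational_Algebra.Polynomial"
begin

text \<open>Measures on the unit circle are represented as Borel measures on the real line
  (the angle variable theta), concentrated on [0, 2 pi).  The point e^{i theta} is cis theta.\<close>

definition circle_prob :: "real measure \<Rightarrow> bool" where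
  "circle_prob \<nu> \<longleftrightarrow> sets \<nu> = sets borel \<and> emeasure \<nu> UNIV = 1 \<and> emeasure \<nu> {0..<2*pi} = 1"

definition nontrivial_circle :: "real measure \<Rightarrow> bool" where
  "nontrivial_circle \<nu> \<longleftrightarrow> (\<forall>S. finite S \<longrightarrow> emeasure \<nu> (- S) > 0)"

definition arc_measure :: "real measure" where
  "arc_measure = uniform_measure lborel {0..<2*pi}"

definition circ_inner :: "real measure \<Rightarrow> complex poly \<Rightarrow> complex poly \<Rightarrow> complex" where
  "circ_inner \<nu> p q = integral\<^sup>L \<nu> (\<lambda>\<theta>. cnj (poly p (cis \<theta>)) * poly q (cis \<theta>))"

definition mop :: "real measure \<Rightarrow> nat \<Rightarrow> complex poly" where
  "mop \<nu> n = (THE p. degree p = n \<and> coeff p n = 1 \<and>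
                    (\<forall>j<n. circ_inner \<nu> (monom 1 j) p = 0))"

text \<open>Reversed polynomial  p^*(z) = z^k conj (p (1 / conj z)).\<close>
definition poly_star :: "nat \<Rightarrow> complex poly \<Rightarrow> complex poly" where
  "poly_star k p = (\<Sum>j\<le>k. monom (cnj (coeff p (k - j))) j)"

definition verblunsky :: "real measure \<Rightarrow> nat \<Rightarrow> complex" where
  "verblunsky \<nu> k = (THE a. mop \<nu> (Suc k) = [:0, 1:] * mop \<nu> k - smult (cnj a) (poly_star k (mop \<nu> k)))"

definition shifted :: "real measure \<Rightarrow> nat \<Rightarrow> real measure" where
  "shifted \<nu> n = (THE \<nu>'. circle_prob \<nu>' \<and> nontrivial_circle \<nu>' \<and>
                        (\<forall>k. verblunsky \<nu>' k = verblunsky \<nu> (n + k)))"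

text \<open>w is (a version of) the density of the absolutely continuous part of nu w.r.t.
  d theta / 2 pi, i.e. nu = w d theta/2pi + nu_s with nu_s concentrated on an arc-null set N.\<close>
definition ac_weight :: "real measure \<Rightarrow> (real \<Rightarrow> real) \<Rightarrow> bool" where
  "ac_weight \<nu> w \<longleftrightarrow> w \<in> borel_measurable borel \<and> (\<forall>\<theta>. 0 \<le> w \<theta>) \<and>
     (\<exists>N\<in>null_sets arc_measure. \<forall>A\<in>sets borel.
        emeasure \<nu> A = (\<integral>\<^sup>+\<theta>. ennreal (w \<theta>) * indicator A \<theta> \<partial>arc_measure) + emeasure \<nu> (A \<inter> N))"

text \<open>Szego condition: int log w d theta/2pi > -infinity (log 0 = -infinity), i.e.
  w > 0 a.e. and log w integrable (its positive part is always integrable).\<close>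
definition szego_weight_ok :: "real measure \<Rightarrow> (real \<Rightarrow> real) \<Rightarrow> bool" where
  "szego_weight_ok \<nu> w \<longleftrightarrow> ac_weight \<nu> w \<and> (AE \<theta> in arc_measure. w \<theta> > 0) \<and>
     integrable arc_measure (\<lambda>\<theta>. ln (w \<theta>))"

definition szego_cond :: "real measure \<Rightarrow> bool" where
  "szego_cond \<nu> \<longleftrightarrow> (\<exists>w. szego_weight_ok \<nu> w)"

definition szego_weight :: "real measure \<Rightarrow> real \<Rightarrow> real" where
  "szego_weight \<nu> = (SOME w. szego_weight_ok \<nu> w)"

definition szego_fun :: "real measure \<Rightarrow> complex \<Rightarrow> complex" where
  "szego_fun \<nu> z = exp (integral\<^sup>L arc_measure
       (\<lambda>\<theta>. (cis \<theta> + z) / (cis \<theta> - z) * complex_of_real (ln (szego_weight \<nu> \<theta>))) / 2)"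

definition carath :: "real measure \<Rightarrow> complex \<Rightarrow> complex" where
  "carath \<nu> z = integral\<^sup>L \<nu> (\<lambda>\<theta>. (cis \<theta> + z) / (cis \<theta> - z))"

text \<open>Schur function f, defined by F = (1 + z f)/(1 - z f) (value at 0 by continuity).\<close>
definition schur :: "real measure \<Rightarrow> complex \<Rightarrow> complex" where
  "schur \<nu> z = (if z = 0 then deriv (carath \<nu>) 0 / 2
                else (carath \<nu> z - 1) / (z * (carath \<nu> z + 1)))"

definition rel_szego :: "real measure \<Rightarrow> complex \<Rightarrow> complex" where
  "rel_szego \<nu> z =
     (1 - cnj (verblunsky \<nu> 0) * schur \<nu> z) / complex_of_real (sqrt (1 - (cmod (verblunsky \<nu> 0))\<^sup>2))
     * ((1 - z * schur (shifted \<nu> 1) z) / (1 - z * schur \<nu> z))"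

end

theory Submission
  imports Defs
begin

text \<open>
  \<^bold>\<open>Boundary values.\<close>  By Jensen's inequality for the Poisson kernel, \<open>|D|\<^sup>2 \<le> Re F \<le> 2 / (1 - |z|)\<close>
  in the disc, so \<open>D\<^sup>-\<^sup>1\<close> has no zero on the circle: even a simple one would make \<open>|D|\<^sup>2\<close> grow like
  \<open>(1 - |z|)\<^sup>-\<^sup>2\<close>.  Hence \<open>D\<^sup>-\<^sup>1 = g\<close> has a holomorphic logarithm near the closed disc, and uniqueness of
  Schwarz integrals gives \<open>w = |g|\<^sup>-\<^sup>2\<close> almost everywhere.  So \<open>w\<close> extends to the analytic function
  \<open>1 / (g(z) cnj (g(1 / cnj z)))\<close> on an annulus, its Fourier coefficients decay exponentially, and
  \<open>F(z) + cnj (F(1 / cnj z)) = 2 / (g(z) cnj (g(1 / cnj z)))\<close> continues \<open>F\<close> to \<open>|z| < R\<close> with poles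
  exactly at the zeros of \<open>g\<close>, with the same orders.

  \<^bold>\<open>Stripping a coefficient.\<close>  With \<open>a = \<alpha>\<^sub>0\<close>, the relative Szego function equals
  \<open>((1 + a) (F + 1) - (1 + cnj a) (F - 1) / z) / (2 \<rho>\<^sub>0)\<close>; the coefficient of the polar part of \<open>F\<close> at \<open>z\<close>
  is a multiple of \<open>(1 + a) z - (1 + cnj a)\<close>, which vanishes only on the circle.  Since \<open>F\<close> is analytic
  with positive real part on the closed disc, one Schur step produces an explicit \<open>F\<^sub>1\<close> with the same
  properties, hence a measure with density \<open>Re F\<^sub>1\<close> on the circle.  Geronimus' theorem identifies it
  with \<open>\<mu>\<^sup>(\<^sup>1\<^sup>)\<close>, and the Schwarz formula shows that \<open>g\<close> times the relative Szego function is
  \<open>1 / D\<^sup>(\<^sup>1\<^sup>)\<close>, in which the poles cancel.  The new measure satisfies the hypotheses again.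
\<close>

section \<open>Measures on the circle\<close>

text \<open>Two notions are mere descriptions: \<open>shifted\<close> is a \<open>THE\<close> over
  measures, \<open>szego_weight\<close> a \<open>SOME\<close> over densities. The first forces a
  proof that Verblunsky coefficients determine the measure; existence then comes from writing the
  stripped measure down by its density. The second leaves log w known only as an integrable function
  up to null sets, so identities for w come from comparing Schwarz integrals inside the disc.

  The continuation has two stages. Near the closed unit disc \<open>g\<close> has no zeros and
  everything is holomorphic. Beyond the circle the reflected point lies in the unit disc, where
  \<open>g\<close> is nonzero; multiplying the reflection identity by \<open>g\<close> then gives
  holomorphic numerators \<open>K\<close> and \<open>g1\<close> on the whole large disc, with
  \<open>K / g\<close> continuing F and \<open>g1 / g\<close> the relative Szego function. Poles and
  orders are read off at the zeros of \<open>g\<close>, and \<open>g1\<close> is itself the next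
  inverse Szego function, which drives the induction. Geronimus' theorem is proved for formal power
  series, where it is pure algebra.\<close>

lemma sets_arc_measure [simp, measurable_cong]: "sets arc_measure = sets borel"
  by (simp add: arc_measure_def)

lemma space_arc_measure [simp]: "space arc_measure = UNIV"
  by (simp add: arc_measure_def)

lemma emeasure_arc_measure:
  assumes "A \<in> sets borel"
  shows "emeasure arc_measure A = emeasure lborel ({0..<2*pi} \<inter> A) / ennreal (2 * pi)"
  using assms by (simp add: arc_measure_def)

lemma emeasure_arc_UNIV: "emeasure arc_measure UNIV = 1"
  using emeasure_arc_measure[of UNIV] by (simp add: ennreal_divide_self)

lemma finite_measure_arc: "finite_measure arc_measure"
  by (rule finite_measureI) (simp add: emeasure_arc_UNIV)

lemma AE_arc_iff:
  assumes "Measurable.pred borel P"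
  shows "(AE \<theta> in arc_measure. P \<theta>) \<longleftrightarrow> (AE \<theta> in lborel. \<theta> \<in> {0..<2*pi} \<longrightarrow> P \<theta>)"
  unfolding arc_measure_def
  by (rule AE_uniform_measure) (use assms in auto)

lemma finite_null_arc:
  assumes "finite S" shows "emeasure arc_measure S = 0"
proof -
  have "emeasure lborel ({0..<2*pi} \<inter> S) = 0"
    using assms by (intro emeasure_lborel_countable countable_finite) auto
  then show ?thesis
    using assms by (simp add: emeasure_arc_measure finite_imp_closed)
qed

lemma integral_arc:
  fixes f :: "real \<Rightarrow> complex"
  assumes "continuous_on UNIV f"
  shows "(\<integral>\<theta>. f \<theta> \<partial>arc_measure) = integral {0..2*pi} f / (2 * pi)"
proof -
  have m: "f \<in> borel_measurable borel"
    using assms by (rule borel_measurable_continuous_onI)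
  have d: "arc_measure = density lborel (\<lambda>x. ennreal (indicator {0..<2*pi} x / (2*pi)))"
    unfolding arc_measure_def uniform_measure_def
    by (intro density_cong)
       (auto simp: indicator_def ennreal_1[symmetric] divide_ennreal simp del: ennreal_1)
  have "(\<integral>\<theta>. f \<theta> \<partial>arc_measure) = (\<integral>x. (indicator {0..<2*pi} x / (2*pi)) *\<^sub>R f x \<partial>lborel)"
    unfolding d by (rule integral_density) (use m in auto)
  also have "\<dots> = (\<integral>x. (1/(2*pi)) *\<^sub>R (indicator {0..2*pi} x *\<^sub>R f x) \<partial>lborel)"
  proof (rule integral_cong_AE)
    have "AE x in lborel. x \<noteq> 2*pi"
      by (rule AE_lborel_singleton)
    then show "AE x in lborel. (indicator {0..<2*pi} x / (2*pi)) *\<^sub>R f x = (1/(2*pi)) *\<^sub>R (indicator {0..2*pi} x *\<^sub>R f x)"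
      by eventually_elim (auto simp: indicator_def)
  qed (use m in measurable)
  also have "\<dots> = (1/(2*pi)) *\<^sub>R (LINT x:{0..2*pi}|lborel. f x)"
    unfolding set_lebesgue_integral_def by (rule integral_scaleR_right)
  also have "(LINT x:{0..2*pi}|lborel. f x) = integral {0..2*pi} f"
    by (rule set_borel_integral_eq_integral(2)[OF borel_integrable_atLeastAtMost'])
       (rule continuous_on_subset[OF assms], simp)
  finally show ?thesis
    by (simp add: scaleR_conv_of_real)
qed

lemma measurable_cis [measurable]: "cis \<in> borel_measurable borel"
  by (intro borel_measurable_continuous_onI continuous_intros)

lemma continuous_on_circle_comp:
  assumes "continuous_on (sphere 0 1) h"
  shows "continuous_on A (\<lambda>\<theta>. h (cis \<theta>))"
  by (rule continuous_on_compose2[OF assms]) (auto intro!: continuous_intros)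

lemma bounded_circle_comp:
  fixes h :: "complex \<Rightarrow> 'a::real_normed_vector"
  assumes "continuous_on (sphere 0 1) h"
  obtains B where "\<And>\<theta>. norm (h (cis \<theta>)) \<le> B"
proof -
  have "bounded (h ` sphere 0 1)"
    by (intro compact_imp_bounded compact_continuous_image assms compact_sphere)
  then obtain B where "\<forall>z\<in>sphere 0 1. norm (h z) \<le> B"
    unfolding bounded_iff by auto
  then show ?thesis
    by (intro that[of B]) auto
qed

lemma integrable_mult_circle:
  fixes h :: "complex \<Rightarrow> complex" and u :: "real \<Rightarrow> complex"
  assumes "integrable M u" and "sets M = sets borel" and h: "continuous_on (sphere 0 1) h"
  shows "integrable M (\<lambda>\<theta>. h (cis \<theta>) * u \<theta>)"
proof -
  obtain B where B: "\<And>\<theta>. norm (h (cis \<theta>)) \<le> B"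
    using bounded_circle_comp[OF h] by blast
  have m: "(\<lambda>\<theta>. h (cis \<theta>)) \<in> borel_measurable M"
    using borel_measurable_continuous_onI[OF continuous_on_circle_comp[OF h]] assms(2)
    by (simp cong: measurable_cong_sets)
  show ?thesis
  proof (rule Bochner_Integration.integrable_bound)
    show "integrable M (\<lambda>\<theta>. B * norm (u \<theta>))"
      using assms(1) by auto
    show "(\<lambda>\<theta>. h (cis \<theta>) * u \<theta>) \<in> borel_measurable M"
      using m assms(1) by auto
    have "norm (h (cis x) * u x) \<le> norm (B * norm (u x))" for x
      using mult_right_mono[OF B[of x], of "norm (u x)"] by (simp add: norm_mult)
    then show "AE x in M. norm (h (cis x) * u x) \<le> norm (B * norm (u x))"
      by simp
  qed
qed

lemma integrable_circle:
  fixes h :: "complex \<Rightarrow> complex"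
  assumes "finite_measure M" and "sets M = sets borel" and h: "continuous_on (sphere 0 1) h"
  shows "integrable M (\<lambda>\<theta>. h (cis \<theta>))"
  using integrable_mult_circle[of M "\<lambda>_. 1" h] finite_measure.integrable_const[OF assms(1), of "1::complex"] assms
  by simp

lemma integrable_circle_real:
  fixes h :: "complex \<Rightarrow> real"
  assumes "finite_measure M" and "sets M = sets borel" and h: "continuous_on (sphere 0 1) h"
  shows "integrable M (\<lambda>\<theta>. h (cis \<theta>))"
proof -
  have "integrable M (\<lambda>\<theta>. (\<lambda>z. complex_of_real (h z)) (cis \<theta>))"
    by (rule integrable_circle) (use assms in \<open>auto intro!: continuous_intros\<close>)
  then show ?thesis
    using complex_of_real_integrable_eq by auto
qed

lemma circle_prob_finite: "circle_prob \<nu> \<Longrightarrow> finite_measure \<nu>"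
  by (rule finite_measureI) (auto simp: circle_prob_def dest: sets_eq_imp_space_eq)

lemma circle_prob_sets: "circle_prob \<nu> \<Longrightarrow> sets \<nu> = sets borel"
  by (simp add: circle_prob_def)

section \<open>Moments determine the measure\<close>

text \<open>Laurent monomials with natural exponents: on the unit circle a negative power is the
  conjugate of a positive one. The instance j = 0, n = 1 is the identity
  \<open>cnj z = 1 / z\<close> used throughout.\<close>

lemma circle_unit_power_quotient:
  assumes "norm (z::complex) = 1"
  shows "z ^ j / z ^ n = (if n \<le> j then z ^ (j - n) else cnj (z ^ (n - j)))"
proof -
  have z: "z \<noteq> 0" using assms by auto
  have "cnj z * z = 1"
    using assms by (metis complex_norm_square mult.commute of_real_1 one_power2)
  then have c: "cnj z = 1 / z"
    using z by (simp add: field_simps)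
  show ?thesis
  proof (cases "n \<le> j")
    case True
    then show ?thesis using z by (simp add: power_diff)
  next
    case False
    then have "z ^ n = z ^ j * z ^ (n - j)"
      by (simp flip: power_add)
    then show ?thesis using False z by (simp add: c power_divide)
  qed
qed

text \<open>Moments of nonnegative order suffice, since those of negative order are their
  conjugates.\<close>

lemma integral_circle_quotient_eq:
  fixes M N :: "real measure"
  assumes "finite_measure M" "sets M = sets borel" "finite_measure N" "sets N = sets borel"
    and mom: "\<And>n::nat. (\<integral>\<theta>. cis \<theta> ^ n \<partial>M) = (\<integral>\<theta>. cis \<theta> ^ n \<partial>N)"
  shows "(\<integral>\<theta>. poly p (cis \<theta>) / cis \<theta> ^ n \<partial>M) = (\<integral>\<theta>. poly p (cis \<theta>) / cis \<theta> ^ n \<partial>N)"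
proof -
  define t where "t j z = (if n \<le> j then z ^ (j - n) else cnj (z ^ (n - j)))" for j and z :: complex
  have ex: "poly p (cis \<theta>) / cis \<theta> ^ n = (\<Sum>j\<le>degree p. coeff p j * t j (cis \<theta>))" for \<theta>
    using circle_unit_power_quotient[of "cis \<theta>"]
    by (simp add: poly_altdef sum_divide_distrib t_def flip: times_divide_eq_right)
  have cont: "continuous_on (sphere 0 1) (t j)" for j
    unfolding t_def by (cases "n \<le> j") (auto intro!: continuous_intros)
  have eq: "(\<integral>\<theta>. t j (cis \<theta>) \<partial>M) = (\<integral>\<theta>. t j (cis \<theta>) \<partial>N)" for j
    by (cases "n \<le> j") (simp_all add: t_def mom flip: complex_cnj_power)
  have lin: "(\<integral>\<theta>. (\<Sum>j\<le>degree p. coeff p j * t j (cis \<theta>)) \<partial>K)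
      = (\<Sum>j\<le>degree p. coeff p j * (\<integral>\<theta>. t j (cis \<theta>) \<partial>K))"
    if "finite_measure K" "sets K = sets borel" for K
    using integrable_circle[OF that cont] by (subst Bochner_Integration.integral_sum) auto
  show ?thesis
    unfolding ex using lin assms eq by simp
qed

lemma integral_circle_eq:
  fixes M N :: "real measure" and h :: "complex \<Rightarrow> real"
  assumes M: "finite_measure M" "sets M = sets borel" and N: "finite_measure N" "sets N = sets borel"
    and mom: "\<And>n::nat. (\<integral>\<theta>. cis \<theta> ^ n \<partial>M) = (\<integral>\<theta>. cis \<theta> ^ n \<partial>N)"
    and h: "continuous_on (sphere 0 1) h"
  shows "(\<integral>\<theta>. h (cis \<theta>) \<partial>M) = (\<integral>\<theta>. h (cis \<theta>) \<partial>N)"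
proof -
  \<comment> \<open>Real trigonometric polynomials, written as a polynomial over a power of z. The
    form is closed under sums and products, and it contains Re and Im, which separate points; so
    Stone-Weierstrass applies.\<close>
  define P :: "(complex \<Rightarrow> real) \<Rightarrow> bool" where
    "P k \<longleftrightarrow> (\<exists>p n. \<forall>z\<in>sphere 0 1. complex_of_real (k z) = poly p z / z ^ n)" for k
  have Pcont: "continuous_on (sphere 0 1) k" if Pk: "P k" for k
  proof -
    obtain p n where pn: "\<And>z. z \<in> sphere 0 1 \<Longrightarrow> complex_of_real (k z) = poly p z / z ^ n"
      using Pk unfolding P_def by blast
    have "continuous_on (sphere 0 1) (\<lambda>z::complex. Re (poly p z / z ^ n))"
      by (auto intro!: continuous_intros)
    moreover have "Re (poly p z / z ^ n) = k z" if "z \<in> sphere 0 1" for z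
      using pn[OF that] by (metis Re_complex_of_real)
    ultimately show ?thesis
      by (rule continuous_on_eq)
  qed
  have Peq: "(\<integral>\<theta>. k (cis \<theta>) \<partial>M) = (\<integral>\<theta>. k (cis \<theta>) \<partial>N)" if Pk: "P k" for k
  proof -
    obtain p n where pn: "\<And>z. z \<in> sphere 0 1 \<Longrightarrow> complex_of_real (k z) = poly p z / z ^ n"
      using Pk unfolding P_def by blast
    have "complex_of_real (\<integral>\<theta>. k (cis \<theta>) \<partial>K) = (\<integral>\<theta>. poly p (cis \<theta>) / cis \<theta> ^ n \<partial>K)" for K
      using pn by (simp flip: integral_complex_of_real)
    then show ?thesis
      using integral_circle_quotient_eq[OF M N mom, of p n] by (metis of_real_eq_iff)
  qed
  have approx: "\<exists>k. P k \<and> (\<forall>z\<in>sphere 0 1. \<bar>h z - k z\<bar> < e)" if e: "e > 0" for e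
  proof (rule Stone_Weierstrass_HOL)
    show "compact (sphere (0::complex) 1)" by simp
    show "P (\<lambda>x. c)" for c
      unfolding P_def by (rule exI[of _ "[:of_real c:]"], rule exI[of _ 0]) simp
    show "continuous_on (sphere 0 1) f" if "P f" for f
      using that by (rule Pcont)
    show "P (\<lambda>x. f x + g x)" if "P f \<and> P g" for f g
    proof -
      from that obtain p n q m where
        pq: "\<And>z. z \<in> sphere 0 1 \<Longrightarrow> complex_of_real (f z) = poly p z / z ^ n"
          "\<And>z. z \<in> sphere 0 1 \<Longrightarrow> complex_of_real (g z) = poly q z / z ^ m"
        unfolding P_def by blast
      have "complex_of_real (f z + g z) = poly (p * monom 1 m + q * monom 1 n) z / z ^ (n + m)"
        if "z \<in> sphere 0 1" for z
      proof -
        have "z \<noteq> 0" using that by auto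
        then show ?thesis
          using pq[OF that] by (simp add: poly_monom power_add field_simps)
      qed
      then show ?thesis unfolding P_def by blast
    qed
    show "P (\<lambda>x. f x * g x)" if "P f \<and> P g" for f g
    proof -
      from that obtain p n q m where
        pq: "\<And>z. z \<in> sphere 0 1 \<Longrightarrow> complex_of_real (f z) = poly p z / z ^ n"
          "\<And>z. z \<in> sphere 0 1 \<Longrightarrow> complex_of_real (g z) = poly q z / z ^ m"
        unfolding P_def by blast
      have "complex_of_real (f z * g z) = poly (p * q) z / z ^ (n + m)"
        if "z \<in> sphere 0 1" for z
        using pq[OF that] that by (auto simp: power_add)
      then show ?thesis unfolding P_def by blast
    qed
    have unit: "cnj z = 1 / z" if "z \<in> sphere 0 1" for z :: complex
      using circle_unit_power_quotient[of z 0 1] that by simp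
    have PRe: "P Re"
      unfolding P_def
    proof (intro exI ballI)
      fix z :: complex assume z: "z \<in> sphere 0 1"
      then have "z \<noteq> 0" by auto
      have "complex_of_real (Re z) = (z + cnj z) / 2"
        by (simp add: complex_add_cnj)
      then show "complex_of_real (Re z) = poly [:1/2, 0, 1/2:] z / z ^ 1"
        using unit[OF z] \<open>z \<noteq> 0\<close> by (simp add: field_simps)
    qed
    have PIm: "P Im"
      unfolding P_def
    proof (intro exI ballI)
      fix z :: complex assume z: "z \<in> sphere 0 1"
      then have "z \<noteq> 0" by auto
      have "complex_of_real (Im z) = (z - cnj z) / (2 * \<i>)"
        by (simp add: complex_eq_iff)
      then show "complex_of_real (Im z) = poly [:-1/(2*\<i>), 0, 1/(2*\<i>):] z / z ^ 1"
        using unit[OF z] \<open>z \<noteq> 0\<close> by (simp add: field_simps)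
    qed
    show "\<exists>f. P f \<and> f x \<noteq> f y" if "x \<in> sphere 0 1 \<and> y \<in> sphere 0 1 \<and> x \<noteq> y" for x y
      using that PRe PIm complex_eqI by blast
  qed (use h e in auto)
  define m where "m = measure M UNIV + measure N UNIV"
  have sp: "space M = UNIV" "space N = UNIV"
    using sets_eq_imp_space_eq[OF M(2)] sets_eq_imp_space_eq[OF N(2)] by simp_all
  have "\<bar>(\<integral>\<theta>. h (cis \<theta>) \<partial>M) - (\<integral>\<theta>. h (cis \<theta>) \<partial>N)\<bar> \<le> e * m" if e: "e > 0" for e
  proof -
    obtain k where k: "P k" "\<And>z. z \<in> sphere 0 1 \<Longrightarrow> \<bar>h z - k z\<bar> < e"
      using approx[OF e] by blast
    have bd: "\<bar>(\<integral>\<theta>. h (cis \<theta>) \<partial>K) - (\<integral>\<theta>. k (cis \<theta>) \<partial>K)\<bar> \<le> e * measure K UNIV"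
      if K: "finite_measure K" "sets K = sets borel" "space K = UNIV" for K
    proof -
      note i = integrable_circle_real[OF K(1,2)]
      have i2: "integrable K (\<lambda>\<theta>. h (cis \<theta>) - k (cis \<theta>))"
        using i[OF h] i[OF Pcont[OF k(1)]] by auto
      have "(\<integral>\<theta>. h (cis \<theta>) \<partial>K) - (\<integral>\<theta>. k (cis \<theta>) \<partial>K) = (\<integral>\<theta>. h (cis \<theta>) - k (cis \<theta>) \<partial>K)"
        using i[OF h] i[OF Pcont[OF k(1)]] by simp
      also have "\<bar>\<dots>\<bar> \<le> (\<integral>\<theta>. \<bar>h (cis \<theta>) - k (cis \<theta>)\<bar> \<partial>K)"
        by (rule integral_abs_bound)
      also have "\<dots> \<le> (\<integral>\<theta>. e \<partial>K)"
        using k(2) by (intro integral_mono) (auto simp: finite_measure.integrable_const[OF K(1)]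
            intro!: i2 less_imp_le)
      also have "\<dots> = e * measure K UNIV"
        using K(3) by (simp add: mult.commute)
      finally show ?thesis .
    qed
    show ?thesis
      using bd[OF M sp(1)] bd[OF N sp(2)] Peq[OF k(1)] by (simp add: m_def algebra_simps)
  qed
  note bound = this
  show ?thesis
  proof (rule ccontr)
    assume "\<not> ?thesis"
    then have pos: "0 < \<bar>(\<integral>\<theta>. h (cis \<theta>) \<partial>M) - (\<integral>\<theta>. h (cis \<theta>) \<partial>N)\<bar>" (is "0 < ?d") by simp
    have m0: "m \<ge> 0" by (simp add: m_def)
    \<comment> \<open>This choice of e makes e * m smaller than the difference itself; the + 1
      covers m = 0.\<close>
    have "?d \<le> ?d / (2 * (m + 1)) * m"
      using pos m0 by (intro bound) simp
    also have "\<dots> < ?d"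
      using pos m0 by (simp add: divide_simps)
    finally show False by simp
  qed
qed

text \<open>Equal integrals of continuous functions on the circle give equal measures of closed
  sets, in particular of closed arcs starting at 1. Concentration on [0, 2 pi), where
  \<open>cis\<close> is injective, turns these arcs back into half-lines, which generate the Borel
  sets.\<close>

theorem circle_measure_eqI:
  fixes M N :: "real measure"
  assumes M: "finite_measure M" "sets M = sets borel" "emeasure M (- {0..<2*pi}) = 0"
    and N: "finite_measure N" "sets N = sets borel" "emeasure N (- {0..<2*pi}) = 0"
    and mom: "\<And>n::nat. (\<integral>\<theta>. cis \<theta> ^ n \<partial>M) = (\<integral>\<theta>. cis \<theta> ^ n \<partial>N)"
  shows "M = N"
proof -
  interpret M: finite_measure M by fact
  interpret N: finite_measure N by fact
  have sp: "space M = UNIV" "space N = UNIV"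
    using sets_eq_imp_space_eq[OF M(2)] sets_eq_imp_space_eq[OF N(2)] by simp_all
  have closed_eq: "measure M (cis -` C) = measure N (cis -` C)" if C: "closed C" "C \<noteq> {}" for C
  proof -
    \<comment> \<open>Continuous functions decreasing to the indicator of the closed set C.\<close>
    define h where "h n z = max 0 (1 - real n * infdist z C)" for n z
    have hc: "continuous_on A (h n)" for n A
      unfolding h_def by (intro continuous_intros)
    have lim: "(\<lambda>n. h n z) \<longlonglongrightarrow> indicator C z" for z
    proof (cases "z \<in> C")
      case True
      then show ?thesis by (simp add: h_def)
    next
      case False
      then have pos: "infdist z C > 0"
        using C in_closed_iff_infdist_zero infdist_nonneg less_eq_real_def by metis
      obtain m :: nat where m: "1 < real m * infdist z C"
        using reals_Archimedean3[OF pos] by blast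
      have "h n z = 0" if "n \<ge> m" for n
      proof -
        have "real m * infdist z C \<le> real n * infdist z C"
          using that pos by (intro mult_right_mono) auto
        then show ?thesis using m by (simp add: h_def)
      qed
      then have "\<forall>\<^sub>F n in sequentially. h n z = indicator C z"
        using False eventually_sequentiallyI by fastforce
      then show ?thesis by (rule tendsto_eventually)
    qed
    have meas: "cis -` C \<in> sets borel"
      using measurable_sets_borel[OF measurable_cis] C by auto
    have conv: "(\<lambda>n. \<integral>\<theta>. h n (cis \<theta>) \<partial>K) \<longlonglongrightarrow> measure K (cis -` C)"
      if K: "finite_measure K" "sets K = sets borel" "space K = UNIV" for K
    proof -
      have "(\<lambda>n. \<integral>\<theta>. h n (cis \<theta>) \<partial>K) \<longlonglongrightarrow> (\<integral>\<theta>. indicator C (cis \<theta>) \<partial>K)"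
      proof (rule integral_dominated_convergence)
        show "integrable K (\<lambda>_. 1::real)"
          using finite_measure.integrable_const[OF K(1)] by auto
        show "(\<lambda>\<theta>. h n (cis \<theta>)) \<in> borel_measurable K" for n
          using integrable_circle_real[OF K(1,2) hc] by (rule borel_measurable_integrable)
        show "(\<lambda>\<theta>. indicator C (cis \<theta>) :: real) \<in> borel_measurable K"
          using borel_measurable_indicator[OF meas, where 'b=real] K(2)
          by (simp add: indicator_def[abs_def] vimage_def cong: measurable_cong_sets)
        show "AE x in K. (\<lambda>i. h i (cis x)) \<longlonglongrightarrow> indicator C (cis x)"
          using lim by simp
        show "AE x in K. norm (h i (cis x)) \<le> 1" for i
          by (auto simp: h_def infdist_nonneg)
      qed
      also have "(\<integral>\<theta>. indicator C (cis \<theta>) \<partial>K) = (\<integral>\<theta>. indicator (cis -` C) \<theta> \<partial>K)"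
        by (simp add: indicator_def)
      also have "\<dots> = measure K (cis -` C)"
        using K(3) by simp
      finally show ?thesis by simp
    qed
    have "(\<lambda>n. \<integral>\<theta>. h n (cis \<theta>) \<partial>M) = (\<lambda>n. \<integral>\<theta>. h n (cis \<theta>) \<partial>N)"
      using integral_circle_eq[OF M(1,2) N(1,2) mom hc] by auto
    then show ?thesis
      using conv[OF M(1,2) sp(1)] conv[OF N(1,2) sp(2)] LIMSEQ_unique by metis
  qed
  have restrict: "emeasure K A = emeasure K B"
    if "emeasure K (- {0..<2*pi}) = 0" "sets K = sets borel" "A \<in> sets borel" "B \<in> sets borel"
      "A \<inter> {0..<2*pi} = B \<inter> {0..<2*pi}" for K :: "real measure" and A B
  proof (rule emeasure_eq_AE)
    have "AE x in K. x \<notin> - {0..<2*pi}"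
      by (rule AE_not_in) (use that in auto)
    then show "AE x in K. (x \<in> A) = (x \<in> B)"
      by eventually_elim (use that(5) in blast)
  qed (use that in auto)
  have atMost: "emeasure M {..a} = emeasure N {..a}" for a
  proof -
    consider "a < 0" | "0 \<le> a" "a < 2*pi" | "2*pi \<le> a" by linarith
    then show ?thesis
    proof cases
      case 1
      then have "{..a} \<inter> {0..<2*pi} = {}" by auto
      then show ?thesis
        using restrict[of M "{..a}" "{}"] restrict[of N "{..a}" "{}"] M N by auto
    next
      case 2
      \<comment> \<open>Inside [0, 2 pi) the half-line up to a is the preimage of this closed
        arc.\<close>
      define C where "C = cis ` {0..a}"
      have C: "closed C" "C \<noteq> {}"
        using 2 unfolding C_def
        by (auto intro!: compact_imp_closed compact_continuous_image continuous_intros)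
      have meas: "cis -` C \<in> sets borel"
        using measurable_sets_borel[OF measurable_cis] C by auto
      have inj: "x = y" if "cis x = cis y" "x \<in> {0..<2*pi}" "y \<in> {0..<2*pi}" for x y
        using Arg2pi_unique[of 1 x "cis x"] Arg2pi_unique[of 1 y "cis x"] that
        by (simp add: cis_conv_exp)
      have eq: "{..a} \<inter> {0..<2*pi} = (cis -` C) \<inter> {0..<2*pi}"
      proof (intro equalityI subsetI)
        fix x assume "x \<in> (cis -` C) \<inter> {0..<2*pi}"
        then obtain y where "y \<in> {0..a}" "cis x = cis y" "x \<in> {0..<2*pi}"
          by (auto simp: C_def)
        then have "x = y" using 2 by (intro inj) auto
        then show "x \<in> {..a} \<inter> {0..<2*pi}"
          using \<open>y \<in> {0..a}\<close> \<open>x \<in> {0..<2*pi}\<close> by auto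
      qed (auto simp: C_def)
      have "emeasure M (cis -` C) = emeasure N (cis -` C)"
        using closed_eq[OF C] by (simp add: M.emeasure_eq_measure N.emeasure_eq_measure)
      then show ?thesis
        using restrict[OF M(3,2) _ meas eq] restrict[OF N(3,2) _ meas eq] by auto
    next
      case 3
      have "measure M UNIV = measure N UNIV"
        using closed_eq[of UNIV] by simp
      then have "emeasure M UNIV = emeasure N UNIV"
        by (simp add: M.emeasure_eq_measure N.emeasure_eq_measure)
      moreover have "{..a} \<inter> {0..<2*pi} = UNIV \<inter> {0..<2*pi}" using 3 by auto
      ultimately show ?thesis
        using restrict[OF M(3,2), of "{..a}" UNIV] restrict[OF N(3,2), of "{..a}" UNIV] by simp
    qed
  qed
  show ?thesis
  proof (rule measure_eqI_generator_eq)
    show "Int_stable (range (atMost :: real \<Rightarrow> _))"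
      by (auto simp: Int_stable_def)
    show "range (atMost :: real \<Rightarrow> _) \<subseteq> Pow UNIV" by auto
    show "emeasure M X = emeasure N X" if "X \<in> range atMost" for X
      using that atMost by auto
    show "sets M = sigma_sets UNIV (range atMost)" "sets N = sigma_sets UNIV (range atMost)"
      using M N by (simp_all add: borel_eq_atMost)
    show "range (\<lambda>n::nat. {..real n}) \<subseteq> range atMost" by auto
    show "(\<Union>i. {..real i}) = UNIV" by (auto intro: real_arch_simple)
    show "emeasure M {..real i} \<noteq> \<infinity>" for i by simp
  qed
qed

section \<open>Orthogonal polynomials on the unit circle\<close>

lemma coeff_poly_star: "coeff (poly_star k p) j = (if j \<le> k then cnj (coeff p (k - j)) else 0)"
  by (simp add: poly_star_def coeff_sum if_distrib cong: if_cong)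

lemma poly_star_circle:
  assumes "degree p \<le> k" and "norm z = 1"
  shows "poly (poly_star k p) z = z ^ k * cnj (poly p z)"
proof -
  have "poly (poly_star k p) z = (\<Sum>j\<le>k. cnj (coeff p (k - j)) * z ^ j)"
    by (simp add: poly_star_def poly_sum poly_monom)
  also have "\<dots> = (\<Sum>j\<le>k. cnj (coeff p j) * z ^ (k - j))"
    by (rule sum.reindex_bij_witness[of _ "\<lambda>j. k - j" "\<lambda>j. k - j"]) auto
  also have "\<dots> = (\<Sum>j\<le>k. z ^ k * cnj (coeff p j * z ^ j))"
  proof (rule sum.cong)
    fix j assume j: "j \<in> {..k}"
    have "z ^ (k - j) = z ^ k / z ^ j"
      using circle_unit_power_quotient[OF assms(2), of k j] j by simp
    moreover have "cnj (z ^ j) = 1 / z ^ j"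
      using circle_unit_power_quotient[OF assms(2), of 0 j] by (cases "j = 0") auto
    ultimately show "cnj (coeff p j) * z ^ (k - j) = z ^ k * cnj (coeff p j * z ^ j)"
      by simp
  qed simp
  also have "\<dots> = z ^ k * cnj (poly p z)"
  proof -
    have "poly p z = poly (\<Sum>j\<le>k. monom (coeff p j) j) z"
      by (simp add: poly_as_sum_of_monoms'[OF assms(1)])
    then show ?thesis
      by (simp add: poly_sum poly_monom sum_distrib_left)
  qed
  finally show ?thesis .
qed

text \<open>The dual half of the Szego recursion. The reversal index grows with the degree, so
  reversing z p gives the reversal of p, and reversing the reversal of p gives z p.\<close>

lemma poly_star_recursion:
  assumes "degree p \<le> k"
  shows "poly_star (Suc k) (pCons 0 p - smult (cnj a) (poly_star k p))
       = poly_star k p - smult a (pCons 0 p)"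
proof (rule poly_eqI)
  fix j
  consider "j = 0" | "0 < j" "j \<le> k" | "j = Suc k" | "Suc k < j" by linarith
  then show "coeff (poly_star (Suc k) (pCons 0 p - smult (cnj a) (poly_star k p))) j
      = coeff (poly_star k p - smult a (pCons 0 p)) j"
  proof cases
    case 1
    then show ?thesis by (simp add: coeff_poly_star)
  next
    case 2
    then obtain i where i: "j = Suc i" by (cases j) auto
    have "Suc k - j = Suc (k - j)" using 2 by simp
    then show ?thesis using 2 i by (simp add: coeff_poly_star)
  next
    case 3
    then show ?thesis by (simp add: coeff_poly_star)
  next
    case 4
    then obtain i where i: "j = Suc i" by (cases j) auto
    then show ?thesis using 4 assms by (simp add: coeff_poly_star coeff_eq_0)
  qed
qed

lemma unit_cnj_mult: "cnj (cis t) * cis t = 1"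
  by (metis complex_norm_square mult.commute norm_cis of_real_1 one_power2)

lemma degree_diff_less:
  assumes "degree p = n" "degree q = n" "coeff p n = coeff q n" "p \<noteq> (q :: 'a::ab_group_add poly)"
  shows "degree (p - q) < n"
proof -
  have "degree (p - q) \<le> n"
    using assms degree_diff_le_max[of p q] by simp
  moreover have "degree (p - q) \<noteq> n"
  proof
    assume "degree (p - q) = n"
    moreover have "coeff (p - q) n = 0" using assms by simp
    ultimately have "p - q = 0" by (metis leading_coeff_0_iff)
    then show False using assms(4) by simp
  qed
  ultimately show ?thesis by simp
qed

locale circle_measure =
  fixes \<nu> :: "real measure"
  assumes prob: "circle_prob \<nu>" and nontrivial: "nontrivial_circle \<nu>"
begin

abbreviation ip where "ip \<equiv> circ_inner \<nu>"

text \<open>The predicate inside the description \<open>mop\<close>, named so that existence and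
  uniqueness can be stated for it.\<close>

definition is_mop :: "nat \<Rightarrow> complex poly \<Rightarrow> bool" where
  "is_mop n p \<longleftrightarrow> degree p = n \<and> coeff p n = 1 \<and> (\<forall>j<n. ip (monom 1 j) p = 0)"

lemma space_UNIV: "space \<nu> = UNIV"
  using sets_eq_imp_space_eq[OF circle_prob_sets[OF prob]] by simp

lemma measure_UNIV: "measure \<nu> UNIV = 1"
  using prob by (simp add: circle_prob_def measure_def)

lemma integrable_ip: "integrable \<nu> (\<lambda>\<theta>. cnj (poly p (cis \<theta>)) * poly q (cis \<theta>))"
  by (rule integrable_circle[OF circle_prob_finite[OF prob] circle_prob_sets[OF prob],
        of "\<lambda>z. cnj (poly p z) * poly q z"]) (intro continuous_intros)

lemma ip_add: "ip p (q + r) = ip p q + ip p r"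
  using integrable_ip by (simp add: circ_inner_def ring_distribs)

lemma ip_diff: "ip p (q - r) = ip p q - ip p r"
  using integrable_ip by (simp add: circ_inner_def ring_distribs)

lemma ip_smult: "ip p (smult c q) = c * ip p q"
proof -
  have "ip p (smult c q) = (\<integral>\<theta>. c * (cnj (poly p (cis \<theta>)) * poly q (cis \<theta>)) \<partial>\<nu>)"
    by (simp add: circ_inner_def mult_ac)
  then show ?thesis by (simp add: circ_inner_def)
qed

lemma ip_sum: "ip p (\<Sum>i\<in>A. q i) = (\<Sum>i\<in>A. ip p (q i))"
proof (induction A rule: infinite_finite_induct)
  case (insert x F)
  then show ?case by (simp add: ip_add)
qed (simp_all add: circ_inner_def)

lemma ip_cnj: "cnj (ip p q) = ip q p"
proof -
  have "(\<lambda>\<theta>. cnj (poly q (cis \<theta>)) * poly p (cis \<theta>)) = (\<lambda>\<theta>. cnj (cnj (poly p (cis \<theta>)) * poly q (cis \<theta>)))"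
    by (simp add: fun_eq_iff mult.commute)
  then show ?thesis by (simp only: circ_inner_def Bochner_Integration.integral_cnj)
qed

text \<open>Multiplication by z is an isometry, as z has modulus 1 on the circle.\<close>

lemma ip_shift: "ip (pCons 0 p) (pCons 0 q) = ip p q"
proof -
  have eq: "cnj (poly (pCons 0 p) (cis t)) * poly (pCons 0 q) (cis t)
      = (cnj (cis t) * cis t) * (cnj (poly p (cis t)) * poly q (cis t))" for t
    by (simp add: mult_ac)
  show ?thesis
    by (simp only: circ_inner_def eq unit_cnj_mult mult_1_left)
qed

text \<open>On the circle the reversal is z^k times the conjugate, which exchanges z^j and z^(k-j).
  Hence the reversal of the n-th orthogonal polynomial is orthogonal to z, ..., z^n.\<close>

lemma ip_star:
  assumes "degree p \<le> k" "j \<le> k"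
  shows "ip (monom 1 j) (poly_star k p) = cnj (ip (monom 1 (k - j)) p)"
proof -
  have "cnj (poly (monom 1 j) (cis t)) * poly (poly_star k p) (cis t)
     = poly (monom 1 (k - j)) (cis t) * cnj (poly p (cis t))" for t
  proof -
    have "cnj (cis t ^ j) * cis t ^ k = (cnj (cis t) * cis t) ^ j * cis t ^ (k - j)"
      using assms(2) by (simp add: power_mult_distrib mult.assoc flip: power_add)
    then show ?thesis
      using assms by (simp add: poly_star_circle poly_monom unit_cnj_mult)
  qed
  then have "ip (monom 1 j) (poly_star k p) = ip p (monom 1 (k - j))"
    by (simp add: circ_inner_def mult.commute)
  then show ?thesis by (simp add: ip_cnj)
qed

text \<open>Here nontriviality enters: a nonzero p would vanish almost everywhere, yet it has only
  finitely many zeros on the circle.\<close>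

lemma ip_self_eq_0:
  assumes "ip p p = 0" shows "p = 0"
proof (rule ccontr)
  assume p: "p \<noteq> 0"
  have i: "integrable \<nu> (\<lambda>\<theta>. (norm (poly p (cis \<theta>)))\<^sup>2)"
    by (rule integrable_circle_real[OF circle_prob_finite[OF prob] circle_prob_sets[OF prob],
          of "\<lambda>z. (norm (poly p z))\<^sup>2"]) (intro continuous_intros)
  have "ip p p = (\<integral>\<theta>. complex_of_real ((norm (poly p (cis \<theta>)))\<^sup>2) \<partial>\<nu>)"
    unfolding circ_inner_def
    by (intro Bochner_Integration.integral_cong refl) (simp add: complex_norm_square mult.commute del: of_real_power)
  also have "\<dots> = of_real (\<integral>\<theta>. (norm (poly p (cis \<theta>)))\<^sup>2 \<partial>\<nu>)"
    by (rule integral_complex_of_real)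
  finally have "(\<integral>\<theta>. (norm (poly p (cis \<theta>)))\<^sup>2 \<partial>\<nu>) = 0"
    using assms by simp
  then have "AE \<theta> in \<nu>. (norm (poly p (cis \<theta>)))\<^sup>2 = 0"
    using integral_nonneg_eq_0_iff_AE[OF i] by simp
  then have AE: "AE \<theta> in \<nu>. poly p (cis \<theta>) = 0"
    by simp
  define S where "S = {\<theta>\<in>{0..<2*pi}. poly p (cis \<theta>) = 0}"
  have "finite (Arg2pi ` {z. poly p z = 0})"
    using p by (intro finite_imageI poly_roots_finite)
  moreover have "S \<subseteq> Arg2pi ` {z. poly p z = 0}"
  proof
    fix x assume x: "x \<in> S"
    have "Arg2pi (cis x) = x"
      using Arg2pi_unique[of 1 x "cis x"] x by (simp add: S_def cis_conv_exp)
    then show "x \<in> Arg2pi ` {z. poly p z = 0}"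
      using x by (intro image_eqI[of _ _ "cis x"]) (auto simp: S_def)
  qed
  ultimately have S: "finite S"
    by (rule rev_finite_subset)
  have sets: "- S \<in> sets \<nu>" "- {0..<2*pi} \<in> sets \<nu>"
    using S by (auto simp: circle_prob_sets[OF prob] finite_imp_closed)
  have "emeasure \<nu> (- {0..<2*pi}) = emeasure \<nu> UNIV - emeasure \<nu> {0..<2*pi}"
    using emeasure_Diff[of \<nu> "{0..<2*pi}" UNIV] prob
    by (simp add: circle_prob_def Compl_eq_Diff_UNIV)
  then have "emeasure \<nu> (- {0..<2*pi}) = 0"
    using prob by (simp add: circle_prob_def)
  then have "AE \<theta> in \<nu>. \<theta> \<notin> - {0..<2*pi}"
    using sets by (intro AE_not_in) auto
  with AE have "AE \<theta> in \<nu>. \<theta> \<notin> - S"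
    by eventually_elim (auto simp: S_def)
  then have "emeasure \<nu> (- S) = 0"
    using sets AE_iff_measurable[of "- S" \<nu> "\<lambda>\<theta>. \<theta> \<notin> - S"] by (auto simp: space_UNIV)
  moreover have "emeasure \<nu> (- S) > 0"
    using nontrivial S by (simp add: nontrivial_circle_def)
  ultimately show False by simp
qed

lemma ip_low_degree:
  assumes "\<forall>j<n. ip (monom 1 j) p = 0" and "degree q < n"
  shows "ip q p = 0"
proof -
  have "ip p (monom (coeff q j) j) = 0" if "j \<le> degree q" for j
  proof -
    have "ip p (monom (coeff q j) j) = coeff q j * ip p (monom 1 j)"
      by (simp flip: ip_smult add: smult_monom)
    also have "ip p (monom 1 j) = cnj (ip (monom 1 j) p)"
      by (simp add: ip_cnj)
    finally show ?thesis using assms that by simp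
  qed
  then have "ip p (\<Sum>j\<le>degree q. monom (coeff q j) j) = 0"
    by (simp add: ip_sum)
  then have "ip p q = 0" by (simp add: poly_as_sum_of_monoms)
  then show ?thesis using ip_cnj[of p q] by simp
qed

lemma is_mop_unique:
  assumes p: "is_mop n p" and q: "is_mop n q" shows "p = q"
proof (rule ccontr)
  assume ne: "p \<noteq> q"
  have "degree (p - q) < n"
    using p q ne by (intro degree_diff_less) (auto simp: is_mop_def)
  moreover have "\<forall>j<n. ip (monom 1 j) (p - q) = 0"
    using p q by (simp add: is_mop_def ip_diff)
  ultimately have "ip (p - q) (p - q) = 0"
    by (rule ip_low_degree[rotated])
  then show False using ip_self_eq_0 ne by fastforce
qed

text \<open>Otherwise p would be orthogonal to every polynomial of degree at most n, itself
  included.\<close>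

lemma is_mop_lead:
  assumes p: "is_mop n p" shows "ip (monom 1 n) p \<noteq> 0"
proof
  assume 0: "ip (monom 1 n) p = 0"
  have "\<forall>j<Suc n. ip (monom 1 j) p = 0"
    using 0 p by (auto simp: is_mop_def less_Suc_eq)
  then have "ip p p = 0"
    using p by (intro ip_low_degree[of "Suc n"]) (auto simp: is_mop_def)
  then have "p = 0" by (rule ip_self_eq_0)
  then show False
    using p by (simp add: is_mop_def)
qed

text \<open>Both z p and the reversal of p are orthogonal to z, ..., z^n, so one constant b is
  enough to make the combination orthogonal to 1 as well. Its denominator is the conjugate of the
  quantity in \<open>is_mop_lead\<close>. This yields existence of the orthogonal polynomials and
  their recursion at once.\<close>

lemma is_mop_step:
  assumes p: "is_mop n p"
  defines "b \<equiv> ip 1 (pCons 0 p) / ip 1 (poly_star n p)"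
  shows "is_mop (Suc n) (pCons 0 p - smult b (poly_star n p))"
proof -
  have deg: "degree p = n" and lc: "coeff p n = 1" and orth: "\<And>j. j < n \<Longrightarrow> ip (monom 1 j) p = 0"
    using p by (auto simp: is_mop_def)
  have one: "monom 1 0 = (1 :: complex poly)" by simp
  have ne: "ip 1 (poly_star n p) \<noteq> 0"
    using ip_star[of p n 0, unfolded one] deg is_mop_lead[OF p] by simp
  let ?q = "pCons 0 p - smult b (poly_star n p)"
  have "degree (poly_star n p) \<le> n"
    by (rule degree_le) (simp add: coeff_poly_star)
  then have "degree (smult b (poly_star n p)) < Suc n"
    using degree_smult_le[of b "poly_star n p"] by linarith
  moreover have dp: "degree (pCons 0 p) = Suc n"
    using deg lc by (metis degree_pCons_eq leading_coeff_0_iff zero_neq_one)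
  ultimately have "degree ?q = Suc n"
    by (simp add: degree_add_eq_left flip: add_uminus_conv_diff)
  moreover have "coeff ?q (Suc n) = 1"
    using lc by (simp add: coeff_poly_star)
  moreover have "ip (monom 1 j) ?q = 0" if j: "j < Suc n" for j
  proof (cases j)
    case 0
    then show ?thesis
      using ne by (simp only: one ip_diff ip_smult b_def) simp
  next
    case (Suc i)
    have "ip (monom 1 j) (pCons 0 p) = 0"
      using Suc j orth by (simp add: monom_Suc ip_shift)
    moreover have "ip (monom 1 j) (poly_star n p) = 0"
      using ip_star[of p n j] deg j Suc orth[of "n - j"] by simp
    ultimately show ?thesis by (simp add: ip_diff ip_smult)
  qed
  ultimately show ?thesis unfolding is_mop_def by blast
qed

lemma ex_is_mop: "\<exists>p. is_mop n p"
proof (induction n)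
  case 0
  show ?case by (rule exI[of _ 1]) (simp add: is_mop_def)
next
  case (Suc n)
  then show ?case using is_mop_step by blast
qed

lemma is_mop_mop: "is_mop n (mop \<nu> n)"
proof -
  have "\<exists>!p. is_mop n p"
    using ex_is_mop is_mop_unique by blast
  then have "is_mop n (THE p. is_mop n p)" by (rule theI')
  then show ?thesis unfolding mop_def is_mop_def .
qed

lemma mop_0: "mop \<nu> 0 = 1"
  by (rule is_mop_unique[OF is_mop_mop]) (simp add: is_mop_def)

lemma degree_mop: "degree (mop \<nu> n) = n"
  using is_mop_mop[of n] by (simp add: is_mop_def)

lemma ip_mop_eq_0: "j < n \<Longrightarrow> ip (monom 1 j) (mop \<nu> n) = 0"
  using is_mop_mop[of n] by (simp add: is_mop_def)

text \<open>Discharges the description in \<open>verblunsky\<close>. The coefficient is unique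
  because the reversal has constant term 1 and so is not the zero polynomial.\<close>

lemma mop_Suc:
  "mop \<nu> (Suc k) = pCons 0 (mop \<nu> k) - smult (cnj (verblunsky \<nu> k)) (poly_star k (mop \<nu> k))"
proof -
  let ?P = "\<lambda>a. mop \<nu> (Suc k) = [:0, 1:] * mop \<nu> k - smult (cnj a) (poly_star k (mop \<nu> k))"
  have star: "poly_star k (mop \<nu> k) \<noteq> 0"
  proof
    assume "poly_star k (mop \<nu> k) = 0"
    then have "coeff (poly_star k (mop \<nu> k)) 0 = 0" by simp
    then show False
      using is_mop_mop[of k] by (simp add: coeff_poly_star is_mop_def)
  qed
  obtain b where b: "is_mop (Suc k) (pCons 0 (mop \<nu> k) - smult b (poly_star k (mop \<nu> k)))"
    using is_mop_step[OF is_mop_mop] by blast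
  have "?P (cnj b)"
    using is_mop_unique[OF is_mop_mop b] by simp
  moreover have "a = cnj b" if "?P a" for a
  proof -
    have "smult (cnj a) (poly_star k (mop \<nu> k)) = smult b (poly_star k (mop \<nu> k))"
      using trans[OF that[symmetric] \<open>?P (cnj b)\<close>] by simp
    then have "smult (cnj a - b) (poly_star k (mop \<nu> k)) = 0"
      by (simp add: smult_diff_left)
    then have "cnj a = b" using star by simp
    then show ?thesis by auto
  qed
  ultimately have "?P (THE a. ?P a)" by (rule theI[where P = ?P])
  then show ?thesis by (simp add: verblunsky_def)
qed

lemma poly_star_mop_Suc:
  "poly_star (Suc k) (mop \<nu> (Suc k))
     = poly_star k (mop \<nu> k) - smult (verblunsky \<nu> k) (pCons 0 (mop \<nu> k))"
  unfolding mop_Suc by (rule poly_star_recursion) (simp add: degree_mop)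

lemma ip_one_one: "ip 1 1 = 1"
  by (simp add: circ_inner_def measure_UNIV space_UNIV)

end

section \<open>The measure as a function of its Verblunsky coefficients\<close>

lemma verblunsky_determines_mop:
  assumes "circle_measure \<nu>" "circle_measure \<nu>'" "\<And>k. verblunsky \<nu> k = verblunsky \<nu>' k"
  shows "mop \<nu> n = mop \<nu>' n"
proof (induction n)
  case 0
  show ?case using assms by (simp add: circle_measure.mop_0)
next
  case (Suc n)
  then show ?case using assms by (simp add: circle_measure.mop_Suc)
qed

text \<open>Orthogonality of the n-th polynomial to 1 expresses the n-th moment through lower
  moments and the coefficients of that polynomial, which the recursion determines.\<close>

theorem verblunsky_determines_measure:
  assumes \<nu>: "circle_measure \<nu>" and \<nu>': "circle_measure \<nu>'"
    and eq: "\<And>k. verblunsky \<nu> k = verblunsky \<nu>' k"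
  shows "\<nu> = \<nu>'"
proof -
  interpret a: circle_measure \<nu> by fact
  interpret b: circle_measure \<nu>' by fact
  have mom: "circ_inner \<nu> 1 (monom 1 n) = circ_inner \<nu>' 1 (monom 1 n)" for n
  proof (induction n rule: less_induct)
    case (less n)
    show ?case
    proof (cases "n = 0")
      case True
      then show ?thesis using a.ip_one_one b.ip_one_one by simp
    next
      case False
      have formula: "circ_inner \<kappa> 1 (monom 1 n)
          = - (\<Sum>j<n. coeff (mop \<kappa> n) j * circ_inner \<kappa> 1 (monom 1 j))"
        if "circle_measure \<kappa>" for \<kappa>
      proof -
        interpret circle_measure \<kappa> by fact
        have "mop \<kappa> n = (\<Sum>j\<le>n. monom (coeff (mop \<kappa> n) j) j)"
          using poly_as_sum_of_monoms[of "mop \<kappa> n"] by (simp add: degree_mop)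
        also have "\<dots> = (\<Sum>j\<le>n. smult (coeff (mop \<kappa> n) j) (monom 1 j))"
          by (simp add: smult_monom)
        finally have "ip 1 (mop \<kappa> n) = (\<Sum>j\<le>n. coeff (mop \<kappa> n) j * ip 1 (monom 1 j))"
          by (metis (no_types, lifting) ip_smult ip_sum sum.cong)
        also have "\<dots> = (\<Sum>j<n. coeff (mop \<kappa> n) j * ip 1 (monom 1 j)) + ip 1 (monom 1 n)"
          using is_mop_mop[of n] by (simp add: is_mop_def flip: lessThan_Suc_atMost)
        finally show ?thesis
          using ip_mop_eq_0[of 0 n] False by (simp add: eq_neg_iff_add_eq_0 add.commute)
      qed
      show ?thesis
        unfolding formula[OF \<nu>] formula[OF \<nu>']
        using less verblunsky_determines_mop[OF \<nu> \<nu>' eq] by simp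
    qed
  qed
  have null: "emeasure \<kappa> (- {0..<2*pi}) = 0" if "circle_prob \<kappa>" for \<kappa>
  proof -
    have "emeasure \<kappa> (- {0..<2*pi}) = emeasure \<kappa> UNIV - emeasure \<kappa> {0..<2*pi}"
      using emeasure_Diff[of \<kappa> "{0..<2*pi}" UNIV] that
      by (simp add: circle_prob_def Compl_eq_Diff_UNIV)
    then show ?thesis using that by (simp add: circle_prob_def)
  qed
  show ?thesis
  proof (rule circle_measure_eqI)
    show "(\<integral>\<theta>. cis \<theta> ^ n \<partial>\<nu>) = (\<integral>\<theta>. cis \<theta> ^ n \<partial>\<nu>')" for n
      using mom[of n] by (simp add: circ_inner_def poly_monom)
  qed (use a.prob b.prob in \<open>auto simp: circle_prob_finite circle_prob_sets null\<close>)
qed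

section \<open>Geronimus' theorem\<close>

text \<open>The Taylor series at 0 of the Caratheodory function of a probability measure, see
  \<open>carath_has_fps_expansion\<close>.\<close>

definition moment_fps :: "real measure \<Rightarrow> complex fps" where
  "moment_fps \<nu> = Abs_fps (\<lambda>n. if n = 0 then 1 else 2 * (\<integral>\<theta>. cnj (cis \<theta>) ^ n \<partial>\<nu>))"

context circle_measure
begin

text \<open>A function of the second kind: the expansion of z times the integral of e^(it) / (e^(it)
  - z) against the n-th orthogonal polynomial. The factor z makes its order at 0 exactly n +
  1.\<close>

definition mop_fps :: "nat \<Rightarrow> complex fps" where
  "mop_fps n = Abs_fps (\<lambda>j. case j of 0 \<Rightarrow> 0 | Suc i \<Rightarrow> ip (monom 1 i) (mop \<nu> n))"

text \<open>The expansion of the integral of z / (e^(it) - z) against the reversed polynomial.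
  Without the constant term of the Cauchy kernel its order at 0 is at least n + 1, matching
  \<open>mop_fps\<close>.\<close>

definition star_fps :: "nat \<Rightarrow> complex fps" where
  "star_fps n = Abs_fps (\<lambda>j. if j = 0 then 0 else ip (monom 1 j) (poly_star n (mop \<nu> n)))"

lemma star_fps_Suc: "star_fps (Suc n) = star_fps n - fps_const (verblunsky \<nu> n) * mop_fps n"
proof (rule fps_ext)
  fix j
  show "star_fps (Suc n) $ j = (star_fps n - fps_const (verblunsky \<nu> n) * mop_fps n) $ j"
    by (cases j) (simp_all add: star_fps_def mop_fps_def poly_star_mop_Suc ip_diff ip_smult
        monom_Suc ip_shift)
qed

lemma mop_fps_Suc:
  "mop_fps (Suc n) = fps_X * (mop_fps n - fps_const (cnj (verblunsky \<nu> n)) * star_fps n)"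
proof (rule fps_ext)
  fix j
  consider "j = 0" | "j = 1" | i where "j = Suc (Suc i)"
    by (metis One_nat_def not0_implies_Suc)
  then show "mop_fps (Suc n) $ j
      = (fps_X * (mop_fps n - fps_const (cnj (verblunsky \<nu> n)) * star_fps n)) $ j"
  proof cases
    \<comment> \<open>The coefficient of z is, on the left, the inner product of 1 with the next
      orthogonal polynomial, zero by orthogonality; on the right it is zero because both series have
      no constant term.\<close>
    case 2
    then show ?thesis
      using ip_mop_eq_0[of 0 "Suc n"] by (simp add: star_fps_def mop_fps_def)
  next
    case 3
    then show ?thesis
      by (simp add: star_fps_def mop_fps_def mop_Suc[of n] ip_diff ip_smult) (simp add: monom_Suc ip_shift)
  qed (simp add: mop_fps_def)
qed

lemma mop_fps_low: "j < Suc n \<Longrightarrow> mop_fps n $ j = 0"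
  using ip_mop_eq_0 by (cases j) (auto simp: mop_fps_def)

lemma mop_fps_lead: "mop_fps n $ Suc n \<noteq> 0"
  using is_mop_lead[OF is_mop_mop] by (simp add: mop_fps_def)

lemma star_fps_low: "j < Suc n \<Longrightarrow> star_fps n $ j = 0"
  using ip_mop_eq_0[of "n - j" n] by (auto simp: star_fps_def ip_star degree_mop)

text \<open>The next series \<open>star_fps (Suc n)\<close> already vanishes at index n + 1, so its
  recursion exhibits the Verblunsky coefficient as a ratio of lowest coefficients, that is, as the
  value at 0 of the n-th Schur iterate.\<close>

lemma star_fps_lead: "star_fps n $ Suc n = verblunsky \<nu> n * mop_fps n $ Suc n"
  using star_fps_low[of "Suc n" "Suc n"] by (simp add: star_fps_Suc)

lemma star_fps_0: "2 * star_fps 0 = moment_fps \<nu> - 1"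
proof (rule fps_ext)
  fix n
  have "poly_star 0 (1 :: complex poly) = 1"
    by (simp add: poly_star_def)
  then show "(2 * star_fps 0) $ n = (moment_fps \<nu> - 1) $ n"
    by (simp add: star_fps_def moment_fps_def mop_0 circ_inner_def poly_monom numeral_fps_const)
qed

lemma mop_fps_0: "2 * mop_fps 0 = fps_X * (moment_fps \<nu> + 1)"
proof (rule fps_ext)
  fix n
  show "(2 * mop_fps 0) $ n = (fps_X * (moment_fps \<nu> + 1)) $ n"
    using measure_UNIV space_UNIV
    by (cases n) (simp_all add: mop_fps_def moment_fps_def mop_0 circ_inner_def poly_monom numeral_fps_const)
qed

lemma verblunsky_0: "verblunsky \<nu> 0 = (\<integral>\<theta>. cnj (cis \<theta>) \<partial>\<nu>)"
proof -
  have "(2 * star_fps 0) $ 1 = verblunsky \<nu> 0 * (2 * mop_fps 0) $ 1"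
    using star_fps_lead[of 0] by (simp add: numeral_fps_const)
  then show ?thesis
    unfolding star_fps_0 mop_fps_0 by (simp add: moment_fps_def)
qed

end

lemma fps_mult_nth_lowest:
  fixes f g :: "'a::comm_ring_1 fps"
  assumes "\<And>i. i < m \<Longrightarrow> f $ i = 0" and "\<And>i. i < k \<Longrightarrow> g $ i = 0"
  shows "(f * g) $ (m + k) = f $ m * g $ k"
proof -
  have "(f * g) $ (m + k) = (\<Sum>i=0..m+k. f $ i * g $ (m + k - i))"
    by (simp add: fps_mult_nth)
  also have "\<dots> = (\<Sum>i\<in>{m}. f $ i * g $ (m + k - i))"
  proof (rule sum.mono_neutral_right)
    show "\<forall>i\<in>{0..m + k} - {m}. f $ i * g $ (m + k - i) = 0"
    proof
      fix i assume "i \<in> {0..m + k} - {m}"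
      then have "i < m \<or> m + k - i < k" by auto
      then show "f $ i * g $ (m + k - i) = 0" using assms by auto
    qed
  qed auto
  finally show ?thesis by simp
qed

text \<open>The hypothesis is the Schur step \<open>z f\<^sub>1 = (f - a) / (1 - cnj a f)\<close>, cleared of denominators and
  expressed through the Caratheodory functions.  The ratio of \<open>star_fps n\<close> and \<open>mop_fps n\<close>
  is the \<open>n\<close>-th Schur iterate of \<open>\<nu>\<close>.\<close>

theorem verblunsky_shift:
  assumes \<nu>: "circle_measure \<nu>" and \<nu>': "circle_measure \<nu>'"
    and step: "(moment_fps \<nu>' + 1) * ((moment_fps \<nu> - 1) - fps_const (verblunsky \<nu> 0) * fps_X * (moment_fps \<nu> + 1))
      = (moment_fps \<nu>' - 1) * (fps_X * (moment_fps \<nu> + 1) - fps_const (cnj (verblunsky \<nu> 0)) * (moment_fps \<nu> - 1))"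
  shows "verblunsky \<nu>' n = verblunsky \<nu> (Suc n)"
proof -
  interpret a: circle_measure \<nu> by fact
  interpret b: circle_measure \<nu>' by fact
  \<comment> \<open>The hypothesis is equality of two Schur iterates, cross-multiplied. The factors
    have orders at least n + 1 and n + 2, so the lowest coefficient sits at their sum.\<close>
  have coeff: "verblunsky \<nu>' n = verblunsky \<nu> (Suc n)"
    if eq: "b.mop_fps n * a.star_fps (Suc n) = b.star_fps n * a.mop_fps (Suc n)" for n
  proof -
    have "b.mop_fps n $ Suc n * a.star_fps (Suc n) $ Suc (Suc n)
        = b.star_fps n $ Suc n * a.mop_fps (Suc n) $ Suc (Suc n)"
      using arg_cong[OF eq, of "\<lambda>f. f $ (Suc n + Suc (Suc n))"]
      by (simp only: fps_mult_nth_lowest a.mop_fps_low a.star_fps_low b.mop_fps_low b.star_fps_low)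
    then show ?thesis
      using a.mop_fps_lead[of "Suc n"] b.mop_fps_lead[of n]
      by (simp add: a.star_fps_lead b.star_fps_lead)
  qed
  have "b.mop_fps n * a.star_fps (Suc n) = b.star_fps n * a.mop_fps (Suc n)" for n
  proof (induction n)
    case 0
    let ?\<alpha> = "fps_const (verblunsky \<nu> 0)" and ?\<beta> = "fps_const (cnj (verblunsky \<nu> 0))"
    have "4 * (b.mop_fps 0 * a.star_fps (Suc 0))
        = (2 * b.mop_fps 0) * (2 * a.star_fps 0 - ?\<alpha> * (2 * a.mop_fps 0))"
      by (simp add: a.star_fps_Suc algebra_simps)
    also have "\<dots> = fps_X * ((moment_fps \<nu>' + 1) * ((moment_fps \<nu> - 1) - ?\<alpha> * fps_X * (moment_fps \<nu> + 1)))"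
      unfolding a.star_fps_0 a.mop_fps_0 b.mop_fps_0 by (simp add: mult_ac)
    also have "\<dots> = fps_X * ((moment_fps \<nu>' - 1) * (fps_X * (moment_fps \<nu> + 1) - ?\<beta> * (moment_fps \<nu> - 1)))"
      unfolding step ..
    also have "\<dots> = (2 * b.star_fps 0) * (fps_X * (2 * a.mop_fps 0 - ?\<beta> * (2 * a.star_fps 0)))"
      unfolding a.star_fps_0 a.mop_fps_0 b.star_fps_0 by (simp add: mult_ac)
    also have "\<dots> = 4 * (b.star_fps 0 * a.mop_fps (Suc 0))"
      by (simp add: a.mop_fps_Suc algebra_simps)
    finally show ?case by simp
  next
    case (Suc n)
    define \<alpha> \<beta> where "\<alpha> = fps_const (verblunsky \<nu> (Suc n))" and "\<beta> = fps_const (cnj (verblunsky \<nu> (Suc n)))"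
    have v: "verblunsky \<nu>' n = verblunsky \<nu> (Suc n)" by (rule coeff[OF Suc])
    \<comment> \<open>With a common coefficient both pairs undergo the same linear map, so their
      cross difference is multiplied by its determinant z (1 - |a|^2), a being that
      coefficient.\<close>
    have "b.mop_fps (Suc n) * a.star_fps (Suc (Suc n)) - b.star_fps (Suc n) * a.mop_fps (Suc (Suc n))
      = fps_X * (1 - \<alpha> * \<beta>) * (b.mop_fps n * a.star_fps (Suc n) - b.star_fps n * a.mop_fps (Suc n))"
      unfolding a.mop_fps_Suc[of "Suc n"] b.mop_fps_Suc[of n] a.star_fps_Suc[of "Suc n"] b.star_fps_Suc[of n] v
      by (simp add: \<alpha>_def \<beta>_def algebra_simps)
    then show ?case using Suc by simp
  qed
  then show ?thesis by (rule coeff)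
qed

section \<open>Schwarz integrals\<close>

text \<open>The Cauchy kernel is a geometric series, and the Schwarz kernel is twice it minus 1.
  Since u is merely integrable, the result also covers log w.\<close>

lemma kernel_power_series:
  fixes u :: "real \<Rightarrow> complex"
  assumes u: "integrable M u" and M: "sets M = sets borel" and z: "norm z < 1"
  shows "(\<lambda>n. (\<integral>\<theta>. cnj (cis \<theta>) ^ n * u \<theta> \<partial>M) * z ^ n) sums (\<integral>\<theta>. cis \<theta> / (cis \<theta> - z) * u \<theta> \<partial>M)"
    and "(\<integral>\<theta>. (cis \<theta> + z) / (cis \<theta> - z) * u \<theta> \<partial>M)
       = 2 * (\<integral>\<theta>. cis \<theta> / (cis \<theta> - z) * u \<theta> \<partial>M) - (\<integral>\<theta>. u \<theta> \<partial>M)"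
proof -
  have ne: "cis \<theta> \<noteq> z" for \<theta> using z by auto
  define f where "f n \<theta> = (cnj (cis \<theta>) ^ n * z ^ n) * u \<theta>" for n \<theta>
  have int: "integrable M (f n)" for n
    unfolding f_def
    by (rule integrable_mult_circle[OF u M, of "\<lambda>\<zeta>. cnj \<zeta> ^ n * z ^ n"]) (intro continuous_intros)
  have nf: "norm (f n \<theta>) = norm z ^ n * norm (u \<theta>)" for n \<theta>
    by (simp add: f_def norm_mult norm_power)
  have geo: "(\<Sum>n. f n \<theta>) = cis \<theta> / (cis \<theta> - z) * u \<theta>" for \<theta>
  proof -
    have "norm (cnj (cis \<theta>) * z) < 1" using z by (simp add: norm_mult)
    then have s: "(\<lambda>n. (cnj (cis \<theta>) * z) ^ n) sums (1 / (1 - cnj (cis \<theta>) * z))"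
      by (rule geometric_sums)
    have c: "cnj (cis \<theta>) = 1 / cis \<theta>"
      using circle_unit_power_quotient[of "cis \<theta>" 0 1] by simp
    have "1 / (1 - cnj (cis \<theta>) * z) = cis \<theta> / (cis \<theta> - z)"
      unfolding c using ne[of \<theta>] by (simp add: field_simps)
    then have "(\<lambda>n. f n \<theta>) sums (cis \<theta> / (cis \<theta> - z) * u \<theta>)"
      using sums_mult2[OF s, of "u \<theta>"] by (simp add: f_def power_mult_distrib)
    then show ?thesis by (simp add: sums_iff)
  qed
  have "(\<lambda>n. integral\<^sup>L M (f n)) sums (\<integral>\<theta>. (\<Sum>n. f n \<theta>) \<partial>M)"
  proof (rule sums_integral)
    show "AE x in M. summable (\<lambda>n. norm (f n x))"
      unfolding nf using z by (auto intro!: summable_mult2 summable_geometric)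
    have "(\<integral>x. norm (f n x) \<partial>M) = norm z ^ n * (\<integral>x. norm (u x) \<partial>M)" for n
      by (simp add: nf)
    then show "summable (\<lambda>n. \<integral>x. norm (f n x) \<partial>M)"
      using z by (simp add: summable_mult2 summable_geometric)
  qed (fact int)
  moreover have "integral\<^sup>L M (f n) = (\<integral>\<theta>. cnj (cis \<theta>) ^ n * u \<theta> \<partial>M) * z ^ n" for n
  proof -
    have "f n = (\<lambda>\<theta>. (cnj (cis \<theta>) ^ n * u \<theta>) * z ^ n)"
      by (simp add: f_def fun_eq_iff mult_ac)
    then show ?thesis by simp
  qed
  ultimately show "(\<lambda>n. (\<integral>\<theta>. cnj (cis \<theta>) ^ n * u \<theta> \<partial>M) * z ^ n) sums (\<integral>\<theta>. cis \<theta> / (cis \<theta> - z) * u \<theta> \<partial>M)"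
    by (simp add: geo)
  have i: "integrable M (\<lambda>\<theta>. cis \<theta> / (cis \<theta> - z) * u \<theta>)"
    using z by (intro integrable_mult_circle[OF u M, of "\<lambda>\<zeta>. \<zeta> / (\<zeta> - z)"])
      (auto intro!: continuous_intros)
  have "(cis \<theta> + z) / (cis \<theta> - z) * u \<theta> = 2 * (cis \<theta> / (cis \<theta> - z) * u \<theta>) - u \<theta>" for \<theta>
    using ne[of \<theta>] by (simp add: field_simps)
  then have "(\<integral>\<theta>. (cis \<theta> + z) / (cis \<theta> - z) * u \<theta> \<partial>M)
      = (\<integral>\<theta>. 2 * (cis \<theta> / (cis \<theta> - z) * u \<theta>) - u \<theta> \<partial>M)"
    by simp
  also have "\<dots> = 2 * (\<integral>\<theta>. cis \<theta> / (cis \<theta> - z) * u \<theta> \<partial>M) - (\<integral>\<theta>. u \<theta> \<partial>M)"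
    using i u by (simp del: times_divide_eq_left times_divide_eq_right)
  finally show "(\<integral>\<theta>. (cis \<theta> + z) / (cis \<theta> - z) * u \<theta> \<partial>M)
       = 2 * (\<integral>\<theta>. cis \<theta> / (cis \<theta> - z) * u \<theta> \<partial>M) - (\<integral>\<theta>. u \<theta> \<partial>M)" .
qed

lemma schwarz_holomorphic:
  fixes u :: "real \<Rightarrow> complex"
  assumes "integrable M u" "sets M = sets borel"
  shows "(\<lambda>z. \<integral>\<theta>. (cis \<theta> + z) / (cis \<theta> - z) * u \<theta> \<partial>M) holomorphic_on ball 0 1"
proof -
  have "(\<lambda>z. \<integral>\<theta>. cis \<theta> / (cis \<theta> - z) * u \<theta> \<partial>M) holomorphic_on ball 0 1"
    by (rule power_series_holomorphic[where a = "\<lambda>n. \<integral>\<theta>. cnj (cis \<theta>) ^ n * u \<theta> \<partial>M"])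
       (use kernel_power_series(1)[OF assms] in auto)
  then have "(\<lambda>z. 2 * (\<integral>\<theta>. cis \<theta> / (cis \<theta> - z) * u \<theta> \<partial>M) - (\<integral>\<theta>. u \<theta> \<partial>M)) holomorphic_on ball 0 1"
    by (intro holomorphic_intros)
  then show ?thesis
    by (rule holomorphic_transform) (use kernel_power_series(2)[OF assms] in auto)
qed

lemma carath_has_fps_expansion:
  assumes "circle_prob \<nu>"
  shows "carath \<nu> has_fps_expansion moment_fps \<nu>"
proof (rule has_fps_expansionI)
  have i: "integrable \<nu> (\<lambda>_. 1 :: complex)"
    using finite_measure.integrable_const[OF circle_prob_finite[OF assms]] .
  have m: "(\<integral>\<theta>. (1::complex) \<partial>\<nu>) = 1"
    using assms sets_eq_imp_space_eq[OF circle_prob_sets[OF assms]] by (simp add: circle_prob_def measure_def)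
  have "(\<lambda>n. moment_fps \<nu> $ n * z ^ n) sums carath \<nu> z" if "z \<in> ball 0 1" for z
  proof -
    have "norm z < 1" using that by simp
    note k = kernel_power_series[OF i circle_prob_sets[OF assms] this]
    have "(\<lambda>n. 2 * ((\<integral>\<theta>. cnj (cis \<theta>) ^ n \<partial>\<nu>) * z ^ n) - (if n = 0 then 1 else 0)) sums
       (2 * (\<integral>\<theta>. cis \<theta> / (cis \<theta> - z) \<partial>\<nu>) - 1)"
      using k(1) by (intro sums_diff sums_mult) (use sums_single[of 0 "\<lambda>_. 1::complex"] in auto)
    also have "2 * (\<integral>\<theta>. cis \<theta> / (cis \<theta> - z) \<partial>\<nu>) - 1 = carath \<nu> z"
      using k(2) m by (simp add: carath_def)
    also have "(\<lambda>n. 2 * ((\<integral>\<theta>. cnj (cis \<theta>) ^ n \<partial>\<nu>) * z ^ n) - (if n = 0 then 1 else 0))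
        = (\<lambda>n. moment_fps \<nu> $ n * z ^ n)"
      using m by (auto simp: fun_eq_iff moment_fps_def)
    finally show ?thesis .
  qed
  then show "\<forall>\<^sub>F z in nhds 0. (\<lambda>n. moment_fps \<nu> $ n * z ^ n) sums carath \<nu> z"
    by (intro eventually_nhds_in_open[THEN eventually_mono, of "ball 0 1"]) auto
qed

lemma integrable_of_real_arc:
  "integrable arc_measure u \<Longrightarrow> integrable arc_measure (\<lambda>\<theta>. complex_of_real (u \<theta>))"
  by auto

text \<open>The Taylor coefficients at 0 are Fourier coefficients of the difference d. Those of
  nonnegative index vanish by hypothesis, the others by conjugation because d is real; then moments
  determine the rest.\<close>

theorem schwarz_integral_unique:
  fixes u v :: "real \<Rightarrow> real"
  assumes u: "integrable arc_measure u" and v: "integrable arc_measure v"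
    and eq: "\<And>z. norm z < 1 \<Longrightarrow> (\<integral>\<theta>. (cis \<theta> + z) / (cis \<theta> - z) * complex_of_real (u \<theta>) \<partial>arc_measure)
          = (\<integral>\<theta>. (cis \<theta> + z) / (cis \<theta> - z) * complex_of_real (v \<theta>) \<partial>arc_measure)"
  shows "AE \<theta> in arc_measure. u \<theta> = v \<theta>"
proof -
  define d where "d \<theta> = u \<theta> - v \<theta>" for \<theta>
  have d: "integrable arc_measure d" using u v by (simp add: d_def[abs_def])
  define c where "c n = (\<integral>\<theta>. cnj (cis \<theta>) ^ n * complex_of_real (d \<theta>) \<partial>arc_measure)" for n
  define C where "C z = (\<integral>\<theta>. cis \<theta> / (cis \<theta> - z) * complex_of_real (d \<theta>) \<partial>arc_measure)" for z
  have C: "(\<lambda>n. c n * z ^ n) sums C z" "2 * C z - c 0 = 0" if z: "norm z < 1" for z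
  proof -
    note k = kernel_power_series[OF integrable_of_real_arc[OF d] sets_arc_measure z]
    show "(\<lambda>n. c n * z ^ n) sums C z" using k(1) by (simp add: c_def C_def)
    have i: "integrable arc_measure (\<lambda>\<theta>. (cis \<theta> + z) / (cis \<theta> - z) * complex_of_real (x \<theta>))"
      if "integrable arc_measure x" for x
      by (rule integrable_mult_circle[OF integrable_of_real_arc[OF that], of "\<lambda>\<zeta>. (\<zeta> + z) / (\<zeta> - z)"])
        (use z in \<open>auto intro!: continuous_intros\<close>)
    have "(\<integral>\<theta>. (cis \<theta> + z) / (cis \<theta> - z) * complex_of_real (d \<theta>) \<partial>arc_measure) = 0"
      using eq[OF z] i[OF u] i[OF v] by (simp add: d_def ring_distribs)
    then show "2 * C z - c 0 = 0" using k(2) by (simp add: c_def C_def)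
  qed
  \<comment> \<open>The relation 2 C = c 0 at the origin gives c 0 = 0, and then C vanishes on the
    disc.\<close>
  have "C 0 = c 0"
    using C(1)[of 0] sums_unique2[OF C(1)[of 0] powser_sums_zero[of c]] by simp
  then have c0: "c 0 = 0" using C(2)[of 0] by simp
  then have C0: "C z = 0" if "norm z < 1" for z using C(2)[OF that] by simp
  have "(\<lambda>_. 0) has_fps_expansion Abs_fps c"
    by (rule has_fps_expansionI, rule eventually_nhds_in_open[THEN eventually_mono, of "ball 0 1"])
       (use C(1) C0 in auto)
  then have "Abs_fps c = 0"
    by (rule fps_expansion_unique_complex) (rule has_fps_expansion_0)
  then have cn: "c n = 0" for n
    by (metis fps_nth_Abs_fps fps_zero_nth)
  have cn': "(\<integral>\<theta>. cis \<theta> ^ n * complex_of_real (d \<theta>) \<partial>arc_measure) = 0" for n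
  proof -
    have "(\<integral>\<theta>. cis \<theta> ^ n * complex_of_real (d \<theta>) \<partial>arc_measure)
       = (\<integral>\<theta>. cnj (cnj (cis \<theta>) ^ n * complex_of_real (d \<theta>)) \<partial>arc_measure)"
      by simp
    also have "\<dots> = cnj (c n)"
      unfolding c_def by (rule Bochner_Integration.integral_cnj)
    finally show ?thesis by (simp add: cn)
  qed
  \<comment> \<open>Moment uniqueness concerns positive measures, so d is split into its positive
    and negative parts, used as densities.\<close>
  define P N where "P = density arc_measure (\<lambda>\<theta>. ennreal (max 0 (d \<theta>)))"
    and "N = density arc_measure (\<lambda>\<theta>. ennreal (max 0 (- d \<theta>)))"
  have dm [measurable]: "d \<in> borel_measurable borel"
    using borel_measurable_integrable[OF d] by (simp cong: measurable_cong_sets)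
  have props: "finite_measure (density arc_measure (\<lambda>\<theta>. ennreal (h \<theta>)))"
     "sets (density arc_measure (\<lambda>\<theta>. ennreal (h \<theta>))) = sets borel"
     "emeasure (density arc_measure (\<lambda>\<theta>. ennreal (h \<theta>))) (- {0..<2*pi}) = 0"
    if h: "integrable arc_measure h" "\<And>\<theta>. 0 \<le> h \<theta>" for h
  proof -
    have hm [measurable]: "h \<in> borel_measurable borel"
      using borel_measurable_integrable[OF h(1)] by (simp cong: measurable_cong_sets)
    show "finite_measure (density arc_measure (\<lambda>\<theta>. ennreal (h \<theta>)))"
      by (rule finite_measureI) (use h nn_integral_eq_integral[OF h(1)] in \<open>simp add: emeasure_density\<close>)
    show "sets (density arc_measure (\<lambda>\<theta>. ennreal (h \<theta>))) = sets borel" by simp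
    have "emeasure arc_measure (- {0..<2*pi}) = 0"
      by (simp add: emeasure_arc_measure)
    then have "- {0..<2*pi} \<in> null_sets arc_measure" by auto
    moreover have "absolutely_continuous arc_measure (density arc_measure (\<lambda>\<theta>. ennreal (h \<theta>)))"
      by (rule absolutely_continuousI_density) simp
    ultimately show "emeasure (density arc_measure (\<lambda>\<theta>. ennreal (h \<theta>))) (- {0..<2*pi}) = 0"
      unfolding absolutely_continuous_def by auto
  qed
  have iP: "integrable arc_measure (\<lambda>\<theta>. max 0 (d \<theta>))" and iN: "integrable arc_measure (\<lambda>\<theta>. max 0 (- d \<theta>))"
    using d by auto
  have "P = N"
    unfolding P_def N_def
  proof (rule circle_measure_eqI)
    fix n :: nat
    have id: "integrable arc_measure (\<lambda>\<theta>. cis \<theta> ^ n * complex_of_real (h \<theta>))"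
      if "integrable arc_measure h" for h
      by (rule integrable_mult_circle[OF integrable_of_real_arc[OF that], of "\<lambda>\<zeta>. \<zeta> ^ n"])
        (auto intro!: continuous_intros)
    have den: "(\<integral>\<theta>. cis \<theta> ^ n \<partial>density arc_measure (\<lambda>\<theta>. ennreal (h \<theta>)))
       = (\<integral>\<theta>. cis \<theta> ^ n * complex_of_real (h \<theta>) \<partial>arc_measure)"
      if [measurable]: "h \<in> borel_measurable borel" and "\<And>\<theta>. 0 \<le> h \<theta>" for h
      by (subst integral_density) (use that in \<open>auto simp: scaleR_conv_of_real mult.commute\<close>)
    have "(\<integral>\<theta>. cis \<theta> ^ n * complex_of_real (max 0 (d \<theta>)) \<partial>arc_measure)
        - (\<integral>\<theta>. cis \<theta> ^ n * complex_of_real (max 0 (- d \<theta>)) \<partial>arc_measure)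
       = (\<integral>\<theta>. cis \<theta> ^ n * complex_of_real (max 0 (d \<theta>)) - cis \<theta> ^ n * complex_of_real (max 0 (- d \<theta>)) \<partial>arc_measure)"
      using id[OF iP] id[OF iN] by simp
    also have "\<dots> = (\<integral>\<theta>. cis \<theta> ^ n * complex_of_real (d \<theta>) \<partial>arc_measure)"
      by (intro Bochner_Integration.integral_cong) (auto simp: max_def)
    finally have "(\<integral>\<theta>. cis \<theta> ^ n * complex_of_real (max 0 (d \<theta>)) \<partial>arc_measure)
        = (\<integral>\<theta>. cis \<theta> ^ n * complex_of_real (max 0 (- d \<theta>)) \<partial>arc_measure)"
      by (simp add: cn')
    then show "(\<integral>\<theta>. cis \<theta> ^ n \<partial>density arc_measure (\<lambda>\<theta>. ennreal (max 0 (d \<theta>)))) =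
        (\<integral>\<theta>. cis \<theta> ^ n \<partial>density arc_measure (\<lambda>\<theta>. ennreal (max 0 (- d \<theta>))))"
      by (subst (1 2) den) auto
  qed (intro props iP iN; simp)+
  interpret finite_measure arc_measure by (rule finite_measure_arc)
  have "AE \<theta> in arc_measure. ennreal (max 0 (d \<theta>)) = ennreal (max 0 (- d \<theta>))"
    using \<open>P = N\<close> unfolding P_def N_def by (subst (asm) density_unique_iff) auto
  then show ?thesis
    by eventually_elim (auto simp: d_def max_def split: if_splits)
qed

lemma AE_circle_eq_imp_eq:
  fixes u v :: "complex \<Rightarrow> real"
  assumes u: "continuous_on (sphere 0 1) u" and v: "continuous_on (sphere 0 1) v"
    and AE: "AE \<theta> in arc_measure. u (cis \<theta>) = v (cis \<theta>)" and z: "norm z = 1"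
  shows "u z = v z"
proof (rule ccontr)
  assume ne: "u z \<noteq> v z"
  define h where "h \<theta> = u (cis \<theta>) - v (cis \<theta>)" for \<theta>
  have hc: "continuous_on UNIV h"
    unfolding h_def by (intro continuous_intros continuous_on_circle_comp u v)
  define t where "t = Arg2pi z"
  have t: "0 \<le> t" "t < 2*pi" "cis t = z"
    using Arg2pi[of z] Arg2pi_eq[of z] z by (simp_all add: t_def cis_conv_exp)
  have "open {\<theta>. h \<theta> \<noteq> 0}"
    using hc by (intro open_Collect_neq) (auto intro!: continuous_intros)
  moreover have "t \<in> {\<theta>. h \<theta> \<noteq> 0}" using ne t by (simp add: h_def)
  ultimately obtain e where e: "e > 0" "ball t e \<subseteq> {\<theta>. h \<theta> \<noteq> 0}"
    using open_contains_ball by blast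
  \<comment> \<open>A one-sided interval to the right of t stays inside [0, 2 pi) even when t =
    0.\<close>
  define s where "s = min (t + e) (2*pi)"
  have s: "t < s" using e t by (simp add: s_def)
  have "AE \<theta> in lborel. \<theta> \<in> {0..<2*pi} \<longrightarrow> u (cis \<theta>) = v (cis \<theta>)"
  proof -
    have m: "(\<lambda>\<theta>. u (cis \<theta>)) \<in> borel_measurable borel" "(\<lambda>\<theta>. v (cis \<theta>)) \<in> borel_measurable borel"
      by (intro borel_measurable_continuous_onI continuous_on_circle_comp u v)+
    have "Measurable.pred borel (\<lambda>\<theta>. u (cis \<theta>) = v (cis \<theta>))"
      using m by measurable
    then show ?thesis using AE AE_arc_iff by blast
  qed
  moreover have "x \<in> {0..<2*pi} \<and> u (cis x) \<noteq> v (cis x)" if "x \<in> {t<..<s}" for x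
  proof -
    have "x \<in> ball t e" using that by (auto simp: s_def dist_real_def)
    then have "h x \<noteq> 0" using e(2) by blast
    then show ?thesis using that t by (auto simp: s_def h_def)
  qed
  ultimately have "AE \<theta> in lborel. \<theta> \<notin> {t<..<s}"
    by (auto elim: eventually_mono)
  moreover have "{x. t < x \<and> x < s} = {t<..<s}" by auto
  ultimately have "emeasure lborel {t<..<s} = 0"
    using AE_iff_measurable[of "{t<..<s}" lborel "\<lambda>\<theta>. \<theta> \<notin> {t<..<s}"] by auto
  then show False using s by simp
qed

section \<open>Mean values over the circle and the Schwarz formula\<close>

lemma has_contour_integral_circle_arc:
  assumes "continuous_on (sphere 0 1) h" and "((\<lambda>\<zeta>. h \<zeta> / \<zeta>) has_contour_integral I) (circlepath 0 1)"
  shows "(\<integral>\<theta>. h (cis \<theta>) \<partial>arc_measure) = I / (2 * pi * \<i>)"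
proof -
  have "((\<lambda>t. h (cis t) / cis t * \<i> * cis t) has_integral I) {0..2*pi}"
    using assms(2) has_contour_integral_part_circlepath_iff[of 0 "2*pi" "\<lambda>\<zeta>. h \<zeta> / \<zeta>" I 0 1]
    by (simp add: circlepath_def)
  then have "((\<lambda>t. \<i> * h (cis t)) has_integral I) {0..2*pi}"
    by (simp add: mult.commute)
  from has_integral_mult_right[OF this, of "-\<i>"]
  have "((\<lambda>t. h (cis t)) has_integral (-\<i> * I)) {0..2*pi}" by (simp flip: mult.assoc)
  then have "integral {0..2*pi} (\<lambda>t. h (cis t)) = -\<i> * I" by (rule integral_unique)
  then show ?thesis
    by (subst integral_arc) (use assms(1) in \<open>auto simp: field_simps intro!: continuous_on_circle_comp\<close>)
qed

lemma circle_mean_value: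
  assumes "h holomorphic_on ball 0 \<rho>" "\<rho> > 1"
  shows "(\<integral>\<theta>. h (cis \<theta>) \<partial>arc_measure) = h 0"
proof -
  have h: "h holomorphic_on cball 0 1"
    by (rule holomorphic_on_subset[OF assms(1)]) (use assms(2) in auto)
  have "((\<lambda>u. h u / (u - 0)) has_contour_integral (2 * of_real pi * \<i> * h 0)) (circlepath 0 1)"
    by (rule Cauchy_integral_circlepath_simple[OF h]) simp
  then have "(\<integral>\<theta>. h (cis \<theta>) \<partial>arc_measure) = (2 * of_real pi * \<i> * h 0) / (2 * pi * \<i>)"
    by (intro has_contour_integral_circle_arc)
      (auto intro: continuous_on_subset[OF holomorphic_on_imp_continuous_on[OF h]])
  then show ?thesis by simp
qed

text \<open>Write the real part as half the sum of F and its conjugate. The F part has mean 2 F(z) -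
  F(0). On the circle the kernel is the conjugate of (1 + cnj z zeta) / (1 - cnj z zeta), analytic
  near the closed disc, so the conjugate part has mean cnj (F 0), which is F(0) by the
  normalisation.\<close>

theorem schwarz_formula:
  assumes F: "F holomorphic_on ball 0 \<rho>" and \<rho>: "\<rho> > 1" and F0: "Im (F 0) = 0" and z: "norm z < 1"
  shows "(\<integral>\<theta>. (cis \<theta> + z) / (cis \<theta> - z) * complex_of_real (Re (F (cis \<theta>))) \<partial>arc_measure) = F z"
proof -
  \<comment> \<open>Here r exceeds 1 while |z| r stays below 1, which keeps 1 - cnj z zeta away from
    0. Unlike 1 / |z|, this bound also makes sense at z = 0.\<close>
  define r where "r = min \<rho> (2 / (1 + norm z))"
  have r: "r > 1" using \<rho> z by (simp add: r_def field_simps add_pos_nonneg)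
  have small: "norm (cnj z * \<zeta>) < 1" if "\<zeta> \<in> ball 0 r" for \<zeta>
  proof -
    have "norm z * norm \<zeta> \<le> norm z * (2 / (1 + norm z))"
      using that by (intro mult_left_mono) (auto simp: r_def)
    moreover have "norm z * (2 / (1 + norm z)) < 1"
      using z by (simp add: field_simps add_pos_nonneg)
    ultimately show ?thesis by (simp add: norm_mult)
  qed
  have ne: "1 - cnj z * \<zeta> \<noteq> 0" if "\<zeta> \<in> ball 0 r" for \<zeta>
    using small[OF that] by auto
  have unit: "cnj (cis t) = 1 / cis t" for t
    using circle_unit_power_quotient[of "cis t" 0 1] by simp
  have nez: "cis t \<noteq> z" for t using z by auto
  have Fr: "F holomorphic_on ball 0 r"
    by (rule holomorphic_on_subset[OF F]) (auto simp: r_def)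
  have Fc: "continuous_on (sphere 0 1) F"
    by (rule continuous_on_subset[OF holomorphic_on_imp_continuous_on[OF F]]) (use \<rho> in auto)
  have kc: "continuous_on (sphere 0 1) (\<lambda>\<zeta>. (\<zeta> + z) / (\<zeta> - z))"
    using z by (auto intro!: continuous_intros)
  have kc2: "continuous_on (sphere 0 1) (\<lambda>\<zeta>. \<zeta> / (\<zeta> - z))"
    using z by (auto intro!: continuous_intros)
  note ic = integrable_circle[OF finite_measure_arc sets_arc_measure]
  have one: "(\<integral>\<theta>. cis \<theta> / (cis \<theta> - z) \<partial>arc_measure) = 1"
  proof -
    have "cis t / (cis t - z) = cnj (1 / (1 - cnj z * cis t))" for t
      using nez[of t] by (simp add: unit field_simps)
    then have "(\<integral>\<theta>. cis \<theta> / (cis \<theta> - z) \<partial>arc_measure) = (\<integral>\<theta>. cnj (1 / (1 - cnj z * cis \<theta>)) \<partial>arc_measure)"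
      by simp
    also have "\<dots> = cnj (\<integral>\<theta>. 1 / (1 - cnj z * cis \<theta>) \<partial>arc_measure)"
      by (rule Bochner_Integration.integral_cnj)
    also have "(\<integral>\<theta>. 1 / (1 - cnj z * cis \<theta>) \<partial>arc_measure) = 1 / (1 - cnj z * 0)"
      by (rule circle_mean_value[of "\<lambda>\<zeta>. 1 / (1 - cnj z * \<zeta>)", OF _ r])
         (use ne in \<open>auto intro!: holomorphic_intros\<close>)
    finally show ?thesis by simp
  qed
  have A: "(\<integral>\<theta>. (cis \<theta> + z) / (cis \<theta> - z) * F (cis \<theta>) \<partial>arc_measure) = 2 * F z - F 0"
  proof -
    \<comment> \<open>The difference quotient with its singularity removed: it splits off the pole
      at z and leaves mean values of holomorphic functions.\<close>
    define q where "q \<zeta> = (if \<zeta> = z then deriv F z else (F \<zeta> - F z) / (\<zeta> - z))" for \<zeta>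
    have q: "q holomorphic_on ball 0 \<rho>"
      unfolding q_def by (rule pole_lemma_open[OF F]) simp
    have qc: "continuous_on (sphere 0 1) q"
      by (rule continuous_on_subset[OF holomorphic_on_imp_continuous_on[OF q]]) (use \<rho> in auto)
    have "(cis t + z) / (cis t - z) * F (cis t) = 2 * (cis t * q (cis t)) + 2 * F z * (cis t / (cis t - z)) - F (cis t)" for t
      using nez[of t] by (simp add: q_def divide_simps) (simp add: algebra_simps)
    then have "(\<integral>\<theta>. (cis \<theta> + z) / (cis \<theta> - z) * F (cis \<theta>) \<partial>arc_measure)
      = (\<integral>\<theta>. 2 * (cis \<theta> * q (cis \<theta>)) + 2 * F z * (cis \<theta> / (cis \<theta> - z)) - F (cis \<theta>) \<partial>arc_measure)"
      by simp
    also have "\<dots> = 2 * (\<integral>\<theta>. cis \<theta> * q (cis \<theta>) \<partial>arc_measure)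
        + 2 * F z * (\<integral>\<theta>. cis \<theta> / (cis \<theta> - z) \<partial>arc_measure) - (\<integral>\<theta>. F (cis \<theta>) \<partial>arc_measure)"
    proof -
      have i1: "integrable arc_measure (\<lambda>\<theta>. cis \<theta> * q (cis \<theta>))"
        by (rule ic[of "\<lambda>\<zeta>. \<zeta> * q \<zeta>"]) (intro continuous_intros qc)
      show ?thesis
        using i1 ic[OF kc2] ic[OF Fc] by (simp del: times_divide_eq_left times_divide_eq_right)
    qed
    also have "(\<integral>\<theta>. cis \<theta> * q (cis \<theta>) \<partial>arc_measure) = 0 * q 0"
      by (rule circle_mean_value[of "\<lambda>\<zeta>. \<zeta> * q \<zeta>", OF _ \<rho>]) (intro holomorphic_intros q)
    also have "(\<integral>\<theta>. F (cis \<theta>) \<partial>arc_measure) = F 0"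
      by (rule circle_mean_value[OF F \<rho>])
    finally show ?thesis by (simp add: one)
  qed
  have B: "(\<integral>\<theta>. (cis \<theta> + z) / (cis \<theta> - z) * cnj (F (cis \<theta>)) \<partial>arc_measure) = cnj (F 0)"
  proof -
    have "(cis t + z) / (cis t - z) * cnj (F (cis t)) = cnj ((1 + cnj z * cis t) / (1 - cnj z * cis t) * F (cis t))" for t
      using nez[of t] by (simp add: unit field_simps)
    then have "(\<integral>\<theta>. (cis \<theta> + z) / (cis \<theta> - z) * cnj (F (cis \<theta>)) \<partial>arc_measure)
      = (\<integral>\<theta>. cnj ((1 + cnj z * cis \<theta>) / (1 - cnj z * cis \<theta>) * F (cis \<theta>)) \<partial>arc_measure)"
      by simp
    also have "\<dots> = cnj (\<integral>\<theta>. (1 + cnj z * cis \<theta>) / (1 - cnj z * cis \<theta>) * F (cis \<theta>) \<partial>arc_measure)"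
      by (rule Bochner_Integration.integral_cnj)
    also have "(\<integral>\<theta>. (1 + cnj z * cis \<theta>) / (1 - cnj z * cis \<theta>) * F (cis \<theta>) \<partial>arc_measure)
       = (1 + cnj z * 0) / (1 - cnj z * 0) * F 0"
      by (rule circle_mean_value[of "\<lambda>\<zeta>. (1 + cnj z * \<zeta>) / (1 - cnj z * \<zeta>) * F \<zeta>", OF _ r])
         (use ne in \<open>auto intro!: holomorphic_intros Fr\<close>)
    finally show ?thesis by simp
  qed
  have "complex_of_real (Re w) = w / 2 + cnj w / 2" for w
    by (simp add: complex_eq_iff)
  then have "(\<integral>\<theta>. (cis \<theta> + z) / (cis \<theta> - z) * complex_of_real (Re (F (cis \<theta>))) \<partial>arc_measure)
    = (\<integral>\<theta>. ((cis \<theta> + z) / (cis \<theta> - z) * F (cis \<theta>)) / 2 + ((cis \<theta> + z) / (cis \<theta> - z) * cnj (F (cis \<theta>))) / 2 \<partial>arc_measure)"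
    by (simp add: ring_distribs)
  also have "\<dots> = (\<integral>\<theta>. (cis \<theta> + z) / (cis \<theta> - z) * F (cis \<theta>) \<partial>arc_measure) / 2
      + (\<integral>\<theta>. (cis \<theta> + z) / (cis \<theta> - z) * cnj (F (cis \<theta>)) \<partial>arc_measure) / 2"
  proof -
    have "integrable arc_measure (\<lambda>\<theta>. (cis \<theta> + z) / (cis \<theta> - z) * F (cis \<theta>))"
      by (rule ic[of "\<lambda>\<zeta>. (\<zeta> + z) / (\<zeta> - z) * F \<zeta>"]) (intro continuous_on_mult kc Fc)
    moreover have "integrable arc_measure (\<lambda>\<theta>. (cis \<theta> + z) / (cis \<theta> - z) * cnj (F (cis \<theta>)))"
      by (rule ic[of "\<lambda>\<zeta>. (\<zeta> + z) / (\<zeta> - z) * cnj (F \<zeta>)"]) (intro continuous_on_mult continuous_on_cnj kc Fc)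
    moreover have "(\<integral>\<theta>. f \<theta> / 2 + h \<theta> / 2 \<partial>arc_measure) = (\<integral>\<theta>. f \<theta> \<partial>arc_measure) / 2 + (\<integral>\<theta>. h \<theta> \<partial>arc_measure) / 2"
      if "integrable arc_measure f" "integrable arc_measure h" for f h :: "real \<Rightarrow> complex"
      using that by simp
    ultimately show ?thesis by blast
  qed
  also have "\<dots> = F z"
    unfolding A B using F0 by (simp add: complex_eq_iff diff_divide_distrib)
  finally show ?thesis .
qed


section \<open>Analytic continuation of the Caratheodory function\<close>

text \<open>The domain is unbounded on purpose: it serves the annulus around the circle and, later,
  the whole exterior part of the large disc.\<close>

lemma holomorphic_reflect:
  assumes "f holomorphic_on ball 0 \<rho>" "\<rho> > 0"
  shows "(\<lambda>z. cnj (f (1 / cnj z))) holomorphic_on {z. 1 / \<rho> < norm z}"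
proof -
  have "cnj ` ball 0 \<rho> = ball 0 \<rho>"
    by (auto simp: image_cnj_conv_vimage_cnj)
  then have a: "(cnj \<circ> f \<circ> cnj) holomorphic_on ball 0 \<rho>"
    using assms by (intro holomorphic_on_compose_cnj_cnj) auto
  have b: "(\<lambda>z::complex. 1 / z) holomorphic_on {z. 1 / \<rho> < norm z}"
    using assms by (auto intro!: holomorphic_intros)
  have c: "(\<lambda>z::complex. 1 / z) ` {z. 1 / \<rho> < norm z} \<subseteq> ball 0 \<rho>"
  proof clarify
    fix z :: complex assume z: "1 / \<rho> < norm z"
    then have "0 < norm z" using assms(2) by (meson divide_pos_pos less_trans zero_less_one)
    then show "1 / z \<in> ball 0 \<rho>"
      using z assms(2) by (simp add: norm_divide field_simps)
  qed
  show ?thesis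
    using holomorphic_on_compose_gen[OF b a c] by (simp add: o_def)
qed

text \<open>The coefficient is a contour integral of W(z) / z^(n+1); moving the contour from radius
  1 to radius r gains the factor r^(-n).\<close>

lemma annulus_fourier_bound:
  assumes W: "W holomorphic_on {z. 1 / \<rho> < norm z \<and> norm z < \<rho>}" and r: "1 < r" "r < \<rho>"
  obtains B where "\<And>n. norm (\<integral>\<theta>. cnj (cis \<theta>) ^ n * W (cis \<theta>) \<partial>arc_measure) \<le> B / r ^ n"
proof -
  define A where "A = {z::complex. 1 / \<rho> < norm z \<and> norm z < \<rho>}"
  have WA: "W holomorphic_on A" using W by (simp add: A_def)
  have \<rho>: "1 / \<rho> < 1" using r by simp
  have A: "open A" unfolding A_def by (intro open_Collect_conj open_Collect_less continuous_intros)
  have A0: "z \<noteq> 0" if "z \<in> A" for z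
    using that r by (auto simp: A_def)
  have circ: "sphere 0 s \<subseteq> A" if "1 \<le> s" "s \<le> r" for s
    using that r less_le_trans[OF \<rho>] by (auto simp: A_def)
  have Wc: "continuous_on (sphere 0 s) W" if "1 \<le> s" "s \<le> r" for s
    using continuous_on_subset[OF holomorphic_on_imp_continuous_on[OF WA] circ[OF that]] .
  have "bounded (W ` sphere 0 r)"
    by (intro compact_imp_bounded compact_continuous_image Wc) (use r in auto)
  then obtain B where B: "\<forall>z\<in>sphere 0 r. norm (W z) \<le> B"
    unfolding bounded_iff by auto
  have "norm (W (of_real r)) \<le> B" using B r by auto
  then have B0: "0 \<le> B" using norm_ge_zero order_trans by blast
  have "norm (\<integral>\<theta>. cnj (cis \<theta>) ^ n * W (cis \<theta>) \<partial>arc_measure) \<le> B / r ^ n" for n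
  proof -
    define f where "f z = W z / z ^ n / z" for z
    have f: "f holomorphic_on A"
      unfolding f_def using A0 by (auto intro!: holomorphic_intros WA)
    have ci: "f contour_integrable_on circlepath 0 s" if "1 \<le> s" "s \<le> r" for s
      using that circ[OF that] holomorphic_on_imp_continuous_on[OF f]
      by (intro contour_integrable_continuous_circlepath) (auto intro: continuous_on_subset)
    have "contour_integral (circlepath 0 1) f = contour_integral (circlepath 0 r) f"
    proof (rule Cauchy_theorem_homotopic_loops[OF _ A f])
      \<comment> \<open>Corresponding points have the same argument, so the segments joining them
        are radial and stay in the annulus.\<close>
      show "homotopic_loops A (circlepath 0 1) (circlepath 0 r)"
      proof (rule homotopic_loops_linear)
        fix t :: real
        show "closed_segment (circlepath 0 1 t) (circlepath 0 r t) \<subseteq> A"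
        proof
          fix x assume "x \<in> closed_segment (circlepath 0 1 t) (circlepath 0 r t)"
          then obtain v where v: "0 \<le> v" "v \<le> 1"
              "x = (1 - v) *\<^sub>R circlepath 0 1 t + v *\<^sub>R circlepath 0 r t"
            by (auto simp: closed_segment_def)
          have "x = of_real (1 + v * (r - 1)) * exp (2 * of_real pi * \<i> * of_real t)"
            using v(3) by (simp add: circlepath scaleR_conv_of_real algebra_simps)
          then have "norm x = \<bar>1 + v * (r - 1)\<bar>"
            by (simp add: norm_mult del: of_real_add of_real_mult of_real_diff)
          moreover have "0 \<le> v * (r - 1)" "v * (r - 1) \<le> r - 1"
            using v r mult_right_mono[of v 1 "r - 1"] by auto
          ultimately have "1 \<le> norm x" "norm x \<le> r" by auto
          then show "x \<in> A" using circ[of "norm x"] by auto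
        qed
      qed auto
    qed auto
    then have fr: "(f has_contour_integral contour_integral (circlepath 0 1) f) (circlepath 0 r)"
      using ci[of r] r has_contour_integral_integral by fastforce
    have "norm (f x) \<le> B / r ^ n / r" if "norm (x - 0) = r" for x
      using that B r by (simp add: f_def norm_divide norm_mult norm_power divide_right_mono)
    then have "norm (contour_integral (circlepath 0 1) f) \<le> (B / r ^ n / r) * (2 * pi * r)"
      using r B0 by (intro has_contour_integral_bound_circlepath[OF fr]) auto
    also have "\<dots> = (B / r ^ n) * (2 * pi)" using r by simp
    finally have bd: "norm (contour_integral (circlepath 0 1) f) \<le> (B / r ^ n) * (2 * pi)" .
    have "continuous_on (sphere 0 1) (\<lambda>z. W z / z ^ n)"
      using Wc[of 1] r by (auto intro!: continuous_intros)
    moreover have "((\<lambda>z. W z / z ^ n / z) has_contour_integral contour_integral (circlepath 0 1) f) (circlepath 0 1)"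
      using ci[of 1] r has_contour_integral_integral by (fastforce simp: f_def[abs_def])
    ultimately have "(\<integral>\<theta>. W (cis \<theta>) / cis \<theta> ^ n \<partial>arc_measure) = contour_integral (circlepath 0 1) f / (2 * pi * \<i>)"
      by (rule has_contour_integral_circle_arc)
    moreover have "cnj (cis \<theta>) ^ n * W (cis \<theta>) = W (cis \<theta>) / cis \<theta> ^ n" for \<theta>
    proof -
      have "cnj (cis \<theta>) ^ n = 1 / cis \<theta> ^ n"
        using circle_unit_power_quotient[of "cis \<theta>" 0 n] by (cases "n = 0") auto
      then show ?thesis by (simp only: times_divide_eq_left mult_1_left)
    qed
    ultimately have "(\<integral>\<theta>. cnj (cis \<theta>) ^ n * W (cis \<theta>) \<partial>arc_measure)
        = contour_integral (circlepath 0 1) f / (2 * pi * \<i>)"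
      by presburger
    then have "norm (\<integral>\<theta>. cnj (cis \<theta>) ^ n * W (cis \<theta>) \<partial>arc_measure)
        = norm (contour_integral (circlepath 0 1) f) / (2 * pi)"
      by (simp add: norm_divide norm_mult)
    also have "\<dots> \<le> (B / r ^ n) * (2 * pi) / (2 * pi)"
      by (intro divide_right_mono bd) simp
    finally show ?thesis by simp
  qed
  then show ?thesis by (rule that)
qed

text \<open>The Taylor coefficients of the Schwarz integral of w are Fourier coefficients of W, and
  their decay makes the series converge on the disc of radius rho.\<close>

theorem carath_continuation:
  fixes w :: "real \<Rightarrow> real"
  assumes \<rho>: "\<rho> > 1" and W: "W holomorphic_on {z. 1 / \<rho> < norm z \<and> norm z < \<rho>}"
    and w: "\<And>\<theta>. W (cis \<theta>) = of_real (w \<theta>)"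
  obtains F where "F holomorphic_on ball 0 \<rho>"
    "\<And>z. norm z < 1 \<Longrightarrow> F z = (\<integral>\<theta>. (cis \<theta> + z) / (cis \<theta> - z) * of_real (w \<theta>) \<partial>arc_measure)"
    "\<And>z. 1 / \<rho> < norm z \<Longrightarrow> norm z < \<rho> \<Longrightarrow> F z + cnj (F (1 / cnj z)) = 2 * W z"
proof -
  define A where "A = {z::complex. 1 / \<rho> < norm z \<and> norm z < \<rho>}"
  have WA: "W holomorphic_on A" using W by (simp add: A_def)
  have sA: "sphere 0 1 \<subseteq> A" using \<rho> by (auto simp: A_def)
  have Wc: "continuous_on (sphere 0 1) W"
    using continuous_on_subset[OF holomorphic_on_imp_continuous_on[OF WA] sA] .
  have ReW: "w \<theta> = Re (W (cis \<theta>))" for \<theta> by (simp add: w)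
  have wi: "integrable arc_measure w"
    unfolding ReW[abs_def]
    by (rule integrable_circle_real[OF finite_measure_arc sets_arc_measure, of "\<lambda>z. Re (W z)"])
       (intro continuous_intros Wc)
  define c where "c n = (\<integral>\<theta>. cnj (cis \<theta>) ^ n * W (cis \<theta>) \<partial>arc_measure)" for n
  have sm: "summable (\<lambda>n. c n * z ^ n)" if z: "norm z < \<rho>" for z
  proof -
    obtain r where r: "max 1 (norm z) < r" "r < \<rho>"
      using dense[of "max 1 (norm z)" \<rho>] z \<rho> by auto
    obtain B where B: "\<And>n. norm (c n) \<le> B / r ^ n"
      using annulus_fourier_bound[OF W, of r] r unfolding c_def by auto
    show ?thesis
    proof (rule summable_comparison_test)
      show "\<exists>N. \<forall>n\<ge>N. norm (c n * z ^ n) \<le> B * (norm z / r) ^ n"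
        using mult_right_mono[OF B] by (auto simp: norm_mult norm_power power_divide intro!: exI[of _ 0])
      show "summable (\<lambda>n. B * (norm z / r) ^ n)"
        using r by (intro summable_mult summable_geometric) auto
    qed
  qed
  define F where "F z = 2 * (\<Sum>n. c n * z ^ n) - c 0" for z
  have F: "F holomorphic_on ball 0 \<rho>"
  proof -
    have "(\<lambda>z. \<Sum>n. c n * z ^ n) holomorphic_on ball 0 \<rho>"
      by (rule power_series_holomorphic[where a = c]) (use sm summable_sums in auto)
    then show ?thesis unfolding F_def by (intro holomorphic_intros)
  qed
  have F1: "F z = (\<integral>\<theta>. (cis \<theta> + z) / (cis \<theta> - z) * of_real (w \<theta>) \<partial>arc_measure)" if z: "norm z < 1" for z
  proof -
    note k = kernel_power_series[OF integrable_of_real_arc[OF wi] sets_arc_measure z]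
    show ?thesis
      unfolding k(2) sums_unique[OF k(1)] F_def c_def by (simp add: w)
  qed
  have F0: "Im (F 0) = 0"
  proof -
    have "F 0 = of_real (\<integral>\<theta>. w \<theta> \<partial>arc_measure)"
      using F1[of 0] by simp
    then show ?thesis by simp
  qed
  have Fc: "continuous_on (sphere 0 1) F"
    by (rule continuous_on_subset[OF holomorphic_on_imp_continuous_on[OF F]]) (use \<rho> in auto)
  \<comment> \<open>Inside the disc F is the Schwarz integral both of w and of its own boundary real
    part.\<close>
  have "AE \<theta> in arc_measure. Re (F (cis \<theta>)) = w \<theta>"
  proof (rule schwarz_integral_unique)
    show "integrable arc_measure (\<lambda>\<theta>. Re (F (cis \<theta>)))"
      by (rule integrable_circle_real[OF finite_measure_arc sets_arc_measure, of "\<lambda>z. Re (F z)"])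
         (intro continuous_intros Fc)
  qed (use schwarz_formula[OF F \<rho> F0] F1 wi in auto)
  then have "AE \<theta> in arc_measure. Re (F (cis \<theta>)) = Re (W (cis \<theta>))"
    by (simp add: ReW)
  then have circ: "Re (F z) = Re (W z)" if "norm z = 1" for z
    using AE_circle_eq_imp_eq[of "\<lambda>z. Re (F z)" "\<lambda>z. Re (W z)"] that
    by (auto intro!: continuous_intros Fc Wc)
  define E where "E z = F z + cnj (F (1 / cnj z)) - 2 * W z" for z
  \<comment> \<open>On the circle the reflected point is z itself and E reduces to 2 Re F - 2 W = 0;
    the identity theorem spreads this over the connected annulus.\<close>
  have "E z = 0" if z: "z \<in> A" for z
  proof (rule analytic_continuation[where f = E and S = A and U = "sphere 0 1" and \<xi> = 1])
    have "(\<lambda>z. cnj (F (1 / cnj z))) holomorphic_on A"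
      by (rule holomorphic_on_subset[OF holomorphic_reflect[OF F]]) (use \<rho> in \<open>auto simp: A_def\<close>)
    moreover have "F holomorphic_on A"
      by (rule holomorphic_on_subset[OF F]) (auto simp: A_def)
    ultimately show "E holomorphic_on A"
      unfolding E_def by (intro holomorphic_intros WA)
    show "open A" unfolding A_def by (intro open_Collect_conj open_Collect_less continuous_intros)
    show "connected A" using connected_annulus(1)[of "1/\<rho>" "0::complex" \<rho>] by (simp add: A_def)
    show "1 \<in> A" using \<rho> by (auto simp: A_def)
    show "1 islimpt sphere (0::complex) 1"
    proof (rule connected_imp_perfect)
      show "connected (sphere (0::complex) 1)" by (simp add: connected_sphere)
      show "sphere (0::complex) 1 \<noteq> {x}" for x
      proof
        assume "sphere (0::complex) 1 = {x}"
        then have "1 \<in> {x}" "-1 \<in> {x}" by (metis mem_sphere_0 norm_one, metis mem_sphere_0 norm_minus_cancel norm_one)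
        then show False by simp
      qed
    qed simp
    show "E z = 0" if "z \<in> sphere 0 1" for z
    proof -
      have nz: "norm z = 1" using that by simp
      have inv: "1 / cnj z = z"
        using circle_unit_power_quotient[of "cnj z" 0 1] nz by simp
      have "W z = of_real (Re (W z))"
      proof -
        have "z = cis (Arg2pi z)"
          using Arg2pi_eq[of z] nz by (simp add: cis_conv_exp)
        then show ?thesis using w[of "Arg2pi z"] by simp
      qed
      then show ?thesis
        unfolding E_def inv using circ[OF nz] by (simp add: complex_eq_iff)
    qed
  qed (use z sA in auto)
  then have "F z + cnj (F (1 / cnj z)) = 2 * W z" if "1 / \<rho> < norm z" "norm z < \<rho>" for z
    using that by (simp add: E_def A_def)
  with F F1 show ?thesis by (rule that)
qed

section \<open>The Szego function and its boundary values\<close>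

text \<open>The singular part lives on an arc-null set, which absolute continuity makes null for the
  measure too.\<close>

lemma szego_weight_density:
  assumes "sets \<nu> = sets borel" "absolutely_continuous arc_measure \<nu>" "szego_weight_ok \<nu> w"
  shows "\<nu> = density arc_measure (\<lambda>\<theta>. ennreal (w \<theta>))"
proof (rule measure_eqI)
  have wm [measurable]: "w \<in> borel_measurable borel"
    using assms(3) by (simp add: szego_weight_ok_def ac_weight_def)
  obtain N where N: "N \<in> null_sets arc_measure" "\<And>A. A \<in> sets borel \<Longrightarrow>
     emeasure \<nu> A = (\<integral>\<^sup>+\<theta>. ennreal (w \<theta>) * indicator A \<theta> \<partial>arc_measure) + emeasure \<nu> (A \<inter> N)"
    using assms(3) unfolding szego_weight_ok_def ac_weight_def by blast
  have "N \<in> null_sets \<nu>"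
    using assms(2) N(1) by (auto simp: absolutely_continuous_def)
  then have "emeasure \<nu> (A \<inter> N) = 0" if "A \<in> sets borel" for A
    using null_setsD1[OF null_set_Int1[of N \<nu> A]] that assms(1) by simp
  then show "emeasure \<nu> A = emeasure (density arc_measure (\<lambda>\<theta>. ennreal (w \<theta>))) A" if "A \<in> sets \<nu>" for A
    using that N(2) assms(1) by (simp add: emeasure_density)
qed (use assms in simp)

lemma integral_density_arc:
  fixes f :: "real \<Rightarrow> complex"
  assumes "w \<in> borel_measurable borel" "\<And>\<theta>. 0 \<le> w \<theta>" "f \<in> borel_measurable borel"
  shows "(\<integral>\<theta>. f \<theta> \<partial>density arc_measure (\<lambda>\<theta>. ennreal (w \<theta>))) = (\<integral>\<theta>. f \<theta> * of_real (w \<theta>) \<partial>arc_measure)"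
  using assms by (subst integral_density) (auto simp: scaleR_conv_of_real mult.commute)

lemma carath_density:
  assumes "w \<in> borel_measurable borel" "\<And>\<theta>. 0 \<le> w \<theta>"
  shows "carath (density arc_measure (\<lambda>\<theta>. ennreal (w \<theta>))) z
       = (\<integral>\<theta>. (cis \<theta> + z) / (cis \<theta> - z) * of_real (w \<theta>) \<partial>arc_measure)"
  unfolding carath_def by (rule integral_density_arc[OF assms]) measurable

lemma density_finite_integrable:
  assumes "w \<in> borel_measurable borel" "\<And>\<theta>. 0 \<le> w \<theta>" "emeasure (density arc_measure (\<lambda>\<theta>. ennreal (w \<theta>))) UNIV < \<infinity>"
  shows "integrable arc_measure w"
  using assms by (intro integrableI_nonneg) (auto simp: emeasure_density)

lemma szego_weight_ok_szego_weight: "szego_cond \<nu> \<Longrightarrow> szego_weight_ok \<nu> (szego_weight \<nu>)"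
  by (metis someI_ex szego_cond_def szego_weight_def)

lemma carath_bound:
  assumes \<nu>: "circle_prob \<nu>" and z: "norm z < 1"
  shows "norm (carath \<nu> z) \<le> 2 / (1 - norm z)"
proof -
  have "norm (carath \<nu> z) \<le> (\<integral>\<theta>. norm ((cis \<theta> + z) / (cis \<theta> - z)) \<partial>\<nu>)"
    unfolding carath_def by (rule integral_norm_bound)
  also have "\<dots> \<le> (\<integral>\<theta>. 2 / (1 - norm z) \<partial>\<nu>)"
  proof (rule integral_mono)
    show "integrable \<nu> (\<lambda>\<theta>. norm ((cis \<theta> + z) / (cis \<theta> - z)))"
      by (rule integrable_circle_real[OF circle_prob_finite[OF \<nu>] circle_prob_sets[OF \<nu>],
            of "\<lambda>\<zeta>. norm ((\<zeta> + z) / (\<zeta> - z))"]) (use z in \<open>auto intro!: continuous_intros\<close>)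
    show "integrable \<nu> (\<lambda>\<theta>. 2 / (1 - norm z))"
      using finite_measure.integrable_const[OF circle_prob_finite[OF \<nu>]] .
    show "norm ((cis \<theta> + z) / (cis \<theta> - z)) \<le> 2 / (1 - norm z)" for \<theta>
    proof -
      have "norm (cis \<theta> + z) \<le> 2" using norm_triangle_ineq[of "cis \<theta>" z] z by simp
      moreover have "1 - norm z \<le> norm (cis \<theta> - z)" using norm_triangle_ineq2[of "cis \<theta>" z] by simp
      ultimately show ?thesis
        using z by (auto simp: norm_divide intro!: frac_le)
    qed
  qed
  also have "\<dots> = 2 / (1 - norm z)"
    using \<nu> sets_eq_imp_space_eq[OF circle_prob_sets[OF \<nu>]] by (simp add: circle_prob_def measure_def)
  finally show ?thesis .
qed

text \<open>Jensen's inequality for the Poisson kernel, in the form \<open>exp x \<ge> exp c * (1 + x - c)\<close> integrated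
  with \<open>c\<close> the Poisson mean of \<open>x = ln w\<close>.\<close>

lemma szego_fun_sq_le_Re_carath:
  assumes \<nu>: "circle_prob \<nu>" and ac: "absolutely_continuous arc_measure \<nu>" and sz: "szego_cond \<nu>"
    and z: "norm z < 1"
  shows "(norm (szego_fun \<nu> z))\<^sup>2 \<le> Re (carath \<nu> z)"
proof -
  define w where "w = szego_weight \<nu>"
  have ok: "szego_weight_ok \<nu> w" unfolding w_def by (rule szego_weight_ok_szego_weight[OF sz])
  have wm: "w \<in> borel_measurable borel" and w0: "\<And>\<theta>. 0 \<le> w \<theta>"
    and wpos: "AE \<theta> in arc_measure. w \<theta> > 0" and li: "integrable arc_measure (\<lambda>\<theta>. ln (w \<theta>))"
    using ok by (auto simp: szego_weight_ok_def ac_weight_def)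
  have dens: "\<nu> = density arc_measure (\<lambda>\<theta>. ennreal (w \<theta>))"
    by (rule szego_weight_density[OF circle_prob_sets[OF \<nu>] ac ok])
  have "emeasure \<nu> UNIV < \<infinity>" using \<nu> by (simp add: circle_prob_def)
  then have wi: "integrable arc_measure w"
    using density_finite_integrable[OF wm w0] dens by simp
  define k where "k \<zeta> = (\<zeta> + z) / (\<zeta> - z)" for \<zeta>
  define P where "P \<theta> = Re (k (cis \<theta>))" for \<theta>
  have kc: "continuous_on (sphere 0 1) k"
    unfolding k_def using z by (auto intro!: continuous_intros)
  have ki: "integrable arc_measure (\<lambda>\<theta>. k (cis \<theta>) * of_real (u \<theta>))" if "integrable arc_measure u" for u
    by (rule integrable_mult_circle[OF integrable_of_real_arc[OF that] sets_arc_measure kc])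
  have Pi: "integrable arc_measure (\<lambda>\<theta>. P \<theta> * u \<theta>)"
    and PRe: "Re (\<integral>\<theta>. k (cis \<theta>) * of_real (u \<theta>) \<partial>arc_measure) = (\<integral>\<theta>. P \<theta> * u \<theta> \<partial>arc_measure)"
    if "integrable arc_measure u" for u
  proof -
    have e: "P \<theta> * u \<theta> = Re (k (cis \<theta>) * of_real (u \<theta>))" for \<theta> by (simp add: P_def)
    show "integrable arc_measure (\<lambda>\<theta>. P \<theta> * u \<theta>)"
      unfolding e using ki[OF that] by (rule integrable_Re)
    show "Re (\<integral>\<theta>. k (cis \<theta>) * of_real (u \<theta>) \<partial>arc_measure) = (\<integral>\<theta>. P \<theta> * u \<theta> \<partial>arc_measure)"
      unfolding e using integral_Re[OF ki[OF that]] by simp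
  qed
  have P0: "P \<theta> \<ge> 0" for \<theta>
  proof -
    have e: "Re ((\<zeta> + z) * cnj (\<zeta> - z)) = (norm \<zeta>)\<^sup>2 - (norm z)\<^sup>2" for \<zeta>
      by (simp add: cmod_power2) (simp add: algebra_simps power2_eq_square)
    have "Re (k (cis \<theta>)) = Re ((cis \<theta> + z) * cnj (cis \<theta> - z)) / (norm (cis \<theta> - z))\<^sup>2"
      unfolding k_def by (subst complex_div_cnj) (simp only: Re_divide_of_real of_real_power[symmetric])
    then have "Re (k (cis \<theta>)) = (1 - (norm z)\<^sup>2) / (norm (cis \<theta> - z))\<^sup>2"
      unfolding e by simp
    moreover have "(norm z)\<^sup>2 \<le> 1" using z by (simp add: power_le_one)
    ultimately show ?thesis by (simp add: P_def)
  qed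
  have i1: "integrable arc_measure (\<lambda>_. 1::real)"
    using finite_measure.integrable_const[OF finite_measure_arc] .
  have P1: "(\<integral>\<theta>. P \<theta> \<partial>arc_measure) = 1"
    using PRe[OF i1] schwarz_formula[of "\<lambda>_. 1" 2 z] z by (simp add: k_def)
  define c where "c = (\<integral>\<theta>. P \<theta> * ln (w \<theta>) \<partial>arc_measure)"
  have "(norm (szego_fun \<nu> z))\<^sup>2 = exp c"
  proof -
    have "norm (szego_fun \<nu> z) = exp (c / 2)"
      unfolding szego_fun_def norm_exp_eq_Re
      using PRe[OF li] by (simp add: c_def k_def w_def)
    then show ?thesis by (simp add: power2_eq_square flip: exp_add)
  qed
  also have "exp c = (\<integral>\<theta>. exp c * ((1 - c) * (P \<theta> * 1) + P \<theta> * ln (w \<theta>)) \<partial>arc_measure)"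
    using Pi[OF i1] Pi[OF li] P1 by (simp flip: c_def)
  also have "\<dots> \<le> (\<integral>\<theta>. P \<theta> * w \<theta> \<partial>arc_measure)"
  proof (rule integral_mono_AE)
    show "integrable arc_measure (\<lambda>\<theta>. exp c * ((1 - c) * (P \<theta> * 1) + P \<theta> * ln (w \<theta>)))"
      using Pi[OF i1] Pi[OF li] by simp
    show "integrable arc_measure (\<lambda>\<theta>. P \<theta> * w \<theta>)" by (rule Pi[OF wi])
    show "AE \<theta> in arc_measure. exp c * ((1 - c) * (P \<theta> * 1) + P \<theta> * ln (w \<theta>)) \<le> P \<theta> * w \<theta>"
      using wpos
    proof eventually_elim
      fix \<theta> assume w: "w \<theta> > 0"
      have "1 + (ln (w \<theta>) - c) \<le> exp (ln (w \<theta>) - c)" by (rule exp_ge_add_one_self)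
      also have "\<dots> = w \<theta> / exp c" using w by (simp add: exp_diff)
      finally have "exp c * (1 + (ln (w \<theta>) - c)) \<le> w \<theta>" by (simp add: field_simps)
      from mult_left_mono[OF this P0[of \<theta>]]
      show "exp c * ((1 - c) * (P \<theta> * 1) + P \<theta> * ln (w \<theta>)) \<le> P \<theta> * w \<theta>"
        by (simp add: algebra_simps)
    qed
  qed
  also have "\<dots> = Re (carath \<nu> z)"
    using PRe[OF wi] carath_density[OF wm w0, of z] dens by (simp add: k_def)
  finally show ?thesis .
qed

lemma szego_inverse_nonzero:
  assumes \<nu>: "circle_prob \<nu>" "absolutely_continuous arc_measure \<nu>" "szego_cond \<nu>"
    and R: "R > 1" and g: "g holomorphic_on ball 0 R"
    and inv: "\<And>z. norm z < 1 \<Longrightarrow> g z = 1 / szego_fun \<nu> z"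
    and z: "norm z \<le> 1"
  shows "g z \<noteq> 0"
proof (cases "norm z < 1")
  case True
  then show ?thesis using inv by (simp add: szego_fun_def)
next
  case False
  then have z1: "norm z = 1" using z by simp
  show ?thesis
  proof
    assume gz: "g z = 0"
    define q where "q \<zeta> = (if \<zeta> = z then deriv g z else (g \<zeta> - g z) / (\<zeta> - z))" for \<zeta>
    have "q holomorphic_on ball 0 R"
      unfolding q_def by (rule pole_lemma_open[OF g]) simp
    then have "continuous_on (cball 0 1) q"
      by (rule continuous_on_subset[OF holomorphic_on_imp_continuous_on]) (use R in auto)
    then have "bounded (q ` cball 0 1)"
      by (intro compact_imp_bounded compact_continuous_image) auto
    then obtain C where C: "\<forall>\<zeta>\<in>cball 0 1. norm (q \<zeta>) \<le> C"
      unfolding bounded_iff by auto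
    \<comment> \<open>At distance s inside the supposed zero, |D|^2 <= 2 / s and |g| <= C s give 1
      <= 2 C^2 s. This s makes the right side less than 1, and the + 1 covers C = 0.\<close>
    define s where "s = 1 / (4 * (C\<^sup>2 + 1))"
    have s: "0 < s" "s \<le> 1" "2 * C\<^sup>2 * s < 1"
    proof -
      have p: "0 < C\<^sup>2 + 1" by (simp add: add_nonneg_pos)
      then show "0 < s" by (simp add: s_def)
      show "s \<le> 1" using p by (simp add: s_def field_simps)
      show "2 * C\<^sup>2 * s < 1" using p by (simp add: s_def field_simps)
    qed
    define \<zeta> where "\<zeta> = of_real (1 - s) * z"
    have n\<zeta>: "norm \<zeta> = 1 - s" using s z1 by (simp add: \<zeta>_def norm_mult del: of_real_diff)
    have ne: "\<zeta> \<noteq> z" using n\<zeta> z1 s by auto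
    have "\<zeta> - z = - of_real s * z" by (simp add: \<zeta>_def algebra_simps)
    then have d: "norm (\<zeta> - z) = s" using z1 s by (simp add: norm_mult)
    have "g \<zeta> = q \<zeta> * (\<zeta> - z)" using ne gz by (simp add: q_def)
    then have "norm (g \<zeta>) = norm (q \<zeta>) * s" using d by (simp add: norm_mult)
    also have "\<dots> \<le> C * s" using C n\<zeta> s by (intro mult_right_mono) auto
    finally have gle: "norm (g \<zeta>) \<le> C * s" .
    have n1: "norm \<zeta> < 1" using n\<zeta> s by simp
    have D: "szego_fun \<nu> \<zeta> \<noteq> 0" by (simp add: szego_fun_def)
    have "(norm (szego_fun \<nu> \<zeta>))\<^sup>2 \<le> Re (carath \<nu> \<zeta>)"
      by (rule szego_fun_sq_le_Re_carath[OF \<nu> n1])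
    also have "\<dots> \<le> 2 / s"
      using carath_bound[OF \<nu>(1) n1] complex_Re_le_cmod[of "carath \<nu> \<zeta>"] n\<zeta> by simp
    finally have le: "(norm (szego_fun \<nu> \<zeta>))\<^sup>2 \<le> 2 / s" .
    have "1 = (norm (szego_fun \<nu> \<zeta>))\<^sup>2 * (norm (g \<zeta>))\<^sup>2"
      using inv[OF n1] D by (simp add: norm_divide power_divide)
    also have "\<dots> \<le> 2 / s * (C * s)\<^sup>2"
      using le gle s by (intro mult_mono power_mono) auto
    also have "\<dots> = 2 * C\<^sup>2 * s" using s by (simp add: power2_eq_square)
    also have "\<dots> < 1" by (rule s)
    finally show False by simp
  qed
qed

lemma cball_enlarge:
  assumes "open U" "cball 0 1 \<subseteq> (U :: complex set)"
  obtains \<rho> where "\<rho> > 1" "ball 0 \<rho> \<subseteq> U"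
proof -
  obtain e where e: "e > 0" "(\<Union>x\<in>cball 0 1. ball x e) \<subseteq> U"
    using compact_subset_open_imp_ball_epsilon_subset[OF compact_cball assms] by blast
  have "ball 0 (1 + e) \<subseteq> U"
  proof
    fix z :: complex assume z: "z \<in> ball 0 (1 + e)"
    show "z \<in> U"
    proof (cases "norm z \<le> 1")
      case True
      then show ?thesis using assms(2) by auto
    next
      case False
      define y where "y = z / of_real (norm z)"
      have "norm y = 1" using False by (auto simp: y_def norm_divide)
      moreover have "y - z = (1 - of_real (norm z)) * y"
      proof -
        have "of_real (norm z) * y = z" using False by (auto simp: y_def)
        then show ?thesis by (simp add: left_diff_distrib)
      qed
      then have "norm (y - z) = norm (of_real (1 - norm z) * y)" by simp
      then have "dist y z = norm z - 1"
        using False \<open>norm y = 1\<close> by (simp add: dist_norm norm_mult del: of_real_diff)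
      ultimately have "z \<in> ball y e" "y \<in> cball 0 1" using z by auto
      then show ?thesis using e(2) by blast
    qed
  qed
  then show ?thesis using e(1) by (intro that[of "1 + e"]) auto
qed

text \<open>The branch is chosen real at 0, as \<open>schwarz_formula\<close> requires.\<close>

lemma holomorphic_log_real:
  assumes "g holomorphic_on ball 0 \<rho>" "\<rho> > 0" "\<And>z. z \<in> ball 0 \<rho> \<Longrightarrow> g z \<noteq> 0" "g 0 = of_real a" "a > 0"
  obtains L where "L holomorphic_on ball 0 \<rho>" "\<And>z. z \<in> ball 0 \<rho> \<Longrightarrow> exp (L z) = g z" "Im (L 0) = 0"
proof -
  obtain L where L: "L holomorphic_on ball 0 \<rho>" "\<And>z. z \<in> ball 0 \<rho> \<Longrightarrow> exp (L z) = g z"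
    using holomorphic_logarithm_exists[of "ball 0 \<rho>" g 0] assms by auto
  show ?thesis
  proof (rule that[of "\<lambda>z. L z - L 0 + of_real (ln a)"])
    show "(\<lambda>z. L z - L 0 + of_real (ln a)) holomorphic_on ball 0 \<rho>"
      by (intro holomorphic_intros L)
    show "exp (L z - L 0 + of_real (ln a)) = g z" if "z \<in> ball 0 \<rho>" for z
      using that L(2)[OF that] L(2)[of 0] assms by (simp add: exp_add exp_diff exp_of_real)
  qed simp
qed

lemma szego_weight_circle:
  assumes \<nu>: "circle_prob \<nu>" "absolutely_continuous arc_measure \<nu>" "szego_cond \<nu>"
    and \<rho>: "\<rho> > 1" and g: "g holomorphic_on ball 0 \<rho>" "\<And>z. z \<in> ball 0 \<rho> \<Longrightarrow> g z \<noteq> 0"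
    and inv: "\<And>z. norm z < 1 \<Longrightarrow> g z = 1 / szego_fun \<nu> z"
  shows "AE \<theta> in arc_measure. szego_weight \<nu> \<theta> = 1 / (norm (g (cis \<theta>)))\<^sup>2"
proof -
  define w where "w = szego_weight \<nu>"
  have ok: "szego_weight_ok \<nu> w" unfolding w_def by (rule szego_weight_ok_szego_weight[OF \<nu>(3)])
  have wpos: "AE \<theta> in arc_measure. w \<theta> > 0" and li: "integrable arc_measure (\<lambda>\<theta>. ln (w \<theta>))"
    using ok by (auto simp: szego_weight_ok_def ac_weight_def)
  define S where "S z = (\<integral>\<theta>. (cis \<theta> + z) / (cis \<theta> - z) * complex_of_real (ln (w \<theta>)) \<partial>arc_measure)" for z
  have S: "S holomorphic_on ball 0 1"
    unfolding S_def by (rule schwarz_holomorphic[OF integrable_of_real_arc[OF li] sets_arc_measure])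
  have D: "szego_fun \<nu> z = exp (S z / 2)" for z
    by (simp add: szego_fun_def S_def w_def)
  have S0: "S 0 = of_real (\<integral>\<theta>. ln (w \<theta>) \<partial>arc_measure)" by (simp add: S_def)
  have "g 0 = of_real (exp (- (\<integral>\<theta>. ln (w \<theta>) \<partial>arc_measure) / 2))"
    using inv[of 0] by (simp add: D S0 exp_minus field_simps flip: exp_of_real)
  then obtain L where L: "L holomorphic_on ball 0 \<rho>" "\<And>z. z \<in> ball 0 \<rho> \<Longrightarrow> exp (L z) = g z" "Im (L 0) = 0"
    using holomorphic_log_real[OF g(1) _ g(2)] \<rho> by (metis exp_gt_zero less_trans zero_less_one)
  have L1: "L holomorphic_on ball 0 1"
    by (rule holomorphic_on_subset[OF L(1)]) (use \<rho> in auto)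
  \<comment> \<open>Both S / 2 and - L are logarithms of the Szego function, so exp h = 1 and h is
    constant; being real at 0, it is 0.\<close>
  define h where "h z = S z / 2 + L z" for z
  have h: "h holomorphic_on ball 0 1" unfolding h_def by (intro holomorphic_intros S L1) auto
  have eh: "exp (h z) = 1" if "z \<in> ball 0 1" for z
    using that L(2)[of z] inv[of z] \<rho> by (simp add: h_def exp_add D)
  have "\<exists>c. \<forall>z\<in>ball 0 1. h z = c"
  proof (rule has_field_derivative_zero_constant)
    fix z :: complex assume z: "z \<in> ball 0 1"
    have d: "(h has_field_derivative deriv h z) (at z)"
      using holomorphic_derivI[OF h _ z] by simp
    then have "((\<lambda>z. exp (h z)) has_field_derivative exp (h z) * deriv h z) (at z)"
      by (auto intro!: derivative_eq_intros)
    moreover have "((\<lambda>z. exp (h z)) has_field_derivative 0) (at z)"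
      by (rule has_field_derivative_transform_within_open[of "\<lambda>_. 1" _ _ "ball 0 1"]) (use z eh in auto)
    ultimately have "exp (h z) * deriv h z = 0" by (rule DERIV_unique)
    then have "deriv h z = 0" by simp
    then show "(h has_field_derivative 0) (at z within ball 0 1)"
      using d has_field_derivative_at_within by fastforce
  qed simp
  then have hc: "h z = h 0" if "z \<in> ball 0 1" for z using that by fastforce
  have "h 0 = of_real (Re (h 0))" using S0 L(3) by (simp add: h_def complex_eq_iff)
  then have "exp (Re (h 0)) = 1" using eh[of 0] by (metis centre_in_ball exp_of_real of_real_eq_1_iff zero_less_one)
  then have "h 0 = 0" using \<open>h 0 = of_real (Re (h 0))\<close> by simp
  then have SL: "S z = - 2 * L z" if "norm z < 1" for z
    using hc[of z] that by (simp add: h_def field_simps add_eq_0_iff)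
  have Lc: "continuous_on (sphere 0 1) L"
    by (rule continuous_on_subset[OF holomorphic_on_imp_continuous_on[OF L(1)]]) (use \<rho> in auto)
  have "AE \<theta> in arc_measure. ln (w \<theta>) = Re (- 2 * L (cis \<theta>))"
  proof (rule schwarz_integral_unique[OF li])
    show "integrable arc_measure (\<lambda>\<theta>. Re (- 2 * L (cis \<theta>)))"
      by (rule integrable_circle_real[OF finite_measure_arc sets_arc_measure, of "\<lambda>z. Re (- 2 * L z)"])
         (intro continuous_intros Lc)
    fix z :: complex assume z: "norm z < 1"
    have "(\<integral>\<theta>. (cis \<theta> + z) / (cis \<theta> - z) * complex_of_real (Re (- 2 * L (cis \<theta>))) \<partial>arc_measure) = - 2 * L z"
      by (rule schwarz_formula[of "\<lambda>z. - 2 * L z", OF _ \<rho> _ z]) (use L in \<open>auto intro!: holomorphic_intros\<close>)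
    then show "(\<integral>\<theta>. (cis \<theta> + z) / (cis \<theta> - z) * complex_of_real (ln (w \<theta>)) \<partial>arc_measure)
      = (\<integral>\<theta>. (cis \<theta> + z) / (cis \<theta> - z) * complex_of_real (Re (- 2 * L (cis \<theta>))) \<partial>arc_measure)"
      using SL[OF z] by (simp add: S_def)
  qed
  with wpos show ?thesis
  proof eventually_elim
    fix \<theta> assume w: "0 < w \<theta>" and ln: "ln (w \<theta>) = Re (- 2 * L (cis \<theta>))"
    have "w \<theta> = exp (- (2 * Re (L (cis \<theta>))))" using w ln exp_ln[OF w] by simp
    also have "\<dots> = 1 / (exp (Re (L (cis \<theta>))))\<^sup>2"
      by (simp add: exp_minus inverse_eq_divide flip: exp_double)
    also have "exp (Re (L (cis \<theta>))) = norm (g (cis \<theta>))"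
      using L(2)[of "cis \<theta>"] \<rho> by (simp flip: norm_exp_eq_Re)
    finally show "szego_weight \<nu> \<theta> = 1 / (norm (g (cis \<theta>)))\<^sup>2" by (simp add: w_def)
  qed
qed

text \<open>Converse of \<open>szego_weight_circle\<close>: it certifies \<open>g\<close> as the
  inverse Szego function of a measure built from \<open>g\<close>.\<close>

lemma szego_fun_of_weight:
  assumes \<nu>: "\<nu> = density arc_measure (\<lambda>\<theta>. ennreal (1 / (norm (g (cis \<theta>)))\<^sup>2))"
    and \<rho>: "\<rho> > 1" and gh: "g holomorphic_on ball 0 \<rho>" and gnz: "\<forall>z\<in>ball 0 \<rho>. g z \<noteq> 0"
    and g0: "g 0 = of_real a" "a > 0"
  shows "absolutely_continuous arc_measure \<nu>" "szego_cond \<nu>"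
    "norm z < 1 \<Longrightarrow> szego_fun \<nu> z = 1 / g z"
proof -
  have g: "g holomorphic_on ball 0 \<rho>" "\<And>z. z \<in> ball 0 \<rho> \<Longrightarrow> g z \<noteq> 0"
    using gh gnz by auto
  define w where "w \<theta> = 1 / (norm (g (cis \<theta>)))\<^sup>2" for \<theta>
  have gc: "continuous_on (sphere 0 1) g"
    by (rule continuous_on_subset[OF holomorphic_on_imp_continuous_on[OF g(1)]]) (use \<rho> in auto)
  have g1: "g (cis \<theta>) \<noteq> 0" for \<theta> using g(2)[of "cis \<theta>"] \<rho> by simp
  have gn: "g z \<noteq> 0" if "z \<in> sphere 0 1" for z using g(2)[of z] that \<rho> by simp
  have wm [measurable]: "w \<in> borel_measurable borel"
    unfolding w_def
    by (intro borel_measurable_continuous_onI continuous_intros continuous_on_circle_comp gc) (use g1 in auto)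
  have w0: "0 < w \<theta>" for \<theta> using g1[of \<theta>] by (simp add: w_def)
  have dens: "\<nu> = density arc_measure (\<lambda>\<theta>. ennreal (w \<theta>))" using \<nu> by (simp add: w_def)
  show ac: "absolutely_continuous arc_measure \<nu>"
    unfolding dens by (rule absolutely_continuousI_density) simp
  have lni: "integrable arc_measure (\<lambda>\<theta>. ln (w \<theta>))"
    unfolding w_def
    by (rule integrable_circle_real[OF finite_measure_arc sets_arc_measure, of "\<lambda>z. ln (1 / (norm (g z))\<^sup>2)"])
       (use gn in \<open>auto intro!: continuous_intros gc\<close>)
  have ok: "szego_weight_ok \<nu> w"
    unfolding szego_weight_ok_def ac_weight_def
    using wm w0 lni by (auto simp: less_imp_le dens emeasure_density intro!: bexI[of _ "{}"])
  then show sz: "szego_cond \<nu>" unfolding szego_cond_def by blast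
  have ok': "szego_weight_ok \<nu> (szego_weight \<nu>)" by (rule szego_weight_ok_szego_weight[OF sz])
  have sm: "szego_weight \<nu> \<in> borel_measurable borel" and s0: "\<And>\<theta>. 0 \<le> szego_weight \<nu> \<theta>"
    using ok' by (auto simp: szego_weight_ok_def ac_weight_def)
  \<comment> \<open>\<open>szego_weight\<close> is an unspecified choice, but as a density of the
    same measure it agrees with w almost everywhere, which suffices inside the integral.\<close>
  have "\<nu> = density arc_measure (\<lambda>\<theta>. ennreal (szego_weight \<nu> \<theta>))"
    by (rule szego_weight_density[OF _ ac ok']) (simp add: dens)
  then have deq: "density arc_measure (\<lambda>\<theta>. ennreal (szego_weight \<nu> \<theta>)) = density arc_measure (\<lambda>\<theta>. ennreal (w \<theta>))"
    using dens by metis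
  interpret finite_measure arc_measure by (rule finite_measure_arc)
  have "AE \<theta> in arc_measure. ennreal (szego_weight \<nu> \<theta>) = ennreal (w \<theta>)"
    using deq sm by (subst (asm) density_unique_iff) auto
  then have AE: "AE \<theta> in arc_measure. szego_weight \<nu> \<theta> = w \<theta>"
    by eventually_elim (use s0 w0 in \<open>auto simp: less_imp_le\<close>)
  obtain L where L: "L holomorphic_on ball 0 \<rho>" "\<And>z. z \<in> ball 0 \<rho> \<Longrightarrow> exp (L z) = g z" "Im (L 0) = 0"
    using holomorphic_log_real[OF g(1) _ g(2) g0] \<rho> by (metis less_trans zero_less_one)
  have lnw: "ln (w \<theta>) = Re (- 2 * L (cis \<theta>))" for \<theta>
  proof -
    have "w \<theta> = exp (- (2 * Re (L (cis \<theta>))))"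
      using L(2)[of "cis \<theta>"] \<rho> by (simp add: w_def exp_minus inverse_eq_divide exp_double flip: norm_exp_eq_Re)
    then show ?thesis by simp
  qed
  show "szego_fun \<nu> z = 1 / g z" if z: "norm z < 1"
  proof -
    have "(\<integral>\<theta>. (cis \<theta> + z) / (cis \<theta> - z) * complex_of_real (ln (szego_weight \<nu> \<theta>)) \<partial>arc_measure)
        = (\<integral>\<theta>. (cis \<theta> + z) / (cis \<theta> - z) * complex_of_real (Re (- 2 * L (cis \<theta>))) \<partial>arc_measure)"
    proof (rule integral_cong_AE)
      show "AE \<theta> in arc_measure. (cis \<theta> + z) / (cis \<theta> - z) * complex_of_real (ln (szego_weight \<nu> \<theta>))
         = (cis \<theta> + z) / (cis \<theta> - z) * complex_of_real (Re (- 2 * L (cis \<theta>)))"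
        using AE by eventually_elim (simp only: lnw)
      show "(\<lambda>\<theta>. (cis \<theta> + z) / (cis \<theta> - z) * complex_of_real (ln (szego_weight \<nu> \<theta>))) \<in> borel_measurable arc_measure"
        using sm by measurable
      show "(\<lambda>\<theta>. (cis \<theta> + z) / (cis \<theta> - z) * complex_of_real (Re (- 2 * L (cis \<theta>)))) \<in> borel_measurable arc_measure"
        using wm by (simp only: lnw[symmetric]) measurable
    qed
    also have "\<dots> = - 2 * L z"
      by (rule schwarz_formula[of "\<lambda>z. - 2 * L z", OF _ \<rho> _ z]) (use L in \<open>auto intro!: holomorphic_intros\<close>)
    finally have "szego_fun \<nu> z = exp (- L z)" by (simp add: szego_fun_def)
    also have "\<dots> = 1 / g z"
      using L(2)[of z] z \<rho> by (simp add: exp_minus inverse_eq_divide)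
    finally show ?thesis .
  qed
qed

section \<open>The Schur step\<close>

text \<open>Put f = b / a, z f1 = (f - alpha) / (1 - cnj alpha f) and F1 = (1 + z f1) / (1 - z f1);
  clearing denominators gives this quotient. Later a = F + 1 and b = (F - 1) / z. The denominator is
  nonzero because 1 + alpha and 1 + cnj alpha have equal modulus.\<close>

lemma schur_step_Re:
  fixes a b \<alpha> :: complex
  assumes "norm b < norm a" "norm \<alpha> < 1"
  shows "(1 + \<alpha>) * a - (1 + cnj \<alpha>) * b \<noteq> 0"
    and "Re (((1 - \<alpha>) * a + (1 - cnj \<alpha>) * b) / ((1 + \<alpha>) * a - (1 + cnj \<alpha>) * b))
      = (1 - (norm \<alpha>)\<^sup>2) * ((norm a)\<^sup>2 - (norm b)\<^sup>2) / (norm ((1 + \<alpha>) * a - (1 + cnj \<alpha>) * b))\<^sup>2"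
proof -
  have n: "norm (1 + cnj \<alpha>) = norm (1 + \<alpha>)"
    by (metis complex_cnj_add complex_cnj_one complex_mod_cnj)
  have "1 + \<alpha> \<noteq> 0" using assms(2) by (metis add_eq_0_iff less_irrefl norm_minus_cancel norm_one)
  then have "norm ((1 + cnj \<alpha>) * b) < norm ((1 + \<alpha>) * a)"
    using assms(1) by (simp add: norm_mult n)
  then show "(1 + \<alpha>) * a - (1 + cnj \<alpha>) * b \<noteq> 0" by auto
  have e1: "Re (x / y) = Re (x * cnj y) / (norm y)\<^sup>2" for x y :: complex
    by (subst complex_div_cnj) (simp only: Re_divide_of_real of_real_power[symmetric])
  have e2: "Re (((1 - \<alpha>) * a + (1 - cnj \<alpha>) * b) * cnj ((1 + \<alpha>) * a - (1 + cnj \<alpha>) * b))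
      = (1 - (norm \<alpha>)\<^sup>2) * ((norm a)\<^sup>2 - (norm b)\<^sup>2)"
    unfolding cmod_power2 by (simp add: power2_eq_square algebra_simps)
  show "Re (((1 - \<alpha>) * a + (1 - cnj \<alpha>) * b) / ((1 + \<alpha>) * a - (1 + cnj \<alpha>) * b))
      = (1 - (norm \<alpha>)\<^sup>2) * ((norm a)\<^sup>2 - (norm b)\<^sup>2) / (norm ((1 + \<alpha>) * a - (1 + cnj \<alpha>) * b))\<^sup>2"
    unfolding e1 e2 ..
qed

lemma norm_diff_1_less:
  assumes "Re z > 0" shows "norm (z - 1) < norm (z + 1)"
proof -
  have "(norm (z - 1))\<^sup>2 < (norm (z + 1))\<^sup>2"
    using assms unfolding cmod_power2 by (simp add: power2_eq_square algebra_simps)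
  then show ?thesis by (rule power2_less_imp_less) simp
qed

text \<open>On the circle |q| = |F - 1| < |F + 1| because Re F > 0, and the maximum principle for q
  / (F + 1) carries this inside, including the point 0.\<close>

lemma schur_bound:
  assumes F: "F holomorphic_on ball 0 \<rho>" and \<rho>: "\<rho> > 1" and F0: "F 0 = 1"
    and pos: "\<And>z. norm z \<le> 1 \<Longrightarrow> Re (F z) > 0" and z: "norm z \<le> 1"
  defines "q \<equiv> \<lambda>z. if z = 0 then deriv F 0 else (F z - 1) / z"
  shows "q holomorphic_on ball 0 \<rho>" "norm (q z) < norm (F z + 1)"
proof -
  show q: "q holomorphic_on ball 0 \<rho>"
    using pole_lemma_open[OF F, of 0] unfolding q_def F0 diff_0_right by simp
  have ne: "F z + 1 \<noteq> 0" if "norm z \<le> 1" for z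
    using pos[OF that] by (metis add_eq_0_iff less_asym neg_0_less_iff_less one_complex.simps(1) uminus_complex.simps(1) zero_less_one)
  define f where "f z = q z / (F z + 1)" for z
  have qc: "continuous_on (cball 0 1) q" and Fc: "continuous_on (cball 0 1) F"
    by (rule continuous_on_subset[OF holomorphic_on_imp_continuous_on], rule q F, use \<rho> in auto)+
  have fc: "continuous_on (cball 0 1) f"
    unfolding f_def using ne by (auto intro!: continuous_intros qc Fc)
  have fh: "f holomorphic_on ball 0 1"
    unfolding f_def using ne
    by (auto intro!: holomorphic_intros holomorphic_on_subset[OF q] holomorphic_on_subset[OF F]) (use \<rho> in auto)
  have sphere: "norm (f z) < 1" if "norm z = 1" for z
  proof -
    have "norm (q z) = norm (F z - 1)" using that by (auto simp: q_def norm_divide)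
    also have "\<dots> < norm (F z + 1)" using that by (intro norm_diff_1_less pos) simp
    finally show ?thesis using ne[of z] that by (simp add: f_def norm_divide)
  qed
  have "sphere (0::complex) 1 \<noteq> {}" by simp
  \<comment> \<open>The supremum over the circle is attained, so the bound that the maximum
    principle transports is strictly less than 1.\<close>
  then obtain x where x: "norm x = 1" "\<And>y. norm y = 1 \<Longrightarrow> norm (f y) \<le> norm (f x)"
    using continuous_attains_sup[of "sphere 0 1" "\<lambda>z. norm (f z)"] continuous_on_subset[OF fc, of "sphere 0 1"]
    by (force intro!: continuous_intros)
  have "norm (f z) \<le> norm (f x)"
    by (rule maximum_modulus_frontier[of f "cball 0 1"]) (use x fc fh z in auto)
  also have "\<dots> < 1" by (rule sphere[OF x(1)])
  finally show "norm (q z) < norm (F z + 1)"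
    using ne[OF z] by (simp add: f_def norm_divide)
qed

lemma circle_measure_ac:
  assumes "circle_prob \<nu>" "absolutely_continuous arc_measure \<nu>"
  shows "circle_measure \<nu>"
proof
  show "nontrivial_circle \<nu>"
    unfolding nontrivial_circle_def
  proof (intro allI impI)
    fix S :: "real set" assume S: "finite S"
    then have "S \<in> null_sets arc_measure"
      using finite_null_arc[OF S] by (auto simp: finite_imp_closed)
    then have "S \<in> null_sets \<nu>" using assms(2) by (auto simp: absolutely_continuous_def)
    then have "emeasure \<nu> (UNIV - S) = emeasure \<nu> UNIV"
      using emeasure_Diff_null_set[of S \<nu> UNIV] assms(1) by (simp add: circle_prob_def)
    then show "0 < emeasure \<nu> (- S)"
      using assms(1) by (simp add: circle_prob_def Compl_eq_Diff_UNIV)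
  qed
qed (fact assms(1))

lemma carath_0: "circle_prob \<nu> \<Longrightarrow> carath \<nu> 0 = 1"
  using has_fps_expansion_imp_0_eq_fps_nth_0[OF carath_has_fps_expansion[of \<nu>]]
  by (simp add: moment_fps_def)

text \<open>This is f(0) = alpha_0 in terms of F.\<close>

lemma deriv_carath_0:
  assumes "circle_measure \<nu>"
  shows "deriv (carath \<nu>) 0 = 2 * verblunsky \<nu> 0"
proof -
  interpret circle_measure \<nu> by fact
  show ?thesis
    using has_fps_expansion_imp_0_eq_fps_nth_0[OF has_fps_expansion_deriv[OF carath_has_fps_expansion[OF prob]]]
    by (simp add: moment_fps_def verblunsky_0)
qed

text \<open>Exhibiting one measure with the shifted coefficients is enough, by
  \<open>verblunsky_determines_measure\<close>.\<close>

lemma shifted_eqI: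
  assumes "circle_measure \<nu>" "\<And>k. verblunsky \<nu> k = verblunsky \<mu> (n + k)"
  shows "shifted \<mu> n = \<nu>"
  unfolding shifted_def
proof (rule the_equality)
  show "circle_prob \<nu> \<and> nontrivial_circle \<nu> \<and> (\<forall>k. verblunsky \<nu> k = verblunsky \<mu> (n + k))"
    using assms by (auto simp: circle_measure_def)
  show "\<nu>' = \<nu>" if "circle_prob \<nu>' \<and> nontrivial_circle \<nu>' \<and> (\<forall>k. verblunsky \<nu>' k = verblunsky \<mu> (n + k))" for \<nu>'
    using that assms by (intro verblunsky_determines_measure) (auto simp: circle_measure_def)
qed

text \<open>\<open>q = (F - 1) / z\<close> and \<open>\<Delta> = (1 + a) (F + 1) - (1 + cnj a) q\<close>, so that the relative Szego function
  is \<open>\<Delta> / (2 \<rho>\<^sub>0)\<close>; this form makes sense also where \<open>f\<close> has a pole.\<close>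

lemma shifted_measure:
  fixes \<mu> :: "real measure" and F g :: "complex \<Rightarrow> complex"
  assumes \<mu>: "circle_prob \<mu>" "absolutely_continuous arc_measure \<mu>"
    and \<rho>: "\<rho> > 1" and Fh: "F holomorphic_on ball 0 \<rho>"
    and F_carath: "\<forall>z\<in>ball 0 1. F z = carath \<mu> z" and F_pos: "\<forall>z\<in>cball 0 1. Re (F z) > 0"
    and gh: "g holomorphic_on ball 0 \<rho>" and g_nz: "\<forall>z\<in>ball 0 \<rho>. g z \<noteq> 0" and g0: "g 0 = of_real a" "a > 0"
    and F_circ: "\<forall>z\<in>sphere 0 1. Re (F z) = 1 / (norm (g z))\<^sup>2"
  defines "\<alpha> \<equiv> verblunsky \<mu> 0"
  defines "q \<equiv> \<lambda>z. if z = 0 then deriv F 0 else (F z - 1) / z"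
  defines "\<Delta> \<equiv> \<lambda>z. (1 + \<alpha>) * (F z + 1) - (1 + cnj \<alpha>) * q z"
  defines "s \<equiv> sqrt (1 - (norm \<alpha>)\<^sup>2)"
  shows "norm \<alpha> < 1" "\<Delta> holomorphic_on ball 0 \<rho>"
    "circle_prob (shifted \<mu> 1)" "absolutely_continuous arc_measure (shifted \<mu> 1)" "szego_cond (shifted \<mu> 1)"
    "\<And>k. verblunsky (shifted \<mu> 1) k = verblunsky \<mu> (Suc k)"
    "\<And>z. norm z < 1 \<Longrightarrow> szego_fun (shifted \<mu> 1) z = 1 / (g z * \<Delta> z / (2 * of_real s))"
    "\<And>z. norm z < 1 \<Longrightarrow> rel_szego \<mu> z = \<Delta> z / (2 * of_real s)"
proof -
  have F: "F holomorphic_on ball 0 \<rho>" "\<And>z. norm z < 1 \<Longrightarrow> F z = carath \<mu> z"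
      "\<And>z. norm z \<le> 1 \<Longrightarrow> Re (F z) > 0"
    and g: "g holomorphic_on ball 0 \<rho>" "\<And>z. z \<in> ball 0 \<rho> \<Longrightarrow> g z \<noteq> 0" "g 0 = of_real a" "a > 0"
    and circ: "\<And>z. norm z = 1 \<Longrightarrow> Re (F z) = 1 / (norm (g z))\<^sup>2"
    using Fh F_carath F_pos gh g_nz g0 F_circ by auto
  interpret \<mu>: circle_measure \<mu> by (rule circle_measure_ac[OF \<mu>])
  have F0: "F 0 = 1" using F(2)[of 0] carath_0[OF \<mu>(1)] by simp
  have cF: "carath \<mu> holomorphic_on ball 0 1"
    by (rule holomorphic_transform[of F]) (use F \<rho> in \<open>auto intro: holomorphic_on_subset\<close>)
  have "deriv F 0 = deriv (carath \<mu>) 0"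
    by (rule complex_derivative_transform_within_open[of _ "ball 0 1"])
       (use F cF \<rho> in \<open>auto intro: holomorphic_on_subset\<close>)
  then have q0: "q 0 = 2 * \<alpha>"
    using deriv_carath_0[OF \<mu>.circle_measure_axioms] by (simp add: q_def \<alpha>_def)
  have qh: "q holomorphic_on ball 0 \<rho>"
    unfolding q_def by (rule schur_bound(1)[OF F(1) \<rho> F0 F(3), of 0]) simp_all
  have qb: "norm (q z) < norm (F z + 1)" if "norm z \<le> 1" for z
    unfolding q_def by (rule schur_bound(2)[OF F(1) \<rho> F0 F(3) that])
  have Fq: "F z - 1 = z * q z" for z by (simp add: q_def F0)
  show \<alpha>1: "norm \<alpha> < 1" using qb[of 0] q0 F0 by (simp add: norm_mult)
  have sq: "s\<^sup>2 = 1 - (norm \<alpha>)\<^sup>2" and s0: "s > 0"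
    using \<alpha>1 by (simp_all add: s_def power_le_one power_less_one_iff abs_square_less_1)
  \<comment> \<open>Numerator of the Schur step in \<open>schur_step_Re\<close>, with
    \<open>\<Delta>\<close> as its denominator.\<close>
  define N where "N z = (1 - \<alpha>) * (F z + 1) + (1 - cnj \<alpha>) * q z" for z
  show \<Delta>h: "\<Delta> holomorphic_on ball 0 \<rho>" unfolding \<Delta>_def by (intro holomorphic_intros F qh)
  have Nh: "N holomorphic_on ball 0 \<rho>" unfolding N_def by (intro holomorphic_intros F qh)
  have \<Delta>n: "\<Delta> z \<noteq> 0" if "norm z \<le> 1" for z
    unfolding \<Delta>_def by (rule schur_step_Re[OF qb[OF that] \<alpha>1])
  have "open {z \<in> ball 0 \<rho>. \<Delta> z \<noteq> 0}"
    using continuous_open_preimage[OF holomorphic_on_imp_continuous_on[OF \<Delta>h] open_ball, of "- {0}"]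
    by (simp add: vimage_def Int_def open_Compl)
  \<comment> \<open>\<open>\<Delta>\<close> has no zero in the closed unit disc but may vanish
    farther out, so the new objects are built on a smaller disc.\<close>
  then obtain \<rho>' where \<rho>': "\<rho>' > 1" "ball 0 \<rho>' \<subseteq> {z \<in> ball 0 \<rho>. \<Delta> z \<noteq> 0}"
    using \<Delta>n \<rho> by (elim cball_enlarge) auto
  define F1 where "F1 z = N z / \<Delta> z" for z
  have F1h: "F1 holomorphic_on ball 0 \<rho>'"
    unfolding F1_def using \<rho>'
    by (intro holomorphic_intros holomorphic_on_subset[OF Nh] holomorphic_on_subset[OF \<Delta>h]) auto
  have aa: "\<alpha> * cnj \<alpha> = of_real ((norm \<alpha>)\<^sup>2)" by (rule complex_norm_square[symmetric])
  have \<Delta>0: "\<Delta> 0 = 2 * of_real (s\<^sup>2)"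
    using aa by (simp add: \<Delta>_def q0 F0 sq algebra_simps)
  have "N 0 = 2 * of_real (s\<^sup>2)"
    using aa by (simp add: N_def q0 F0 sq algebra_simps)
  then have F10: "F1 0 = 1" using \<Delta>0 s0 by (simp add: F1_def)
  have ReF1: "Re (F1 z) = s\<^sup>2 * ((norm (F z + 1))\<^sup>2 - (norm (q z))\<^sup>2) / (norm (\<Delta> z))\<^sup>2" if "norm z \<le> 1" for z
    unfolding F1_def N_def \<Delta>_def sq by (rule schur_step_Re[OF qb[OF that] \<alpha>1])
  have F1pos: "Re (F1 z) > 0" if "norm z \<le> 1" for z
    using ReF1[OF that] qb[OF that] \<Delta>n[OF that] s0 by (simp add: power_strict_mono)
  \<comment> \<open>The constant is forced: on the circle Re F1 = 4 s^2 Re F /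
    |\<open>\<Delta>\<close>|^2 with Re F = |g|^(-2), which is |g1|^(-2).\<close>
  define g1 where "g1 z = g z * \<Delta> z / (2 * of_real s)" for z
  have g1h: "g1 holomorphic_on ball 0 \<rho>'"
    unfolding g1_def using \<rho>' s0
    by (intro holomorphic_intros holomorphic_on_subset[OF g(1)] holomorphic_on_subset[OF \<Delta>h]) auto
  have g1n: "\<forall>z\<in>ball 0 \<rho>'. g1 z \<noteq> 0"
    using \<rho>'(2) g(2) s0 by (auto simp: g1_def)
  have g10: "g1 0 = of_real (a * s)"
    using s0 by (simp add: g1_def g \<Delta>0 power2_eq_square)
  have w1: "Re (F1 (cis \<theta>)) = 1 / (norm (g1 (cis \<theta>)))\<^sup>2" for \<theta>
  proof -
    have e: "(norm (F (cis \<theta>) + 1))\<^sup>2 - (norm (q (cis \<theta>)))\<^sup>2 = 4 * Re (F (cis \<theta>))"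
    proof -
      have n: "norm (q (cis \<theta>)) = norm (F (cis \<theta>) - 1)" by (simp add: q_def norm_divide)
      show ?thesis unfolding n cmod_power2 by (simp add: power2_eq_square algebra_simps)
    qed
    show ?thesis
      unfolding ReF1[of "cis \<theta>", simplified] e circ[of "cis \<theta>", simplified]
      by (simp add: g1_def norm_divide norm_mult power_divide power_mult_distrib)
  qed
  define \<nu> where "\<nu> = density arc_measure (\<lambda>\<theta>. ennreal (1 / (norm (g1 (cis \<theta>)))\<^sup>2))"
  have a1: "a * s > 0" using g s0 by simp
  note szf = szego_fun_of_weight[OF \<nu>_def \<rho>'(1) g1h g1n g10 a1]
  have F1c: "continuous_on (sphere 0 1) F1"
    by (rule continuous_on_subset[OF holomorphic_on_imp_continuous_on[OF F1h]]) (use \<rho>' in auto)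
  have wm: "(\<lambda>\<theta>. 1 / (norm (g1 (cis \<theta>)))\<^sup>2) \<in> borel_measurable borel"
    unfolding w1[symmetric]
    by (intro borel_measurable_continuous_onI continuous_intros continuous_on_circle_comp F1c)
  have w0: "0 \<le> 1 / (norm (g1 (cis \<theta>)))\<^sup>2" for \<theta> by simp
  have c1: "carath \<nu> z = F1 z" if z: "norm z < 1" for z
  proof -
    have "carath \<nu> z = (\<integral>\<theta>. (cis \<theta> + z) / (cis \<theta> - z) * of_real (Re (F1 (cis \<theta>))) \<partial>arc_measure)"
      unfolding \<nu>_def carath_density[OF wm w0] w1 ..
    also have "\<dots> = F1 z" by (rule schwarz_formula[OF F1h \<rho>'(1) _ z]) (simp add: F10)
    finally show ?thesis .
  qed
  have prob: "circle_prob \<nu>"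
  proof -
    have i: "integrable arc_measure (\<lambda>\<theta>. 1 / (norm (g1 (cis \<theta>)))\<^sup>2)"
      unfolding w1[symmetric]
      by (rule integrable_circle_real[OF finite_measure_arc sets_arc_measure, of "\<lambda>z. Re (F1 z)"])
         (intro continuous_intros F1c)
    \<comment> \<open>The total mass is the real part of a circle mean, hence the value of F1 at
      0.\<close>
    have "(\<integral>\<theta>. F1 (cis \<theta>) \<partial>arc_measure) = 1"
      using circle_mean_value[OF F1h \<rho>'(1)] F10 by simp
    moreover have "integrable arc_measure (\<lambda>\<theta>. F1 (cis \<theta>))"
      by (rule integrable_circle[OF finite_measure_arc sets_arc_measure F1c])
    ultimately have "(\<integral>\<theta>. Re (F1 (cis \<theta>)) \<partial>arc_measure) = 1" by simp
    then have "(\<integral>\<^sup>+\<theta>. ennreal (1 / (norm (g1 (cis \<theta>)))\<^sup>2) \<partial>arc_measure) = 1"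
      unfolding w1 using nn_integral_eq_integral[OF i] by simp
    then have total: "emeasure \<nu> UNIV = 1"
      unfolding \<nu>_def using wm by (simp add: emeasure_density)
    have "emeasure arc_measure (- {0..<2*pi}) = 0" by (simp add: emeasure_arc_measure)
    then have "- {0..<2*pi} \<in> null_sets arc_measure" by auto
    then have "- {0..<2*pi} \<in> null_sets \<nu>" using szf(1) by (auto simp: absolutely_continuous_def)
    then have "emeasure \<nu> (UNIV - (- {0..<2*pi})) = 1"
      using emeasure_Diff_null_set[of "- {0..<2*pi}" \<nu> UNIV] total by (simp add: \<nu>_def)
    then show ?thesis using total by (simp add: circle_prob_def \<nu>_def Diff_eq)
  qed
  have cm: "circle_measure \<nu>" by (rule circle_measure_ac[OF prob szf(1)])
  have ver: "verblunsky \<nu> k = verblunsky \<mu> (Suc k)" for k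
  proof (rule verblunsky_shift[OF \<mu>.circle_measure_axioms cm])
    let ?A = "moment_fps \<mu>" and ?B = "moment_fps \<nu>"
    note ex = carath_has_fps_expansion[OF \<mu>(1)] carath_has_fps_expansion[OF prob]
    have l: "(\<lambda>z. (carath \<nu> z + 1) * ((carath \<mu> z - 1) - \<alpha> * z * (carath \<mu> z + 1))) has_fps_expansion
       (?B + 1) * ((?A - 1) - fps_const \<alpha> * fps_X * (?A + 1))"
      by (intro fps_expansion_intros ex)
    have r: "(\<lambda>z. (carath \<nu> z - 1) * (z * (carath \<mu> z + 1) - cnj \<alpha> * (carath \<mu> z - 1))) has_fps_expansion
       (?B - 1) * (fps_X * (?A + 1) - fps_const (cnj \<alpha>) * (?A - 1))"
      by (intro fps_expansion_intros ex)
    \<comment> \<open>The Schur step holds by construction of F1 on the unit disc; uniqueness of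
      expansions turns it into the power series identity that \<open>verblunsky_shift\<close> asks
      for.\<close>
    have eq: "(carath \<nu> z + 1) * ((carath \<mu> z - 1) - \<alpha> * z * (carath \<mu> z + 1))
      = (carath \<nu> z - 1) * (z * (carath \<mu> z + 1) - cnj \<alpha> * (carath \<mu> z - 1))" if "z \<in> ball 0 1" for z
    proof -
      have z: "norm z < 1" using that by simp
      have p: "F1 z + 1 = 2 * ((F z + 1) - cnj \<alpha> * q z) / \<Delta> z"
        using \<Delta>n[of z] z by (simp add: F1_def N_def field_simps) (simp add: \<Delta>_def algebra_simps)
      have m: "F1 z - 1 = 2 * (q z - \<alpha> * (F z + 1)) / \<Delta> z"
        using \<Delta>n[of z] z by (simp add: F1_def N_def field_simps) (simp add: \<Delta>_def algebra_simps)
      show ?thesis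
        unfolding c1[OF z] F(2)[OF z, symmetric] p m Fq
        by (simp add: algebra_simps)
    qed
    have "(\<lambda>z. (carath \<nu> z + 1) * ((carath \<mu> z - 1) - \<alpha> * z * (carath \<mu> z + 1))) has_fps_expansion
       (?B - 1) * (fps_X * (?A + 1) - fps_const (cnj \<alpha>) * (?A - 1))"
    proof (subst has_fps_expansion_cong[OF _ refl])
      show "\<forall>\<^sub>F z in nhds 0. (carath \<nu> z + 1) * ((carath \<mu> z - 1) - \<alpha> * z * (carath \<mu> z + 1))
         = (carath \<nu> z - 1) * (z * (carath \<mu> z + 1) - cnj \<alpha> * (carath \<mu> z - 1))"
        by (rule eventually_mono[OF eventually_nhds_in_open[of "ball 0 1"]]) (use eq in auto)
    qed (rule r)
    then show "(?B + 1) * ((?A - 1) - fps_const (verblunsky \<mu> 0) * fps_X * (?A + 1))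
      = (?B - 1) * (fps_X * (?A + 1) - fps_const (cnj (verblunsky \<mu> 0)) * (?A - 1))"
      using fps_expansion_unique_complex[OF l] by (simp add: \<alpha>_def)
  qed
  have sh: "shifted \<mu> 1 = \<nu>"
    by (rule shifted_eqI[OF cm]) (simp add: ver)
  show "circle_prob (shifted \<mu> 1)" "absolutely_continuous arc_measure (shifted \<mu> 1)" "szego_cond (shifted \<mu> 1)"
    unfolding sh using prob szf by auto
  show "verblunsky (shifted \<mu> 1) k = verblunsky \<mu> (Suc k)" for k unfolding sh by (rule ver)
  show "szego_fun (shifted \<mu> 1) z = 1 / (g z * \<Delta> z / (2 * of_real s))" if "norm z < 1" for z
    unfolding sh using szf(3)[OF that] by (simp add: g1_def)
  show "rel_szego \<mu> z = \<Delta> z / (2 * of_real s)" if z: "norm z < 1" for z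
  \<comment> \<open>At 0 the Schur function is given by a derivative, so this value is computed
    separately from f(0) = alpha.\<close>
  proof (cases "z = 0")
    case True
    have "schur \<mu> 0 = \<alpha>"
      using deriv_carath_0[OF \<mu>.circle_measure_axioms] by (simp add: schur_def \<alpha>_def)
    moreover have "rel_szego \<mu> 0 = (1 - cnj \<alpha> * schur \<mu> 0) / of_real s"
      by (simp add: rel_szego_def s_def \<alpha>_def)
    moreover have "1 - cnj \<alpha> * \<alpha> = of_real (s\<^sup>2)"
      using aa by (simp add: sq mult.commute)
    ultimately have "rel_szego \<mu> 0 = of_real (s\<^sup>2) / of_real s" by simp
    then show ?thesis using True \<Delta>0 s0 by simp
  next
    case False
    have Fp: "F z + 1 \<noteq> 0" using qb[of z] z by auto
    have F1p: "F1 z + 1 \<noteq> 0"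
      using F1pos[of z] z by (metis add_eq_0_iff less_asym less_imp_le neg_0_less_iff_less one_complex.simps(1) uminus_complex.simps(1) zero_less_one)
    have f: "schur \<mu> z = q z / (F z + 1)"
      using False F(2)[OF z] by (simp add: schur_def q_def)
    have f1: "z * schur \<nu> z = (F1 z - 1) / (F1 z + 1)"
      using False c1[OF z] F1p by (simp add: schur_def)
    have p: "F1 z + 1 = 2 * ((F z + 1) - cnj \<alpha> * q z) / \<Delta> z"
      using \<Delta>n[of z] z by (simp add: F1_def N_def field_simps) (simp add: \<Delta>_def algebra_simps)
    have e: "(F z + 1) - cnj \<alpha> * q z \<noteq> 0"
    proof
      assume "(F z + 1) - cnj \<alpha> * q z = 0"
      then have "F1 z + 1 = 0" using p by (simp only: mult_zero_right div_0)
      then show False using F1p by simp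
    qed
    have "1 - z * schur \<mu> z = 2 / (F z + 1)"
      unfolding f using Fp Fq[of z] by (simp add: field_simps)
    moreover have "1 - z * schur \<nu> z = \<Delta> z / ((F z + 1) - cnj \<alpha> * q z)"
    proof -
      have "1 - z * schur \<nu> z = 2 / (F1 z + 1)" unfolding f1 using F1p by (simp add: field_simps)
      moreover have "2 / (2 * x / y) = y / x" for x y :: complex by simp
      ultimately show ?thesis unfolding p by (simp only:)
    qed
    moreover have "1 - cnj \<alpha> * schur \<mu> z = ((F z + 1) - cnj \<alpha> * q z) / (F z + 1)"
      unfolding f using Fp by (simp add: field_simps)
    ultimately have "rel_szego \<mu> z = ((F z + 1) - cnj \<alpha> * q z) / (F z + 1) / of_real s *
        ((\<Delta> z / ((F z + 1) - cnj \<alpha> * q z)) / (2 / (F z + 1)))"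
      by (simp only: rel_szego_def sh s_def \<alpha>_def[symmetric])
    also have "\<dots> = \<Delta> z / (2 * of_real s)"
    proof -
      have "x / y / of_real s * ((d / x) / (2 / y)) = d / (2 * of_real s)"
        if "x \<noteq> 0" "y \<noteq> 0" for x y d :: complex
        using that by (simp add: field_simps)
      then show ?thesis using e Fp by blast
    qed
    finally show ?thesis .
  qed
qed

section \<open>Continuation to the large disc\<close>

text \<open>Applied twice with the common denominator \<open>g\<close>. The condition at 0 excludes
  B = 0 identically, so zeros of B are isolated; a nonvanishing numerator then leaves the pole order
  uncancelled.\<close>

lemma quotient_pole:
  assumes A: "A holomorphic_on ball 0 R" and B: "B holomorphic_on ball 0 R" "B 0 \<noteq> 0"
    and z: "z \<in> ball 0 R"
  shows "(\<lambda>z. A z / B z) meromorphic_on ball 0 R"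
    and "B z = 0 \<Longrightarrow> A z \<noteq> 0 \<Longrightarrow> is_pole (\<lambda>z. A z / B z) z"
    and "B z = 0 \<Longrightarrow> A z \<noteq> 0 \<Longrightarrow> zorder (\<lambda>z. A z / B z) z = - zorder B z"
    and "B z \<noteq> 0 \<Longrightarrow> \<not> is_pole (\<lambda>z. A z / B z) z"
proof -
  have an: "A analytic_on ball 0 R" "B analytic_on ball 0 R"
    using A B by (auto simp: analytic_on_open)
  show "(\<lambda>z. A z / B z) meromorphic_on ball 0 R"
    by (intro meromorphic_on_divide analytic_on_imp_meromorphic_on an)
  have "0 < R" using z by (auto intro: le_less_trans[OF norm_ge_zero])
  then have ev: "\<forall>\<^sub>F w in at z. B w \<noteq> 0"
    using non_zero_neighbour_alt[OF B(1) open_ball connected_ball z, of 0] B(2)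
    by (auto elim: eventually_mono)
  have ac: "isCont A z" "isCont B z"
    using A B z holomorphic_on_imp_continuous_on continuous_on_eq_continuous_at open_ball by blast+
  show "is_pole (\<lambda>z. A z / B z) z" if "B z = 0" "A z \<noteq> 0"
  proof (rule is_pole_divide)
    show "filterlim B (at 0) (at z)"
      using ev ac(2) that(1) by (auto simp: filterlim_at isCont_def)
  qed (use ac that in auto)
  show "zorder (\<lambda>z. A z / B z) z = - zorder B z" if "B z = 0" "A z \<noteq> 0"
  proof -
    have az: "A analytic_on {z}" "B analytic_on {z}" using an z by (auto intro: analytic_on_subset)
    have "\<forall>\<^sub>F w in at z. A w \<noteq> 0"
      using ac(1) that(2) tendsto_imp_eventually_ne by (auto simp: isCont_def)
    then have fr: "\<exists>\<^sub>F w in at z. A w \<noteq> 0" "\<exists>\<^sub>F w in at z. B w \<noteq> 0"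
      using ev by (auto intro: eventually_frequently)
    have "zorder (\<lambda>z. A z / B z) z = zorder A z - zorder B z"
      by (rule zorder_divide) (use az fr in \<open>auto intro: analytic_on_imp_meromorphic_on\<close>)
    moreover have "zorder A z = 0" by (rule zorder_eq_0I[OF az(1) that(2)])
    ultimately show ?thesis by simp
  qed
  show "\<not> is_pole (\<lambda>z. A z / B z) z" if "B z \<noteq> 0"
  proof
    assume "is_pole (\<lambda>z. A z / B z) z"
    moreover have "((\<lambda>z. A z / B z) \<longlongrightarrow> A z / B z) (at z)"
      using ac that by (auto simp: isCont_def intro!: tendsto_intros)
    ultimately show False
      using not_tendsto_and_filterlim_at_infinity[of "at z"] by (auto simp: is_pole_def)
  qed
qed

text \<open>The stage free of poles: since \<open>g\<close> has no zeros up to radius rho, 1 / (g(z)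
  cnj (g(1 / cnj z))) is holomorphic on an annulus symmetric under reflection, as
  \<open>carath_continuation\<close> demands.\<close>

lemma carath_near_disc:
  assumes \<mu>: "circle_prob \<mu>" "absolutely_continuous arc_measure \<mu>" "szego_cond \<mu>"
    and R: "R > 1" and g: "g holomorphic_on ball 0 R"
    and inv: "\<And>z. norm z < 1 \<Longrightarrow> g z = 1 / szego_fun \<mu> z"
  obtains \<rho> F where "1 < \<rho>" "\<rho> \<le> R" "\<And>z. z \<in> ball 0 \<rho> \<Longrightarrow> g z \<noteq> 0" "F holomorphic_on ball 0 \<rho>"
    "\<And>z. norm z < 1 \<Longrightarrow> F z = carath \<mu> z" "\<And>z. norm z \<le> 1 \<Longrightarrow> Re (F z) > 0"
    "\<And>z. norm z = 1 \<Longrightarrow> Re (F z) = 1 / (norm (g z))\<^sup>2"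
    "\<And>z. 1 / \<rho> < norm z \<Longrightarrow> norm z < \<rho> \<Longrightarrow> F z + cnj (F (1 / cnj z)) = 2 / (g z * cnj (g (1 / cnj z)))"
proof -
  have "open {z \<in> ball 0 R. g z \<noteq> 0}"
    using continuous_open_preimage[OF holomorphic_on_imp_continuous_on[OF g] open_ball, of "- {0}"]
    by (simp add: vimage_def Int_def open_Compl)
  moreover have "cball 0 1 \<subseteq> {z \<in> ball 0 R. g z \<noteq> 0}"
    using szego_inverse_nonzero[OF \<mu> R g inv] R by auto
  ultimately obtain r where r: "r > 1" "ball 0 r \<subseteq> {z \<in> ball 0 R. g z \<noteq> 0}"
    by (rule cball_enlarge)
  define \<rho> where "\<rho> = min r R"
  have \<rho>: "1 < \<rho>" "\<rho> \<le> R" using r R by (auto simp: \<rho>_def)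
  have gn: "g z \<noteq> 0" if "z \<in> ball 0 \<rho>" for z using r(2) that by (auto simp: \<rho>_def)
  have gh: "g holomorphic_on ball 0 \<rho>" by (rule holomorphic_on_subset[OF g]) (use \<rho> in auto)
  define W where "W z = 1 / (g z * cnj (g (1 / cnj z)))" for z
  define A where "A = {z::complex. 1 / \<rho> < norm z \<and> norm z < \<rho>}"
  have inA: "1 / cnj z \<in> ball 0 \<rho>" if "z \<in> A" for z
  proof -
    have "0 < 1 / \<rho>" using \<rho> by simp
    then have "0 < norm z" using that unfolding A_def by (metis (mono_tags, lifting) less_trans mem_Collect_eq)
    then show ?thesis using that \<rho> by (simp add: A_def norm_divide field_simps)
  qed
  have "(\<lambda>z. cnj (g (1 / cnj z))) holomorphic_on A"
    by (rule holomorphic_on_subset[OF holomorphic_reflect[OF gh]]) (use \<rho> in \<open>auto simp: A_def\<close>)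
  moreover have "g holomorphic_on A"
    by (rule holomorphic_on_subset[OF gh]) (auto simp: A_def)
  ultimately have "W holomorphic_on A"
    unfolding W_def using gn inA by (intro holomorphic_intros) (auto simp: A_def)
  then have W: "W holomorphic_on {z. 1 / \<rho> < norm z \<and> norm z < \<rho>}" by (simp add: A_def)
  have inv1: "1 / cnj z = z" if "norm z = 1" for z
    using circle_unit_power_quotient[of "cnj z" 0 1] that by simp
  have Wc: "W z = of_real (1 / (norm (g z))\<^sup>2)" if "norm z = 1" for z
    unfolding W_def inv1[OF that] by (simp add: complex_norm_square del: of_real_power)
  define w where "w \<theta> = 1 / (norm (g (cis \<theta>)))\<^sup>2" for \<theta>
  have Ww: "W (cis \<theta>) = of_real (w \<theta>)" for \<theta> using Wc[of "cis \<theta>"] by (simp add: w_def)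
  obtain F where F: "F holomorphic_on ball 0 \<rho>"
    "\<And>z. norm z < 1 \<Longrightarrow> F z = (\<integral>\<theta>. (cis \<theta> + z) / (cis \<theta> - z) * of_real (w \<theta>) \<partial>arc_measure)"
    "\<And>z. 1 / \<rho> < norm z \<Longrightarrow> norm z < \<rho> \<Longrightarrow> F z + cnj (F (1 / cnj z)) = 2 * W z"
    using carath_continuation[OF \<rho>(1) W Ww] by blast
  have ok: "szego_weight_ok \<mu> (szego_weight \<mu>)" by (rule szego_weight_ok_szego_weight[OF \<mu>(3)])
  have sm: "szego_weight \<mu> \<in> borel_measurable borel" and s0: "\<And>\<theta>. 0 \<le> szego_weight \<mu> \<theta>"
    using ok by (auto simp: szego_weight_ok_def ac_weight_def)
  have dens: "\<mu> = density arc_measure (\<lambda>\<theta>. ennreal (szego_weight \<mu> \<theta>))"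
    by (rule szego_weight_density[OF circle_prob_sets[OF \<mu>(1)] \<mu>(2) ok])
  have gc: "continuous_on (sphere 0 1) g"
    by (rule continuous_on_subset[OF holomorphic_on_imp_continuous_on[OF g]]) (use R in auto)
  have wm: "w \<in> borel_measurable borel"
    unfolding w_def using gn \<rho>
    by (intro borel_measurable_continuous_onI continuous_intros continuous_on_circle_comp gc) auto
  have AEw: "AE \<theta> in arc_measure. szego_weight \<mu> \<theta> = 1 / (norm (g (cis \<theta>)))\<^sup>2"
    by (rule szego_weight_circle[OF \<mu> \<rho>(1) gh]) (use gn inv in auto)
  have Fc: "F z = carath \<mu> z" if z: "norm z < 1" for z
  proof -
    have "carath \<mu> z = (\<integral>\<theta>. (cis \<theta> + z) / (cis \<theta> - z) * of_real (szego_weight \<mu> \<theta>) \<partial>arc_measure)"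
      using carath_density[OF sm s0] dens by simp
    also have "\<dots> = (\<integral>\<theta>. (cis \<theta> + z) / (cis \<theta> - z) * of_real (w \<theta>) \<partial>arc_measure)"
    proof (rule integral_cong_AE)
      show "AE \<theta> in arc_measure. (cis \<theta> + z) / (cis \<theta> - z) * complex_of_real (szego_weight \<mu> \<theta>)
          = (cis \<theta> + z) / (cis \<theta> - z) * complex_of_real (w \<theta>)"
        using AEw by eventually_elim (simp add: w_def)
      show "(\<lambda>\<theta>. (cis \<theta> + z) / (cis \<theta> - z) * complex_of_real (szego_weight \<mu> \<theta>)) \<in> borel_measurable arc_measure"
        using sm by measurable
      show "(\<lambda>\<theta>. (cis \<theta> + z) / (cis \<theta> - z) * complex_of_real (w \<theta>)) \<in> borel_measurable arc_measure"
        using wm by measurable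
    qed
    finally show ?thesis using F(2)[OF z] by simp
  qed
  have circ: "Re (F z) = 1 / (norm (g z))\<^sup>2" if "norm z = 1" for z
    using F(3)[of z] Wc[OF that] inv1[OF that] that \<rho> by (simp add: complex_eq_iff)
  have pos: "Re (F z) > 0" if "norm z \<le> 1" for z
  proof (cases "norm z < 1")
    case True
    have "0 < (norm (szego_fun \<mu> z))\<^sup>2" by (simp add: szego_fun_def)
    also have "\<dots> \<le> Re (carath \<mu> z)" by (rule szego_fun_sq_le_Re_carath[OF \<mu> True])
    finally show ?thesis by (simp add: Fc[OF True])
  next
    case False
    then show ?thesis using that circ[of z] gn[of z] \<rho> by simp
  qed
  show ?thesis
    by (rule that[OF \<rho> gn F(1) Fc pos circ]) (use F(3) in \<open>auto simp: W_def\<close>)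
qed

text \<open>The facts listed about \<open>shifted \<mu> 1\<close> and \<open>g1\<close> have the
  form of the hypotheses on \<open>\<mu>\<close> and \<open>g\<close>, so the step can be iterated
  with the same R.\<close>

lemma szego_step:
  fixes \<mu> :: "real measure" and R :: real and g :: "complex \<Rightarrow> complex"
  assumes \<mu>: "circle_prob \<mu>" "absolutely_continuous arc_measure \<mu>" "szego_cond \<mu>"
    and R: "R > 1" and g: "g holomorphic_on ball 0 R"
    and inv: "\<And>z. norm z < 1 \<Longrightarrow> g z = 1 / szego_fun \<mu> z"
  obtains K g1 where "K holomorphic_on ball 0 R" "g1 holomorphic_on ball 0 R" "g 0 \<noteq> 0"
    "\<And>z. z \<in> ball 0 R \<Longrightarrow> g z = 0 \<Longrightarrow> K z \<noteq> 0 \<and> g1 z \<noteq> 0"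
    "\<And>z. norm z < 1 \<Longrightarrow> K z / g z = carath \<mu> z"
    "\<And>z. norm z < 1 \<Longrightarrow> g1 z / g z = rel_szego \<mu> z"
    "\<And>z. norm z < 1 \<Longrightarrow> g1 z = 1 / szego_fun (shifted \<mu> 1) z"
    "circle_prob (shifted \<mu> 1)" "absolutely_continuous arc_measure (shifted \<mu> 1)" "szego_cond (shifted \<mu> 1)"
    "\<And>k. verblunsky (shifted \<mu> 1) k = verblunsky \<mu> (Suc k)"
proof -
  obtain \<rho> F where \<rho>: "1 < \<rho>" "\<rho> \<le> R" and gn: "\<And>z. z \<in> ball 0 \<rho> \<Longrightarrow> g z \<noteq> 0"
    and F: "F holomorphic_on ball 0 \<rho>" "\<And>z. norm z < 1 \<Longrightarrow> F z = carath \<mu> z" "\<And>z. norm z \<le> 1 \<Longrightarrow> Re (F z) > 0"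
    and circ: "\<And>z. norm z = 1 \<Longrightarrow> Re (F z) = 1 / (norm (g z))\<^sup>2"
    and refl: "\<And>z. 1 / \<rho> < norm z \<Longrightarrow> norm z < \<rho> \<Longrightarrow> F z + cnj (F (1 / cnj z)) = 2 / (g z * cnj (g (1 / cnj z)))"
    using carath_near_disc[OF \<mu> R g inv] by blast
  have gh: "g holomorphic_on ball 0 \<rho>" by (rule holomorphic_on_subset[OF g]) (use \<rho> in auto)
  define a where "a = exp (- (\<integral>\<theta>. ln (szego_weight \<mu> \<theta>) \<partial>arc_measure) / 2)"
  have g0: "g 0 = of_real a" "a > 0"
    using inv[of 0] by (simp_all add: a_def szego_fun_def exp_minus inverse_eq_divide flip: exp_of_real)
  define \<alpha> where "\<alpha> = verblunsky \<mu> 0"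
  define q where "q z = (if z = 0 then deriv F 0 else (F z - 1) / z)" for z
  define \<Delta> where "\<Delta> z = (1 + \<alpha>) * (F z + 1) - (1 + cnj \<alpha>) * q z" for z
  define s where "s = sqrt (1 - (norm \<alpha>)\<^sup>2)"
  have meas: "\<forall>z\<in>ball 0 1. F z = carath \<mu> z" "\<forall>z\<in>cball 0 1. Re (F z) > 0" "\<forall>z\<in>ball 0 \<rho>. g z \<noteq> 0"
      "\<forall>z\<in>sphere 0 1. Re (F z) = 1 / (norm (g z))\<^sup>2"
    using F gn circ by auto
  note sh = shifted_measure[OF \<mu>(1,2) \<rho>(1) F(1) meas(1,2) gh meas(3) g0 meas(4), folded \<alpha>_def, folded q_def, folded \<Delta>_def s_def]
  have \<alpha>1: "norm \<alpha> < 1" by (rule sh(1))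
  have s0: "s > 0" using \<alpha>1 by (simp add: s_def abs_square_less_1)
  \<comment> \<open>Together with the disc of radius rho this covers the large disc, and reflection
    maps it into the unit disc.\<close>
  define E where "E = {z::complex. 1 < norm z} \<inter> ball 0 R"
  have E: "open E" "ball 0 \<rho> \<union> E = ball 0 R"
    using \<rho> by (auto simp: E_def intro!: open_Int open_Collect_less continuous_intros)
  have rin: "norm (1 / cnj z) < 1" if "z \<in> E" for z
    using that by (auto simp: E_def norm_divide divide_less_eq)
  have Eann: "E \<subseteq> {z. 1 / \<rho> < norm z}"
  proof
    fix z assume "z \<in> E"
    then show "z \<in> {z. 1 / \<rho> < norm z}" using \<rho> less_trans[of "1 / \<rho>" 1 "norm z"] by (simp add: E_def)
  qed
  have rg: "(\<lambda>z. cnj (g (1 / cnj z))) holomorphic_on E" and rF: "(\<lambda>z. cnj (F (1 / cnj z))) holomorphic_on E"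
    using holomorphic_reflect[OF gh] holomorphic_reflect[OF F(1)] \<rho> Eann by (auto intro: holomorphic_on_subset)
  have gE: "g holomorphic_on E" by (rule holomorphic_on_subset[OF g]) (auto simp: E_def)
  have rgn: "cnj (g (1 / cnj z)) \<noteq> 0" if "z \<in> E" for z
    using gn[of "1 / cnj z"] rin[OF that] \<rho> by simp
  \<comment> \<open>The reflection identity solved for F and multiplied by \<open>g\<close>:
    division by \<open>g\<close> disappears except at reflected points, where \<open>g\<close> is
    nonzero.\<close>
  define Ko where "Ko z = 2 / cnj (g (1 / cnj z)) - g z * cnj (F (1 / cnj z))" for z
  define K where "K z = (if z \<in> ball 0 \<rho> then g z * F z else Ko z)" for z
  have Koh: "Ko holomorphic_on E"
    unfolding Ko_def using rgn by (intro holomorphic_intros rg rF gE) auto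
  have agree: "g z * F z = Ko z" if "z \<in> ball 0 \<rho>" "z \<in> E" for z
  proof -
    have "F z + cnj (F (1 / cnj z)) = 2 / (g z * cnj (g (1 / cnj z)))"
      using that Eann by (intro refl) auto
    then have "F z = 2 / (g z * cnj (g (1 / cnj z))) - cnj (F (1 / cnj z))"
      by (simp add: eq_diff_eq)
    then have "g z * F z = g z * (2 / (g z * cnj (g (1 / cnj z)))) - g z * cnj (F (1 / cnj z))"
      by (simp add: right_diff_distrib)
    then show ?thesis using gn[OF that(1)] by (simp add: Ko_def)
  qed
  have Kh: "K holomorphic_on ball 0 R"
    unfolding K_def E(2)[symmetric]
    by (rule holomorphic_on_If_Un[OF _ Koh open_ball E(1) agree]) (auto intro!: holomorphic_intros gh F)
  \<comment> \<open>This is g times \<open>\<Delta>\<close> / (2 s) with g F replaced by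
    \<open>Ko\<close>, so that it makes sense where F has a pole.\<close>
  define Go where "Go z = ((1 + \<alpha>) * (Ko z + g z) - (1 + cnj \<alpha>) * ((Ko z - g z) / z)) / (2 * of_real s)" for z
  define g1 where "g1 z = (if z \<in> ball 0 \<rho> then g z * \<Delta> z / (2 * of_real s) else Go z)" for z
  have E0: "z \<noteq> 0" if "z \<in> E" for z using that by (auto simp: E_def)
  have Goh: "Go holomorphic_on E"
    unfolding Go_def using E0 s0 by (intro holomorphic_intros Koh gE) auto
  have agree1: "g z * \<Delta> z / (2 * of_real s) = Go z" if "z \<in> ball 0 \<rho>" "z \<in> E" for z
    unfolding Go_def agree[OF that, symmetric] \<Delta>_def q_def using E0[OF that(2)] by (simp add: field_simps)
  have g1h: "g1 holomorphic_on ball 0 R"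
    unfolding g1_def E(2)[symmetric]
    by (rule holomorphic_on_If_Un[OF _ Goh open_ball E(1) agree1])
       (use s0 in \<open>auto intro!: holomorphic_intros gh sh(2)\<close>)
  \<comment> \<open>At a zero of \<open>g\<close> only 2 / cnj (g(1 / cnj z)) survives in
    \<open>Ko\<close>, and \<open>Go\<close> becomes \<open>Ko\<close> times a factor whose zeros
    could only lie on the circle.\<close>
  have K0: "K z \<noteq> 0 \<and> g1 z \<noteq> 0" if z: "z \<in> ball 0 R" "g z = 0" for z
  proof -
    have out: "z \<notin> ball 0 \<rho>" using gn z(2) by auto
    then have zE: "z \<in> E" using E(2) z(1) by blast
    have Kz: "Ko z \<noteq> 0" using rgn[OF zE] z(2) by (simp add: Ko_def)
    have "(1 + \<alpha>) * z \<noteq> 1 + cnj \<alpha>"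
    proof
      assume "(1 + \<alpha>) * z = 1 + cnj \<alpha>"
      then have "norm (1 + \<alpha>) * norm z = norm (1 + cnj \<alpha>)" by (metis norm_mult)
      also have "norm (1 + cnj \<alpha>) = norm (1 + \<alpha>)"
        by (metis complex_cnj_add complex_cnj_one complex_mod_cnj)
      finally have "norm (1 + \<alpha>) = 0 \<or> norm z = 1" by simp
      moreover have "1 + \<alpha> \<noteq> 0" using \<alpha>1 by (metis add_eq_0_iff less_irrefl norm_minus_cancel norm_one)
      ultimately show False using zE by (auto simp: E_def)
    qed
    moreover have "Go z = Ko z * ((1 + \<alpha>) * z - (1 + cnj \<alpha>)) / (2 * of_real s * z)"
      using z(2) E0[OF zE] s0 by (simp add: Go_def field_simps)
    ultimately have "Go z \<noteq> 0" using Kz E0[OF zE] s0 by simp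
    then show ?thesis using out Kz by (simp add: K_def g1_def)
  qed
  have in1: "z \<in> ball 0 \<rho>" if "norm z < 1" for z using that \<rho> by simp
  show ?thesis
  proof (rule that[OF Kh g1h _ K0])
    show "g 0 \<noteq> 0" using g0 by simp
    show "K z / g z = carath \<mu> z" if "norm z < 1" for z
      using in1[OF that] gn[OF in1[OF that]] F(2)[OF that] by (simp add: K_def)
    show "g1 z / g z = rel_szego \<mu> z" if "norm z < 1" for z
      using in1[OF that] gn[OF in1[OF that]] sh(8)[OF that] by (simp add: g1_def)
    show "g1 z = 1 / szego_fun (shifted \<mu> 1) z" if "norm z < 1" for z
      using in1[OF that] sh(7)[OF that] by (simp add: g1_def)
  qed (use sh in auto)
qed

text \<open>Induction over all measures and all \<open>g\<close> at once, since each step replaces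
  both.\<close>

theorem szego_inverse_shifted:
  fixes g :: "complex \<Rightarrow> complex"
  assumes \<mu>: "circle_prob \<mu>" "absolutely_continuous arc_measure \<mu>" "szego_cond \<mu>"
    and R: "R > 1" and g: "g holomorphic_on ball 0 R"
    and inv: "\<And>z. norm z < 1 \<Longrightarrow> g z = 1 / szego_fun \<mu> z"
  shows "\<exists>h. h holomorphic_on ball 0 R \<and> (\<forall>z\<in>ball 0 1. h z = 1 / szego_fun (shifted \<mu> (Suc n)) z)"
  using assms
proof (induction n arbitrary: \<mu> g)
  case 0
  obtain g1 where "g1 holomorphic_on ball 0 R" "\<And>z. norm z < 1 \<Longrightarrow> g1 z = 1 / szego_fun (shifted \<mu> 1) z"
    using szego_step[OF 0] by metis
  then show ?case by auto
next
  case (Suc n)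
  obtain g1 where g1: "g1 holomorphic_on ball 0 R" "\<And>z. norm z < 1 \<Longrightarrow> g1 z = 1 / szego_fun (shifted \<mu> 1) z"
    "circle_prob (shifted \<mu> 1)" "absolutely_continuous arc_measure (shifted \<mu> 1)" "szego_cond (shifted \<mu> 1)"
    "\<And>k. verblunsky (shifted \<mu> 1) k = verblunsky \<mu> (Suc k)"
    using szego_step[OF Suc.prems] by metis
  \<comment> \<open>Both descriptions prescribe the same Verblunsky coefficients, so they are the
    same term after rewriting.\<close>
  have "shifted \<mu> (Suc (Suc n)) = shifted (shifted \<mu> 1) (Suc n)"
    unfolding shifted_def[of \<mu> "Suc (Suc n)"] shifted_def[of "shifted \<mu> 1" "Suc n"] g1(6) by simp
  then show ?case using Suc.IH[OF g1(3-5) Suc.prems(4) g1(1,2)] by simp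
qed

theorem theorem2p5:
  fixes \<mu> :: "real measure" and R :: real and g :: "complex \<Rightarrow> complex"
  assumes prob: "circle_prob \<mu>"
    and no_sing: "absolutely_continuous arc_measure \<mu>"
    and szego: "szego_cond \<mu>"
    and R: "R > 1"
    and g_hol: "g holomorphic_on ball 0 R"
    and g_inv: "\<forall>z\<in>ball 0 1. g z = 1 / szego_fun \<mu> z"
  shows "(\<exists>G H.
            G meromorphic_on ball 0 R \<and>
            (\<forall>z\<in>ball 0 1. G z = carath \<mu> z) \<and>
            G holomorphic_on (ball 0 R - {z. g z = 0}) \<and>
            {z\<in>ball 0 R. is_pole G z} = {z\<in>ball 0 R. g z = 0} \<and>
            (\<forall>z\<in>ball 0 R. g z = 0 \<longrightarrow> zorder G z = - zorder g z) \<and>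
            H meromorphic_on ball 0 R \<and>
            (\<forall>z\<in>ball 0 1. H z = rel_szego \<mu> z) \<and>
            H holomorphic_on (ball 0 R - {z. is_pole G z}) \<and>
            {z\<in>ball 0 R. is_pole H z} = {z\<in>ball 0 R. is_pole G z} \<and>
            (\<forall>z\<in>ball 0 R. is_pole G z \<longrightarrow> - zorder H z \<le> - zorder G z))
         \<and> (\<exists>g1. g1 holomorphic_on ball 0 R \<and>
                 (\<forall>z\<in>ball 0 1. g1 z = 1 / szego_fun (shifted \<mu> 1) z))
         \<and> (\<forall>n\<ge>1. \<exists>gn. gn holomorphic_on ball 0 R \<and>
                 (\<forall>z\<in>ball 0 1. gn z = 1 / szego_fun (shifted \<mu> n) z))"
proof -
  have inv: "\<And>z. norm z < 1 \<Longrightarrow> g z = 1 / szego_fun \<mu> z" using g_inv by simp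
  have shift: "\<exists>h. h holomorphic_on ball 0 R \<and> (\<forall>z\<in>ball 0 1. h z = 1 / szego_fun (shifted \<mu> (Suc n)) z)" for n
    by (rule szego_inverse_shifted[OF prob no_sing szego R g_hol inv])
  obtain K g1 where K: "K holomorphic_on ball 0 R" and g1: "g1 holomorphic_on ball 0 R" and g0: "g 0 \<noteq> 0"
    and nz: "\<And>z. z \<in> ball 0 R \<Longrightarrow> g z = 0 \<Longrightarrow> K z \<noteq> 0 \<and> g1 z \<noteq> 0"
    and G: "\<And>z. norm z < 1 \<Longrightarrow> K z / g z = carath \<mu> z"
    and H: "\<And>z. norm z < 1 \<Longrightarrow> g1 z / g z = rel_szego \<mu> z"
    using szego_step[OF prob no_sing szego R g_hol inv] by metis
  have R0: "0 \<in> ball 0 R" using R by simp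
  note qK = quotient_pole[OF K g_hol g0] and q1 = quotient_pole[OF g1 g_hol g0]
  have poleG: "is_pole (\<lambda>z. K z / g z) z \<longleftrightarrow> g z = 0" if "z \<in> ball 0 R" for z
    using qK(2,4)[OF that] nz[OF that] by blast
  have poleH: "is_pole (\<lambda>z. g1 z / g z) z \<longleftrightarrow> g z = 0" if "z \<in> ball 0 R" for z
    using q1(2,4)[OF that] nz[OF that] by blast
  have hol: "(\<lambda>z. A z / g z) holomorphic_on (ball 0 R - {z. g z = 0})" if "A holomorphic_on ball 0 R" for A
    by (intro holomorphic_intros holomorphic_on_subset[OF that] holomorphic_on_subset[OF g_hol]) auto
  have sub: "ball 0 R - {z. is_pole (\<lambda>z. K z / g z) z} \<subseteq> ball 0 R - {z. g z = 0}"
    using poleG by blast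
  have "\<exists>G H.
            G meromorphic_on ball 0 R \<and>
            (\<forall>z\<in>ball 0 1. G z = carath \<mu> z) \<and>
            G holomorphic_on (ball 0 R - {z. g z = 0}) \<and>
            {z\<in>ball 0 R. is_pole G z} = {z\<in>ball 0 R. g z = 0} \<and>
            (\<forall>z\<in>ball 0 R. g z = 0 \<longrightarrow> zorder G z = - zorder g z) \<and>
            H meromorphic_on ball 0 R \<and>
            (\<forall>z\<in>ball 0 1. H z = rel_szego \<mu> z) \<and>
            H holomorphic_on (ball 0 R - {z. is_pole G z}) \<and>
            {z\<in>ball 0 R. is_pole H z} = {z\<in>ball 0 R. is_pole G z} \<and>
            (\<forall>z\<in>ball 0 R. is_pole G z \<longrightarrow> - zorder H z \<le> - zorder G z)"
  proof (rule exI[of _ "\<lambda>z. K z / g z"], rule exI[of _ "\<lambda>z. g1 z / g z"], intro conjI ballI impI)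
    show "(\<lambda>z. K z / g z) meromorphic_on ball 0 R" by (rule qK(1)[OF R0])
    show "(\<lambda>z. g1 z / g z) meromorphic_on ball 0 R" by (rule q1(1)[OF R0])
    show "(\<lambda>z. K z / g z) holomorphic_on (ball 0 R - {z. g z = 0})" by (rule hol[OF K])
    show "(\<lambda>z. g1 z / g z) holomorphic_on (ball 0 R - {z. is_pole (\<lambda>z. K z / g z) z})"
      by (rule holomorphic_on_subset[OF hol[OF g1] sub])
    show "{z \<in> ball 0 R. is_pole (\<lambda>z. K z / g z) z} = {z \<in> ball 0 R. g z = 0}"
      using poleG by blast
    show "{z \<in> ball 0 R. is_pole (\<lambda>z. g1 z / g z) z} = {z \<in> ball 0 R. is_pole (\<lambda>z. K z / g z) z}"
      using poleG poleH by blast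
    fix z :: complex
    show "K z / g z = carath \<mu> z" "g1 z / g z = rel_szego \<mu> z" if "z \<in> ball 0 1"
      using that G H by auto
    show "zorder (\<lambda>z. K z / g z) z = - zorder g z" if "z \<in> ball 0 R" "g z = 0"
      using qK(3)[OF that] nz[OF that] by blast
    \<comment> \<open>Both orders are equal here: each quotient has a pole whose order is that of
      the zero of \<open>g\<close>.\<close>
    show "- zorder (\<lambda>z. g1 z / g z) z \<le> - zorder (\<lambda>z. K z / g z) z"
      if z: "z \<in> ball 0 R" "is_pole (\<lambda>z. K z / g z) z"
      using qK(3)[OF z(1)] q1(3)[OF z(1)] nz[OF z(1)] poleG[OF z(1)] z(2) by simp
  qed
  moreover have "\<exists>gn. gn holomorphic_on ball 0 R \<and> (\<forall>z\<in>ball 0 1. gn z = 1 / szego_fun (shifted \<mu> n) z)"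
    if "n \<ge> 1" for n
    using shift[of "n - 1"] that by simp
  ultimately show ?thesis by auto
qed

end
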